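(* Let $G$ be a planar map and let $x_0,x_1,x_2$ be three distinct vertices occurring in counterclockwise order on the outer face of $G$. Let $G^+$ be the toroidal map obtained as follows: add a vertex $v$ in the outer face of $G$, embed the result on the torus and add at $v$ three non-parallel (pairwise non-homotopic) non-contractible loops, and join each $x_i$ to $v$ by an edge (the edge replacing the half-edge of the suspension at $x_i$) such that no two of these three edges enter $v$ consecutively. Then the planar Schnyder woods of $G$ rooted at $x_0,x_1,x_2$ are in bijection with the (toroidal) Schnyder woods of $G^+$.
   Context: The suspension $G^\sigma$ of $G$ is obtained by attaching to each $x_i$ a half-edge reaching into the outer face. All orientations/colorings below use colors $0,1,2$ (indices modulo 3), each edge being oriented in one direction or in two opposite directions (each direction then having a distinct color). A vertex $v$ satisfies the Schnyder property if it has out-degree exactly one in each color, the edges $e_0(v),e_1(v),e_2(v)$ leaving it in colors $0,1,2$ occur in counterclockwise order, and each edge entering $v$ in color $i$ enters in the counterclockwise sector from $e_{i+1}(v)$ to $e_{i-1}(v)$. A monochromatic cycle of color $i$ is a directed cycle formed by edges colored $i$, oriented by color $i$. A planar Schnyder wood rooted at $x_0,x_1,x_2$ is such an orientation and coloring of $G^\sigma$ with (P1) every vertex satisfies the Schnyder property and the half-edge at $x_i$ is directed outwards and colored $i$; (P2) there is no monochromatic cycle. A toroidal map is a graph embedded on the torus with no contractible loop, no two edges with the same endpoints forming a contractible cycle, and all faces open disks. A (toroidal) Schnyder wood of a toroidal map is such an orientation and coloring of its edges with (T1) every vertex satisfies the Schnyder property; (T2) every monochromatic cycle of color $i$ intersects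 at least one monochromatic cycle of color $i-1$ and at least one of color $i+1$.
   Formalization: As literally stated the claim fails (the triangle has 1 planar but 6 toroidal Schnyder woods); the bijection proved is with the toroidal Schnyder woods of G^+ up to a cyclic shift of the colors and disregarding the orientation and coloring of the three loops at v. *)

theory Defs
  imports "HOL-Combinatorics.Combinatorics" "HOL-Library.Numeral_Type"
begin

section \<open>Maps on oriented surfaces\<close>

text \<open>
  A graph embedded on an oriented surface is given by its rotation system.  The darts are the
  directed edges, each one based at its origin; \<open>rot\<close> sends a dart to the next one in
  counterclockwise order around the same vertex, and \<open>opp\<close> reverses a dart.  Vertices and edges
  are the orbits of \<open>rot\<close> and \<open>opp\<close>.  A fixed point of \<open>opp\<close> is a half-edge; maps proper
  (\<open>comb_map\<close>) have none, they only occur in suspensions.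

  Being cellular, a connected rotation system always has open disks as faces.  All connected maps
  with at least two vertices or at least one edge are covered (an isolated vertex has no darts).
\<close>

record 'a cmap =
  darts :: "'a set"
  rot :: "'a \<Rightarrow> 'a"
  opp :: "'a \<Rightarrow> 'a"

definition comb_map :: "'a cmap \<Rightarrow> bool" where
  "comb_map M \<longleftrightarrow> finite (darts M) \<and> darts M \<noteq> {} \<and>
     rot M permutes darts M \<and> opp M permutes darts M \<and>
     (\<forall>d\<in>darts M. opp M d \<noteq> d \<and> opp M (opp M d) = d)"

definition connected_map :: "'a cmap \<Rightarrow> bool" where
  "connected_map M \<longleftrightarrow>
     (\<forall>d\<in>darts M. \<forall>e\<in>darts M. (d, e) \<in> {(x, y). y = rot M x \<or> y = opp M x}\<^sup>*)"

definition vertex_of :: "'a cmap \<Rightarrow> 'a \<Rightarrow> 'a set" where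
  "vertex_of M d = orbit (rot M) d"

definition vertices :: "'a cmap \<Rightarrow> 'a set set" where
  "vertices M = vertex_of M ` darts M"

definition edges :: "'a cmap \<Rightarrow> 'a set set" where
  "edges M = orbit (opp M) ` darts M"

text \<open>
  The face incident to a dart \<open>d\<close> is the one on the right of \<open>d\<close>.  Arriving at the end of \<open>d\<close>, the
  next dart with this face on its right is the one following \<open>opp d\<close> counterclockwise.  Inner
  faces of a plane map are thus traversed clockwise, while the outer face is traversed
  counterclockwise around the map.  The corner of the face at the origin of \<open>d\<close> is the sector
  between the counterclockwise predecessor of \<open>d\<close> and \<open>d\<close>.
\<close>

definition face_next :: "'a cmap \<Rightarrow> 'a \<Rightarrow> 'a" where
  "face_next M d = rot M (opp M d)"

definition faces :: "'a cmap \<Rightarrow> 'a set set" where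
  "faces M = orbit (face_next M) ` darts M"

definition euler_char :: "'a cmap \<Rightarrow> int" where
  "euler_char M = int (card (vertices M)) - int (card (edges M)) + int (card (faces M))"

definition planar_map :: "'a cmap \<Rightarrow> bool" where
  "planar_map M \<longleftrightarrow> comb_map M \<and> connected_map M \<and> euler_char M = 2"

text \<open>
  Iterating the permutation \<open>p\<close> from \<open>x\<close>, one meets \<open>x\<close>, \<open>y\<close>, \<open>z\<close> in this order within one
  period (in particular they are distinct).
\<close>

definition cyclic_order :: "('a \<Rightarrow> 'a) \<Rightarrow> 'a \<Rightarrow> 'a \<Rightarrow> 'a \<Rightarrow> bool" where
  "cyclic_order p x y z \<longleftrightarrow>
     (\<exists>k l. 0 < k \<and> k < l \<and> l < card (orbit p x) \<and> y = (p ^^ k) x \<and> z = (p ^^ l) x)"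

section \<open>Contractible cycles and toroidal maps\<close>

definition is_walk :: "'a cmap \<Rightarrow> 'a list \<Rightarrow> bool" where
  "is_walk M ds \<longleftrightarrow> set ds \<subseteq> darts M \<and>
     successively (\<lambda>d e. vertex_of M (opp M d) = vertex_of M e) ds"

definition face_walk :: "'a cmap \<Rightarrow> 'a \<Rightarrow> 'a list" where
  "face_walk M d = map (\<lambda>k. (face_next M ^^ k) d) [0..<card (orbit (face_next M) d)]"

text \<open>
  As all faces are disks, two walks in the graph are homotopic on the surface iff they are related
  by inserting and deleting spurs (a dart followed by its reverse) and boundaries of faces.
\<close>

inductive homotopy_step :: "'a cmap \<Rightarrow> 'a list \<Rightarrow> 'a list \<Rightarrow> bool" for M where
  spur: "is_walk M (u @ [d, opp M d] @ w) \<Longrightarrow> homotopy_step M (u @ [d, opp M d] @ w) (u @ w)"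
| face: "is_walk M (u @ face_walk M d @ w) \<Longrightarrow> homotopy_step M (u @ face_walk M d @ w) (u @ w)"

definition contractible_walk :: "'a cmap \<Rightarrow> 'a list \<Rightarrow> bool" where
  "contractible_walk M ds \<longleftrightarrow> equivclp (homotopy_step M) ds []"

text \<open>
  In the last clause \<open>d\<close> and \<open>e\<close> may be loops at the same vertex; as \<open>e\<close> ranges over both darts of
  an edge, the clause then says that the two loops are not homotopic in either direction, that is,
  not parallel.
\<close>

definition toroidal_map :: "'a cmap \<Rightarrow> bool" where
  "toroidal_map M \<longleftrightarrow> comb_map M \<and> connected_map M \<and> euler_char M = 0 \<and>
     (\<forall>d\<in>darts M. vertex_of M d = vertex_of M (opp M d) \<longrightarrow> \<not> contractible_walk M [d]) \<and>
     (\<forall>d\<in>darts M. \<forall>e\<in>darts M.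
        e \<noteq> d \<and> e \<noteq> opp M d \<and> vertex_of M d = vertex_of M e \<and>
        vertex_of M (opp M d) = vertex_of M (opp M e) \<longrightarrow>
          \<not> contractible_walk M [d, opp M e])"

section \<open>Schnyder woods\<close>

text \<open>
  Colors are elements of the type \<open>3\<close>, the integers modulo 3.  An orientation and coloring is a
  function \<open>f\<close> on darts: \<open>f d = Some i\<close> means that the edge of \<open>d\<close> is oriented in the direction of
  \<open>d\<close>, with color \<open>i\<close> in this direction, and \<open>f d = None\<close> that it is not oriented in this direction.
\<close>

type_synonym color = 3

definition orientation_coloring :: "'a cmap \<Rightarrow> ('a \<Rightarrow> color option) \<Rightarrow> bool" where
  "orientation_coloring M f \<longleftrightarrow>
     (\<forall>d. d \<notin> darts M \<longrightarrow> f d = None) \<and>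
     (\<forall>d\<in>darts M. f d \<noteq> None \<or> f (opp M d) \<noteq> None) \<and>
     (\<forall>d\<in>darts M. opp M d \<noteq> d \<longrightarrow> f d \<noteq> f (opp M d))"

definition out_dart :: "('a \<Rightarrow> color option) \<Rightarrow> 'a set \<Rightarrow> color \<Rightarrow> 'a" where
  "out_dart f v i = (THE d. d \<in> v \<and> f d = Some i)"

text \<open>
  The sector of incoming edges is closed: an edge entering in color \<open>i\<close> may be bidirected and
  coincide with one of the two outgoing edges bounding the sector.
\<close>

definition schnyder_property :: "'a cmap \<Rightarrow> ('a \<Rightarrow> color option) \<Rightarrow> 'a set \<Rightarrow> bool" where
  "schnyder_property M f v \<longleftrightarrow>
     (\<forall>i. \<exists>!d. d \<in> v \<and> f d = Some i) \<and>
     cyclic_order (rot M) (out_dart f v 0) (out_dart f v 1) (out_dart f v 2) \<and>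
     (\<forall>d\<in>v. \<forall>i. opp M d \<noteq> d \<and> f (opp M d) = Some i \<longrightarrow>
        d = out_dart f v (i + 1) \<or> d = out_dart f v (i - 1) \<or>
        cyclic_order (rot M) (out_dart f v (i + 1)) d (out_dart f v (i - 1)))"

definition mono_cycle ::
    "'a cmap \<Rightarrow> ('a \<Rightarrow> color option) \<Rightarrow> color \<Rightarrow> 'a list \<Rightarrow> bool" where
  "mono_cycle M f i ds \<longleftrightarrow> ds \<noteq> [] \<and> is_walk M ds \<and>
     vertex_of M (opp M (last ds)) = vertex_of M (hd ds) \<and>
     distinct (map (vertex_of M) ds) \<and>
     (\<forall>d\<in>set ds. opp M d \<noteq> d \<and> f d = Some i)"

definition cycles_intersect :: "'a cmap \<Rightarrow> 'a list \<Rightarrow> 'a list \<Rightarrow> bool" where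
  "cycles_intersect M ds es \<longleftrightarrow> vertex_of M ` set ds \<inter> vertex_of M ` set es \<noteq> {}"

definition toroidal_schnyder_wood :: "'a cmap \<Rightarrow> ('a \<Rightarrow> color option) \<Rightarrow> bool" where
  "toroidal_schnyder_wood M f \<longleftrightarrow> orientation_coloring M f \<and>
     (\<forall>v\<in>vertices M. schnyder_property M f v) \<and>
     (\<forall>i ds. mono_cycle M f i ds \<longrightarrow>
        (\<exists>es. mono_cycle M f (i - 1) es \<and> cycles_intersect M ds es) \<and>
        (\<exists>es. mono_cycle M f (i + 1) es \<and> cycles_intersect M ds es))"

text \<open>
  For three distinct corners \<open>c 0, c 1, c 2\<close>, a half-edge \<open>Inr i\<close> is inserted into the corner
  \<open>c i\<close>, that is, immediately before the dart \<open>c i\<close> in counterclockwise order.  If the \<open>c i\<close> are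
  corners of the outer face at \<open>x\<^sub>0, x\<^sub>1, x\<^sub>2\<close>, this is the suspension.
\<close>

definition suspension :: "'a cmap \<Rightarrow> (3 \<Rightarrow> 'a) \<Rightarrow> ('a + 3) cmap" where
  "suspension M c =
     \<lparr> darts = Inl ` darts M \<union> range Inr,
       rot = (\<lambda>x. case x of
                Inl d \<Rightarrow> if rot M d \<in> range c then Inr (inv c (rot M d)) else Inl (rot M d)
              | Inr i \<Rightarrow> Inl (c i)),
       opp = map_sum (opp M) id \<rparr>"

definition planar_schnyder_wood ::
    "'a cmap \<Rightarrow> (3 \<Rightarrow> 'a) \<Rightarrow> ('a + 3 \<Rightarrow> color option) \<Rightarrow> bool" where
  "planar_schnyder_wood G c f \<longleftrightarrow> orientation_coloring (suspension G c) f \<and>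
     (\<forall>v\<in>vertices (suspension G c). schnyder_property (suspension G c) f v) \<and>
     (\<forall>i. f (Inr i) = Some i) \<and>
     (\<nexists>i ds. mono_cycle (suspension G c) f i ds)"

section \<open>The toroidal map \<open>G\<^sup>+\<close>\<close>

text \<open>
  Let \<open>B\<close> be a one-vertex toroidal map with three loops, and let \<open>b 0, b 1, b 2\<close> be distinct
  corners of \<open>B\<close>.  Add a half-edge in each corner \<open>c i\<close> of \<open>G\<close> and \<open>b i\<close> of \<open>B\<close>, and join the
  half-edges number \<open>i\<close> into one edge from \<open>x\<^sub>i\<close> to the vertex of \<open>B\<close>.  Since the corners \<open>b i\<close> are
  distinct, no two of the new edges are consecutive at the vertex of \<open>B\<close>.  The edges can be drawn
  without crossings on the torus, with \<open>G\<close> inside a face of \<open>B\<close>, iff the result has Euler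
  characteristic 0.
\<close>

definition G_plus ::
    "'a cmap \<Rightarrow> (3 \<Rightarrow> 'a) \<Rightarrow> 'b cmap \<Rightarrow> (3 \<Rightarrow> 'b) \<Rightarrow> (('a + 3) + ('b + 3)) cmap" where
  "G_plus G c B b =
     \<lparr> darts = darts (suspension G c) <+> darts (suspension B b),
       rot = map_sum (rot (suspension G c)) (rot (suspension B b)),
       opp = (\<lambda>x. case x of
                Inl (Inl d) \<Rightarrow> Inl (Inl (opp G d))
              | Inl (Inr i) \<Rightarrow> Inr (Inr i)
              | Inr (Inl d) \<Rightarrow> Inr (Inl (opp B d))
              | Inr (Inr i) \<Rightarrow> Inl (Inr i)) \<rparr>"

text \<open>
  Toroidal Schnyder woods, unlike rooted planar ones, can be rotated in their colors, and the
  Schnyder property at the new vertex leaves two choices for its loops: reversing all three loops,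
  with a suitable recoloring, preserves it.  Woods that differ only in this are identified.
\<close>

definition wood_equiv ::
    "'a cmap \<Rightarrow> (3 \<Rightarrow> 'a) \<Rightarrow> 'b cmap \<Rightarrow> (3 \<Rightarrow> 'b) \<Rightarrow>
     ((('a + 3) + ('b + 3) \<Rightarrow> color option) \<times> (('a + 3) + ('b + 3) \<Rightarrow> color option)) set" where
  "wood_equiv G c B b =
     {(g, h). toroidal_schnyder_wood (G_plus G c B b) g \<and>
              toroidal_schnyder_wood (G_plus G c B b) h \<and>
              (\<exists>k. \<forall>d \<in> darts (G_plus G c B b) - range (Inr \<circ> Inl).
                 h d = map_option (\<lambda>i. i + k) (g d))}"

definition toroidal_extensions ::
    "'a cmap \<Rightarrow> (3 \<Rightarrow> 'a) \<Rightarrow> 'b cmap \<Rightarrow> (3 \<Rightarrow> 'b) \<Rightarrow> ('a + 3 \<Rightarrow> color option) \<Rightarrow>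
     (('a + 3) + ('b + 3) \<Rightarrow> color option) set" where
  "toroidal_extensions G c B b f =
     {g. toroidal_schnyder_wood (G_plus G c B b) g \<and>
         (\<exists>k. \<forall>d \<in> darts (suspension G c). g (Inl d) = map_option (\<lambda>i. i + k) (f d))}"

end

theory Submission
  imports Defs
begin

text \<open>
  Euler's formula forces the three new edges into the three corners of one triangular face of
  \<open>B\<close>, so that around the new vertex \<open>v\<close> they alternate with pairs of loop darts.  Each loop needs an outgoing dart, \<open>v\<close>
  has only three, and so \<open>v\<close> has one per loop and none towards \<open>G\<close>; the Schnyder property then makes
  the outgoing loop darts alternate and determines the colors of the new edges up to a common shift.  Conversely
  a planar wood extends with the loops as its only monochromatic cycles, all through \<open>v\<close>.

  It remains to exclude monochromatic cycles of a toroidal wood inside \<open>G\<close>.  Let \<open>C\<close> be one of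
  color \<open>i\<close> whose interior is minimal.  If the interior is on its left, put \<open>s = 1\<close>, else \<open>s = -1\<close>:
  following color \<open>i + s\<close> from \<open>C\<close> one never leaves the disk, which yields a cycle of color \<open>i + s\<close>;
  by minimality it is \<open>C\<close> reversed.  Then color \<open>i - s\<close> leaves the vertices of \<open>C\<close> to the outside
  and enters them only from the inside, so no cycle of color \<open>i - s\<close> meets \<open>C\<close>, contrary to (T2).
\<close>

section \<open>Cyclic orders\<close>

text \<open>The interior of a cycle has to be produced without topology. It is a set of faces whose
  boundary modulo 2 is the cycle, and its existence is a dimension count over the field with two
  elements. Such a set is determined only up to complement; the half-edges mark the outer face, and
  the interior is the choice avoiding them. That the second cycle has its interior within the first
  is again a boundary argument: its faces outside would, together with the first interior, form a
  nonempty set without boundary, hence by connectedness everything, the outer face included. On the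
  torus, the absence of contractible and of parallel loops excludes faces of \<open>B\<close> of
  degree 1 and 2, so that the two darts of a loop are opposite around the vertex and both faces are
  triangles. The face count of \<open>G_plus\<close> is tight only if the three new edges, taken
  towards the new vertex, lie on three different faces; tracing these faces fixes the places where
  the edges arrive.\<close>

lemma color_cases: "i = 0 \<or> i = 1 \<or> i = (2::3)"
proof (cases i)
  case (of_int z)
  then have "z = 0 \<or> z = 1 \<or> z = 2" by auto
  then show ?thesis using of_int by auto
qed

lemma UNIV_color: "(UNIV :: 3 set) = {0, 1, 2}"
  using color_cases by auto

lemma all_color: "(\<forall>i::3. P i) \<longleftrightarrow> P 0 \<and> P 1 \<and> P 2"
  using color_cases by metis

lemma color_ne [simp]: "i + 1 \<noteq> (i::3)" "i - 1 \<noteq> (i::3)" "i \<noteq> i + 1" "i \<noteq> i - 1"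
  "i + 1 \<noteq> i - 1" "i - 1 \<noteq> i + 1"
  using color_cases[of i] by auto

lemma color_arith [simp]: "i + 1 + 1 = i - (1::3)" "i - 1 - 1 = i + (1::3)" "i + 1 - 1 = (i::3)" "i - 1 + 1 = (i::3)"
  "i - 2 = i + (1::3)" "i + 2 = i - (1::3)"
  using color_cases[of i] by auto

lemma color_consts: "(3::3) = 0" "(4::3) = 1" "- 1 = (2::3)" "- 2 = (1::3)" "- 3 = (0::3)"
  by simp_all

lemma card_orbit_pos: "x \<in> orbit p x \<Longrightarrow> 0 < card (orbit p x)"
  using finite_orbit card_gt_0_iff by fastforce

text \<open>\<open>cyclic_order\<close> measures the period by the cardinality of the orbit,
  iteration measures it by \<open>funpow_dist1\<close>. Identifying the two makes exponents below
  this cardinality usable as coordinates on the orbit.\<close>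

lemma funpow_card_orbit:
  assumes "x \<in> orbit p x"
  shows "(p ^^ card (orbit p x)) x = x"
    and "inj_on (\<lambda>n. (p ^^ n) x) {..<card (orbit p x)}"
    and "orbit p x = (\<lambda>n. (p ^^ n) x) ` {..<card (orbit p x)}"
proof -
  let ?n = "funpow_dist1 p x x"
  have eq: "orbit p x = (\<lambda>n. (p ^^ n) x) ` {..<?n}"
    using orbit_conv_funpow_dist1[OF assms] by (simp add: lessThan_atLeast0)
  have inj: "inj_on (\<lambda>n. (p ^^ n) x) {..<?n}"
    using inj_on_funpow_dist1[OF assms] by (simp add: lessThan_atLeast0)
  have card: "card (orbit p x) = ?n"
    using eq card_image[OF inj] by simp
  show "(p ^^ card (orbit p x)) x = x"
    unfolding card by (rule funpow_dist1_prop[OF assms])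
  show "inj_on (\<lambda>n. (p ^^ n) x) {..<card (orbit p x)}"
    unfolding card by (rule inj)
  show "orbit p x = (\<lambda>n. (p ^^ n) x) ` {..<card (orbit p x)}"
    unfolding card by (rule eq)
qed

lemma orbit_index:
  assumes "x \<in> orbit p x" "y \<in> orbit p x"
  obtains k where "k < card (orbit p x)" "y = (p ^^ k) x"
  using equalityD1[OF funpow_card_orbit(3)[OF assms(1)], THEN subsetD, OF assms(2)] that by blast

lemma funpow_orbit_inj:
  assumes "x \<in> orbit p x" "(p ^^ k) x = (p ^^ l) x" "k < card (orbit p x)" "l < card (orbit p x)"
  shows "k = l"
  using funpow_card_orbit(2)[OF assms(1)] assms(2-4) by (auto dest: inj_onD)

lemma orbit_eq_of_mem:
  assumes "x \<in> orbit p x" "y \<in> orbit p x"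
  shows "orbit p y = orbit p x"
  using assms by (blast intro: orbit_trans orbit_swap)

lemma cyclic_orderI:
  assumes "x \<in> orbit p x" "y = (p ^^ k) x" "z = (p ^^ l) x" "0 < k" "k < l" "l < card (orbit p x)"
  shows "cyclic_order p x y z"
  unfolding cyclic_order_def using assms by blast

lemma cyclic_order_mem:
  assumes "x \<in> orbit p x" "cyclic_order p x y z"
  shows "y \<in> orbit p x" "z \<in> orbit p x" "y \<noteq> x" "z \<noteq> x" "y \<noteq> z"
proof -
  obtain k l where kl: "0 < k" "k < l" "l < card (orbit p x)" "y = (p ^^ k) x" "z = (p ^^ l) x"
    using assms(2) unfolding cyclic_order_def by blast
  show "y \<in> orbit p x" "z \<in> orbit p x"
    unfolding kl using assms(1) by (auto intro: funpow_in_orbit)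
  show "y \<noteq> x" using funpow_orbit_inj[OF assms(1), of k 0] kl by auto
  show "z \<noteq> x" using funpow_orbit_inj[OF assms(1), of l 0] kl by auto
  show "y \<noteq> z" using funpow_orbit_inj[OF assms(1), of k l] kl by auto
qed

lemma funpow_shift: "k \<le> l \<Longrightarrow> (p ^^ l) x = (p ^^ (l - k)) ((p ^^ k) x)"
  using funpow_add[of "l - k" k p] by simp

lemma cyclic_order_rotate:
  assumes "x \<in> orbit p x" "cyclic_order p x y z"
  shows "cyclic_order p y z x"
proof -
  let ?n = "card (orbit p x)"
  obtain k l where kl: "0 < k" "k < l" "l < ?n" "y = (p ^^ k) x" "z = (p ^^ l) x"
    using assms(2) unfolding cyclic_order_def by blast
  have y: "y \<in> orbit p x" using cyclic_order_mem[OF assms] by simp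
  have [simp]: "orbit p y = orbit p x" by (rule orbit_eq_of_mem[OF assms(1) y])
  show ?thesis
  proof (rule cyclic_orderI)
    show "y \<in> orbit p y" using y by simp
    show "z = (p ^^ (l - k)) y" using kl funpow_shift[of k l p x] by simp
    show "x = (p ^^ (?n - k)) y"
      using kl funpow_shift[of k ?n p x] funpow_card_orbit(1)[OF assms(1)] by simp
    show "?n - k < card (orbit p y)" using kl(1-3) by simp
  qed (use kl(1-3) in auto)
qed

text \<open>Exponents below the period are unique. In coordinates starting at \<open>x\<close> the
  arc from \<open>y\<close> to \<open>z\<close> does not wrap around, so \<open>w\<close> has
  exponent \<open>k + m\<close>, strictly between those of \<open>y\<close> and
  \<open>z\<close>.\<close>

lemma cyclic_order_trans:
  assumes "x \<in> orbit p x" "cyclic_order p x y z" "cyclic_order p y w z"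
  shows "cyclic_order p x y w" "cyclic_order p x w z"
proof -
  let ?n = "card (orbit p x)"
  obtain k l where kl: "0 < k" "k < l" "l < ?n" "y = (p ^^ k) x" "z = (p ^^ l) x"
    using assms(2) unfolding cyclic_order_def by blast
  have y: "y \<in> orbit p x" using cyclic_order_mem[OF assms(1,2)] by simp
  have [simp]: "orbit p y = orbit p x" by (rule orbit_eq_of_mem[OF assms(1) y])
  obtain m n where mn: "0 < m" "m < n" "n < ?n" "w = (p ^^ m) y" "z = (p ^^ n) y"
    using assms(3) unfolding cyclic_order_def by auto
  have "n = l - k"
  proof (rule funpow_orbit_inj[of y p])
    show "(p ^^ n) y = (p ^^ (l - k)) y" using mn kl funpow_shift[of k l p x] by auto
  qed (use y mn(1-3) kl(1-3) in auto)
  moreover have "w = (p ^^ (k + m)) x"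
    using mn kl funpow_add[of m k p] by (simp add: add.commute)
  ultimately show "cyclic_order p x y w" "cyclic_order p x w z"
    using cyclic_orderI[OF assms(1) kl(4), of w "k + m"] cyclic_orderI[OF assms(1) _ kl(5), of w "k + m"]
      kl(1-3) mn(1-2) by auto
qed

lemma cyclic_order_trans':
  assumes "x \<in> orbit p x" "cyclic_order p x y z" "cyclic_order p x z w"
  shows "cyclic_order p y z w"
proof -
  let ?n = "card (orbit p x)"
  obtain k l where kl: "0 < k" "k < l" "l < ?n" "y = (p ^^ k) x" "z = (p ^^ l) x"
    using assms(2) unfolding cyclic_order_def by blast
  have y: "y \<in> orbit p x" using cyclic_order_mem[OF assms(1,2)] by simp
  have [simp]: "orbit p y = orbit p x" by (rule orbit_eq_of_mem[OF assms(1) y])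
  obtain l' n where ln: "0 < l'" "l' < n" "n < ?n" "z = (p ^^ l') x" "w = (p ^^ n) x"
    using assms(3) unfolding cyclic_order_def by auto
  have "l' = l" using funpow_orbit_inj[OF assms(1), of l l'] kl ln by auto
  then have "0 < l - k" "l - k < n - k" "n - k < card (orbit p y)"
    using \<open>l' = l\<close> kl(1-3) ln(1-3) by auto
  moreover have "z = (p ^^ (l - k)) y" "w = (p ^^ (n - k)) y"
    using \<open>l' = l\<close> kl ln funpow_shift[of k l p x] funpow_shift[of k n p x] by auto
  ultimately show ?thesis
    unfolding cyclic_order_def by blast
qed

text \<open>If a property \<open>S\<close> of darts is face-invariant, the darts from \<open>x\<close> to \<open>y\<close> around a vertex see
  the same value as long as no edge separating \<open>S\<close> from its complement is crossed.\<close>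

lemma arc_constant:
  assumes x: "x \<in> orbit p x" and y: "y \<in> orbit p x" "y \<noteq> x"
    and face: "\<And>z. z \<in> orbit p x \<Longrightarrow> S (p z) \<longleftrightarrow> S (q z)"
    and cross: "\<And>z. \<lbrakk>z \<in> orbit p x; z \<noteq> x; z \<noteq> y\<rbrakk> \<Longrightarrow> S (q z) \<longleftrightarrow> S z"
  shows "S y \<longleftrightarrow> S (q x)"
    and "cyclic_order p x z y \<Longrightarrow> (S z \<longleftrightarrow> S (q x)) \<and> (S (q z) \<longleftrightarrow> S (q x))"
proof -
  let ?n = "card (orbit p x)"
  obtain l where l: "l < ?n" "y = (p ^^ l) x" using orbit_index[OF x y(1)] .
  have l0: "0 < l" using l y(2) by (cases l) auto
  have *: "k \<le> l \<Longrightarrow> 0 < k \<Longrightarrow> S ((p ^^ k) x) \<longleftrightarrow> S (q x)" for k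
  proof (induction k)
    case (Suc k)
    show ?case
    proof (cases "k = 0")
      case True
      then show ?thesis using face[OF x] by simp
    next
      case False
      have "(p ^^ k) x \<noteq> x" using funpow_orbit_inj[OF x, of k 0] False Suc.prems l by auto
      moreover have "(p ^^ k) x \<noteq> y" using funpow_orbit_inj[OF x, of k l] Suc.prems l by auto
      moreover have "(p ^^ k) x \<in> orbit p x" using x by (rule funpow_in_orbit)
      ultimately show ?thesis using face cross Suc False by auto
    qed
  qed simp
  show "S y \<longleftrightarrow> S (q x)" using *[of l] l l0 by simp
  assume "cyclic_order p x z y"
  then obtain k l' where kl: "0 < k" "k < l'" "l' < ?n" "z = (p ^^ k) x" "y = (p ^^ l') x"
    unfolding cyclic_order_def by blast
  have "l' = l" using funpow_orbit_inj[OF x, of l l'] kl l by auto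
  moreover have "z \<in> orbit p x" "z \<noteq> x" "z \<noteq> y"
    using cyclic_order_mem[OF x \<open>cyclic_order p x z y\<close>] by auto
  ultimately show "(S z \<longleftrightarrow> S (q x)) \<and> (S (q z) \<longleftrightarrow> S (q x))"
    using *[of k] kl cross by auto
qed

lemma permutes_self_in_orbit: "finite A \<Longrightarrow> p permutes A \<Longrightarrow> x \<in> orbit p x"
  by (intro permutation_self_in_orbit) (auto simp: permutation_permutes)

lemma orbit_map:
  assumes "x \<in> orbit p x" "\<And>y. y \<in> orbit p x \<Longrightarrow> q (h y) = h (p y)"
  shows "orbit q (h x) = h ` orbit p x"
  using orbit_inverse[OF assms(1), of q h] assms(2) by simp

lemma cyclic_order_map:
  assumes "inj h" "\<And>y. q (h y) = h (p y)" and x: "x \<in> orbit p x"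
  shows "cyclic_order q (h x) (h y) (h z) \<longleftrightarrow> cyclic_order p x y z"
proof -
  have "(q ^^ k) (h x) = h ((p ^^ k) x)" for k by (induction k) (auto simp: assms(2))
  moreover have "card (orbit q (h x)) = card (orbit p x)"
    using orbit_map[where h = h and q = q, OF x assms(2)] assms(1) by (simp add: card_image inj_on_subset)
  ultimately show ?thesis unfolding cyclic_order_def using inj_eq[OF assms(1)] by simp
qed

section \<open>Planar maps: even edge sets are boundaries\<close>

lemma odd_card_sym_diff:
  assumes "finite A" "finite B"
  shows "odd (card (sym_diff A B)) \<longleftrightarrow> odd (card A) \<noteq> odd (card B)"
proof -
  have "card (sym_diff A B) = card (A - B) + card (B - A)"
    using assms by (intro card_Un_disjoint) auto
  moreover have "card A = card (A - B) + card (A \<inter> B)"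
    using card_Int_Diff[OF assms(1), of B] by simp
  moreover have "card B = card (B - A) + card (A \<inter> B)"
    using card_Int_Diff[OF assms(2), of A] by (simp add: Int_commute)
  ultimately show ?thesis by auto
qed

text \<open>The first isomorphism theorem for groups of sets under symmetric difference, in terms of cardinalities.\<close>

lemma card_sym_diff_hom:
  fixes f :: "'a set \<Rightarrow> 'b set"
  assumes "finite P"
    and closed: "\<And>X Y. X \<in> P \<Longrightarrow> Y \<in> P \<Longrightarrow> sym_diff X Y \<in> P"
    and hom: "\<And>X Y. X \<in> P \<Longrightarrow> Y \<in> P \<Longrightarrow> f (sym_diff X Y) = sym_diff (f X) (f Y)"
  shows "card P = card {X \<in> P. f X = {}} * card (f ` P)"
proof -
  have fibre: "card {X \<in> P. f X = y} = card {X \<in> P. f X = {}}" if y: "y \<in> f ` P" for y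
  proof -
    obtain X where X: "X \<in> P" "f X = y" using y by blast
    have "bij_betw (sym_diff X) {Y \<in> P. f Y = {}} {Y \<in> P. f Y = y}"
    proof (rule bij_betw_byWitness[of _ "sym_diff X"])
      show "sym_diff X ` {Y \<in> P. f Y = {}} \<subseteq> {Y \<in> P. f Y = y}"
        using X closed hom by auto
      show "sym_diff X ` {Y \<in> P. f Y = y} \<subseteq> {Y \<in> P. f Y = {}}"
        using X closed hom by auto
    qed auto
    then show ?thesis using bij_betw_same_card by fastforce
  qed
  have "card P = (\<Sum>y\<in>f ` P. card {X \<in> P. f X = y})"
    using sum.image_gen[OF assms(1), of "\<lambda>_. 1::nat" f] by simp
  also have "\<dots> = (\<Sum>y\<in>f ` P. card {X \<in> P. f X = {}})" using fibre by simp
  finally show ?thesis by simp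
qed

text \<open>For a permutation of a finite set these are the unions of orbits. With
  \<open>rot M\<close>, \<open>opp M\<close> and \<open>face_next M\<close> for \<open>p\<close>
  they are the sets of vertices, edges and faces, that is, the chains modulo 2 of the
  surface.\<close>

definition inv_sets :: "('a \<Rightarrow> 'a) \<Rightarrow> 'a set \<Rightarrow> 'a set set" where
  "inv_sets p A = {X. X \<subseteq> A \<and> p ` X \<subseteq> X}"

lemma inv_sets_orbit:
  assumes "X \<in> inv_sets p A" "x \<in> X" shows "orbit p x \<subseteq> X"
proof
  fix y assume "y \<in> orbit p x" then show "y \<in> X"
    by induction (use assms in \<open>auto simp: inv_sets_def\<close>)
qed

lemma orbit_partition:
  assumes "finite A" "p permutes A" "x \<in> orbit p y" shows "orbit p x = orbit p y"
  using orbit_eq_of_mem[OF permutes_self_in_orbit[OF assms(1,2)] assms(3)] .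

lemma mem_orbit_iff:
  assumes "finite A" "p permutes A" shows "x \<in> orbit p y \<longleftrightarrow> orbit p x = orbit p y"
  using orbit_partition[OF assms] permutes_self_in_orbit[OF assms] by metis

text \<open>\<open>inv_sets\<close> demands closure forwards; backwards it follows because iterating
  a permutation of a finite set leads from \<open>p x\<close> back to \<open>x\<close>.\<close>

lemma inv_sets_iff:
  assumes "finite A" "p permutes A" "X \<in> inv_sets p A"
  shows "p x \<in> X \<longleftrightarrow> x \<in> X"
proof
  assume "p x \<in> X"
  moreover have "x \<in> orbit p (p x)"
    using mem_orbit_iff[OF assms(1,2)] orbit_partition[OF assms(1,2) orbit.base] by metis
  ultimately show "x \<in> X" using inv_sets_orbit[OF assms(3)] by blast
qed (use assms in \<open>auto simp: inv_sets_def\<close>)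

lemma inv_sets_sym_diff:
  assumes "finite A" "p permutes A" "X \<in> inv_sets p A" "Y \<in> inv_sets p A"
  shows "sym_diff X Y \<in> inv_sets p A"
  using inv_sets_iff[OF assms(1,2,3)] inv_sets_iff[OF assms(1,2,4)] assms(3,4)
  by (auto simp: inv_sets_def)

lemma card_inv_sets:
  assumes "finite A" "p permutes A"
  shows "card (inv_sets p A) = 2 ^ card (orbit p ` A)"
proof -
  have self: "x \<in> orbit p x" for x by (rule permutes_self_in_orbit[OF assms])
  have "bij_betw Union (Pow (orbit p ` A)) (inv_sets p A)"
  proof (rule bij_betw_byWitness[of _ "\<lambda>X. orbit p ` X"])
    show "\<forall>W\<in>Pow (orbit p ` A). orbit p ` \<Union>W = W"
    proof
      fix W assume W: "W \<in> Pow (orbit p ` A)"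
      have *: "orbit p x = w" if "w \<in> W" "x \<in> w" for x w
        using W that orbit_partition[OF assms] by auto
      moreover have "\<exists>x\<in>w. orbit p x = w" if "w \<in> W" for w
        using W that self by blast
      ultimately show "orbit p ` \<Union>W = W" by fastforce
    qed
    show "\<forall>X\<in>inv_sets p A. \<Union> (orbit p ` X) = X"
      using inv_sets_orbit self by fastforce
    show "Union ` Pow (orbit p ` A) \<subseteq> inv_sets p A"
    proof
      fix X assume "X \<in> Union ` Pow (orbit p ` A)"
      then obtain W where W: "W \<subseteq> orbit p ` A" "X = \<Union>W" by auto
      have "p x \<in> w" "w \<subseteq> A" if w: "w \<in> W" "x \<in> w" for x w
      proof -
        obtain a where "a \<in> A" "w = orbit p a" using W w by auto
        then show "p x \<in> w" "w \<subseteq> A"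
          using permutes_orbit_subset[OF assms(2)] w by (auto intro: orbit.step)
      qed
      then show "X \<in> inv_sets p A" unfolding inv_sets_def W(2) by fast
    qed
    show "(`) (orbit p) ` inv_sets p A \<subseteq> Pow (orbit p ` A)"
      by (auto simp: inv_sets_def)
  qed
  then have "card (inv_sets p A) = card (Pow (orbit p ` A))" by (metis bij_betw_same_card)
  then show ?thesis using assms by (simp add: card_Pow)
qed

section \<open>Rotation systems: darts, vertices and connectedness\<close>

lemma comb_mapD:
  assumes "comb_map M"
  shows "finite (darts M)" "rot M permutes darts M" "opp M permutes darts M"
    "d \<in> darts M \<Longrightarrow> opp M d \<noteq> d" "opp M (opp M d) = d"
    "face_next M permutes darts M"
    "d \<in> darts M \<Longrightarrow> opp M d \<in> darts M" "d \<in> darts M \<Longrightarrow> rot M d \<in> darts M"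
proof -
  show *: "finite (darts M)" "rot M permutes darts M" "opp M permutes darts M"
    "d \<in> darts M \<Longrightarrow> opp M d \<noteq> d"
    using assms by (auto simp: comb_map_def)
  show "opp M (opp M d) = d"
    using assms permutes_not_in[OF *(3), of d] by (cases "d \<in> darts M") (auto simp: comb_map_def)
  have "face_next M = rot M \<circ> opp M" by (auto simp: face_next_def)
  then show "face_next M permutes darts M" using permutes_compose[OF *(3,2)] by simp
  show "d \<in> darts M \<Longrightarrow> opp M d \<in> darts M" "d \<in> darts M \<Longrightarrow> rot M d \<in> darts M"
    using * by (auto simp: permutes_in_image)
qed

lemma vertex_of_props:
  assumes "finite (darts M)" "rot M permutes darts M"
  shows "d \<in> vertex_of M d" "d \<in> darts M \<Longrightarrow> vertex_of M d \<subseteq> darts M"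
    "e \<in> vertex_of M d \<longleftrightarrow> vertex_of M e = vertex_of M d"
    "vertex_of M (rot M d) = vertex_of M d" "finite (vertex_of M d)"
proof -
  show 1: "d \<in> vertex_of M d" 
    unfolding vertex_of_def by (rule permutes_self_in_orbit[OF assms])
  show "d \<in> darts M \<Longrightarrow> vertex_of M d \<subseteq> darts M"
    unfolding vertex_of_def by (rule permutes_orbit_subset[OF assms(2)])
  show "e \<in> vertex_of M d \<longleftrightarrow> vertex_of M e = vertex_of M d"
    unfolding vertex_of_def by (rule mem_orbit_iff[OF assms])
  show "vertex_of M (rot M d) = vertex_of M d"
    unfolding vertex_of_def by (rule orbit_partition[OF assms orbit.base])
  show "finite (vertex_of M d)"
    using 1 unfolding vertex_of_def by (rule finite_orbit)
qed

lemma connected_invariant: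
  assumes conn: "connected_map M" and sub: "T \<subseteq> darts M" and d: "d \<in> T" and e: "e \<in> darts M"
    and opp: "\<And>x. x \<in> T \<Longrightarrow> opp M x \<in> T" and rot: "\<And>x. x \<in> T \<Longrightarrow> rot M x \<in> T"
  shows "e \<in> T"
proof -
  have "(d, e) \<in> {(x, y). y = rot M x \<or> y = opp M x}\<^sup>*"
    using conn d e sub unfolding connected_map_def by blast
  then show ?thesis by (induction) (use d opp rot in auto)
qed

text \<open>The boundary map from edges to vertices modulo 2. An edge set is given by both darts of
  each edge, a vertex set by all darts at the vertices. A loop contributes two darts to its vertex,
  hence nothing.\<close>

definition odd_vertices :: "'a cmap \<Rightarrow> 'a set \<Rightarrow> 'a set" where
  "odd_vertices M X = {d \<in> darts M. odd (card (X \<inter> vertex_of M d))}"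

text \<open>The boundary map from faces to edges modulo 2. A dart in \<open>K\<close> has a chosen
  face on its right, so \<open>opp M d \<in> K\<close> refers to the face on the left of
  \<open>d\<close>.\<close>

definition boundary :: "'a cmap \<Rightarrow> 'a set \<Rightarrow> 'a set" where
  "boundary M K = {d \<in> darts M. (d \<in> K) \<noteq> (opp M d \<in> K)}"

lemma odd_vertices_sym_diff:
  assumes "comb_map M"
  shows "odd_vertices M (sym_diff X Y) = sym_diff (odd_vertices M X) (odd_vertices M Y)"
proof -
  note [simp] = vertex_of_props(5)[OF comb_mapD(1,2)[OF assms]]
  have "sym_diff X Y \<inter> v = sym_diff (X \<inter> v) (Y \<inter> v)" for v by auto
  then show ?thesis unfolding odd_vertices_def by (auto simp: odd_card_sym_diff)
qed

text \<open>The boundary of a boundary vanishes: around a vertex the corners switch between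
  \<open>K\<close> and its complement an even number of times.\<close>

lemma odd_vertices_boundary:
  assumes "comb_map M" "K \<in> inv_sets (face_next M) (darts M)"
  shows "odd_vertices M (boundary M K) = {}"
proof -
  note c = comb_mapD[OF assms(1)] and v = vertex_of_props[OF comb_mapD(1,2)[OF assms(1)]]
  have face: "rot M d \<in> K \<longleftrightarrow> opp M d \<in> K" for d
    using inv_sets_iff[OF c(1,6) assms(2), of "opp M d"] by (simp add: face_next_def c(5))
  have "even (card (boundary M K \<inter> vertex_of M d))" if d: "d \<in> darts M" for d
  proof -
    let ?v = "vertex_of M d"
    \<comment> \<open>\<open>x \<in> K\<close> speaks of the corner just before \<open>x\<close>,
      \<open>rot M x \<in> K\<close> of the corner just after it. Since \<open>rot M\<close> maps
      the second set onto the first, they have the same size, and their symmetric difference is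
      even.\<close>
    have eq: "boundary M K \<inter> ?v = sym_diff {x \<in> ?v. x \<in> K} {x \<in> ?v. rot M x \<in> K}"
      using v(2)[OF d] face by (auto simp: boundary_def)
    have "rot M ` {x \<in> ?v. rot M x \<in> K} = {x \<in> ?v. x \<in> K}"
    proof (intro equalityI subsetI)
      fix y assume y: "y \<in> {x \<in> ?v. x \<in> K}"
      obtain x where "y = rot M x" using c(2) by (metis permutes_def)
      then show "y \<in> rot M ` {x \<in> ?v. rot M x \<in> K}" using y v(3,4) by auto
    qed (use v(3,4) in auto)
    moreover have "inj_on (rot M) {x \<in> ?v. rot M x \<in> K}"
      using permutes_inj[OF c(2)] inj_on_subset by blast
    ultimately have "card {x \<in> ?v. x \<in> K} = card {x \<in> ?v. rot M x \<in> K}"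
      using card_image[of "rot M" "{x \<in> ?v. rot M x \<in> K}"] by simp
    then show ?thesis unfolding eq
      using odd_card_sym_diff[of "{x \<in> ?v. x \<in> K}" "{x \<in> ?v. rot M x \<in> K}"] v(5) by simp
  qed
  then show ?thesis by (auto simp: odd_vertices_def)
qed

text \<open>A path has only its two ends as odd vertices: a \<open>rot\<close> step stays at the
  vertex, an \<open>opp\<close> step adds one edge. Edges used twice cancel in the symmetric
  difference, so the path may repeat itself.\<close>

lemma path_odd_vertices:
  assumes M: "comb_map M" and d: "d \<in> darts M"
    and "(d, e) \<in> {(x, y). y = rot M x \<or> y = opp M x}\<^sup>*"
  shows "e \<in> darts M \<and>
    (\<exists>X \<in> inv_sets (opp M) (darts M). odd_vertices M X = sym_diff (vertex_of M d) (vertex_of M e))"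
  using assms(3)
proof induction
  case base
  have "odd_vertices M {} = {}" by (simp add: odd_vertices_def)
  then show ?case using d by (auto simp: inv_sets_def intro!: bexI[of _ "{}"])
next
  case (step e e')
  note c = comb_mapD[OF M] and v = vertex_of_props[OF comb_mapD(1,2)[OF M]]
  from step.IH obtain X where e: "e \<in> darts M" and X: "X \<in> inv_sets (opp M) (darts M)"
    "odd_vertices M X = sym_diff (vertex_of M d) (vertex_of M e)" by blast
  show ?case
  proof (cases "e' = rot M e")
    case True
    then show ?thesis using e X v(4) c(8) by auto
  next
    case False
    then have e': "e' = opp M e" using step.hyps by simp
    have E: "{e, e'} \<in> inv_sets (opp M) (darts M)"
      using e c(5,7) e' by (auto simp: inv_sets_def)
    have "card ({e, e'} \<inter> w) = (if e \<in> w then 1 else 0) + (if e' \<in> w then 1 else 0)" for w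
      using c(4)[OF e] e' by auto
    moreover have "x \<in> vertex_of M y \<longleftrightarrow> y \<in> vertex_of M x" for x y by (metis v(3))
    ultimately have "odd_vertices M {e, e'} = sym_diff (vertex_of M e) (vertex_of M e')"
      using v(2)[OF e] v(2)[of e'] c(7)[OF e] e' unfolding odd_vertices_def by auto
    then have "odd_vertices M (sym_diff X {e, e'}) = sym_diff (vertex_of M d) (vertex_of M e')"
      unfolding odd_vertices_sym_diff[OF M] X by auto
    moreover have "sym_diff X {e, e'} \<in> inv_sets (opp M) (darts M)"
      by (rule inv_sets_sym_diff[OF c(1,3) X(1) E])
    ultimately show ?thesis using c(7)[OF e] e' by blast
  qed
qed

text \<open>Jordan curve theorem modulo 2: with \<open>Z\<close> the space of even edge sets, connectedness bounds the
  ranks of the boundary maps from edges to vertices and from faces to edges from below, and Euler's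
  formula leaves no room for a cycle that is not the boundary of a set of faces.\<close>

theorem planar_even_is_boundary:
  assumes "planar_map M" and X: "X \<in> inv_sets (opp M) (darts M)"
    and even: "odd_vertices M X = {}"
  obtains K where "K \<in> inv_sets (face_next M) (darts M)" "boundary M K = X"
proof -
  have M: "comb_map M" and conn: "connected_map M" and euler: "euler_char M = 2"
    using assms(1) by (auto simp: planar_map_def)
  note c = comb_mapD[OF M] and v = vertex_of_props[OF comb_mapD(1,2)[OF M]]
  let ?D = "darts M"
  let ?A = "inv_sets (opp M) ?D" and ?F = "inv_sets (face_next M) ?D" and ?V = "inv_sets (rot M) ?D"
  let ?Z = "{X \<in> ?A. odd_vertices M X = {}}"
  obtain d0 where d0: "d0 \<in> ?D" using M by (auto simp: comb_map_def)
  have fin: "finite (inv_sets p ?D)" for p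
    by (rule finite_subset[of _ "Pow ?D"]) (auto simp: inv_sets_def c(1))
  have cE: "card ?A = 2 ^ card (edges M)" and cF: "card ?F = 2 ^ card (faces M)"
    and cV: "card ?V = 2 ^ card (vertices M)"
    using card_inv_sets[OF c(1,3)] card_inv_sets[OF c(1,6)] card_inv_sets[OF c(1,2)]
    unfolding edges_def faces_def vertices_def vertex_of_def by auto
  have A: "card ?A = card ?Z * card (odd_vertices M ` ?A)"
    by (rule card_sym_diff_hom[OF fin inv_sets_sym_diff[OF c(1,3)] odd_vertices_sym_diff[OF M]])
  have F: "card ?F = card {K \<in> ?F. boundary M K = {}} * card (boundary M ` ?F)"
    by (rule card_sym_diff_hom[OF fin inv_sets_sym_diff[OF c(1,6)]]) (auto simp: boundary_def c)
  \<comment> \<open>The kernel of the boundary map on faces has dimension at most 1: a set of faces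
    without boundary is closed under \<open>opp\<close> and \<open>rot\<close>, and the map is
    connected.\<close>
  have "{K \<in> ?F. boundary M K = {}} \<subseteq> {{}, ?D}"
  proof
    fix K assume "K \<in> {K \<in> ?F. boundary M K = {}}"
    then have K: "K \<in> ?F" "boundary M K = {}" "K \<subseteq> ?D" by (auto simp: inv_sets_def)
    have opp: "opp M x \<in> K" if "x \<in> K" for x using K that by (auto simp: boundary_def)
    have rot: "rot M x \<in> K" if "x \<in> K" for x
      using inv_sets_iff[OF c(1,6) K(1), of "opp M x"] opp[OF that] by (simp add: face_next_def c(5))
    show "K \<in> {{}, ?D}"
      using connected_invariant[OF conn K(3) _ _ opp rot] K(3) by blast
  qed
  then have "card {K \<in> ?F. boundary M K = {}} \<le> card {{}, ?D}" by (intro card_mono) auto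
  also have "\<dots> \<le> 2" by (simp add: card_insert_if)
  finally have "card ?F \<le> 2 * card (boundary M ` ?F)"
    by (subst F) (rule mult_le_mono1)
  then have F2: "2 ^ card (faces M) \<le> 2 * card (boundary M ` ?F)" using cF by simp
  \<comment> \<open>The image of the boundary map on edges has codimension at most 1: summing paths
    from the members of a vertex set to \<open>d0\<close> yields this set, up to the vertex of
    \<open>d0\<close>.\<close>
  have "?V \<subseteq> odd_vertices M ` ?A \<union> (\<lambda>Y. sym_diff Y (vertex_of M d0)) ` odd_vertices M ` ?A" (is "_ \<subseteq> ?I \<union> ?s ` ?I")
  proof
    fix Y assume Y: "Y \<in> ?V"
    have "finite (vertex_of M ` Y)" using Y c(1) by (auto simp: inv_sets_def intro: finite_subset)
    moreover have "\<Union>W \<in> ?I \<union> ?s ` ?I" if "finite W" "W \<subseteq> vertex_of M ` ?D" for W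
      using that
    proof induction
      case empty
      have "{} \<in> ?A" "odd_vertices M {} = {}" by (auto simp: inv_sets_def odd_vertices_def)
      then show ?case using imageI[of "{}" ?A "odd_vertices M"] by simp
    next
      case (insert w W)
      have "w \<in> vertex_of M ` ?D" using insert.prems by simp
      then obtain e where e: "e \<in> ?D" "w = vertex_of M e" by auto
      have "(e, d0) \<in> {(x, y). y = rot M x \<or> y = opp M x}\<^sup>*"
        using conn d0 e by (auto simp: connected_map_def)
      from path_odd_vertices[OF M e(1) this] obtain P
        where P: "P \<in> ?A" "odd_vertices M P = sym_diff w (vertex_of M d0)" using e by blast
      have "w \<inter> u = {}" if "u \<in> W" for u
      proof (rule ccontr)
        assume "w \<inter> u \<noteq> {}"
        then obtain x where x: "x \<in> w" "x \<in> u" by blast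
        have "u \<in> vertex_of M ` ?D" using subsetD[OF insert.prems, of u] that by simp
        then obtain e' where "u = vertex_of M e'" by (rule imageE)
        then have "u = w" using x v(3) e(2) by simp
        then show False using that insert.hyps(2) by simp
      qed
      then have disj: "w \<inter> \<Union>W = {}" by blast
      have "\<Union>W \<in> ?I \<union> ?s ` ?I" using insert.IH insert.prems by simp
      then obtain Q where Q: "Q \<in> ?A" "\<Union>W = odd_vertices M Q \<or> \<Union>W = ?s (odd_vertices M Q)" by blast
      have PQ: "odd_vertices M (sym_diff P Q) \<in> ?I"
        using inv_sets_sym_diff[OF c(1,3) P(1) Q(1)] by blast
      have "odd_vertices M (sym_diff P Q) = sym_diff (sym_diff w (vertex_of M d0)) (odd_vertices M Q)"
        using odd_vertices_sym_diff[OF M] P(2) by simp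
      then have "\<Union>(insert w W) = odd_vertices M (sym_diff P Q)
          \<or> \<Union>(insert w W) = ?s (odd_vertices M (sym_diff P Q))"
        using Q(2) disj unfolding Union_insert by (elim disjE) (simp; blast)+
      then show ?case using PQ imageI[OF PQ, of ?s] by (elim disjE) simp_all
    qed
    moreover have "vertex_of M ` Y \<subseteq> vertex_of M ` ?D" using Y by (auto simp: inv_sets_def)
    ultimately have "\<Union> (vertex_of M ` Y) \<in> ?I \<union> ?s ` ?I" by blast
    moreover have "\<Union> (vertex_of M ` Y) = Y"
      using inv_sets_orbit[OF Y] v(1) unfolding vertex_of_def by blast
    ultimately show "Y \<in> ?I \<union> ?s ` ?I" by simp
  qed
  then have "card ?V \<le> card (?I \<union> ?s ` ?I)" by (intro card_mono) (use fin in auto)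
  also have "\<dots> \<le> card ?I + card (?s ` ?I)" by (rule card_Un_le)
  also have "\<dots> \<le> card ?I + card ?I" using card_image_le[of ?I ?s] fin by auto
  finally have V2: "2 ^ card (vertices M) \<le> 2 * card ?I" using cV by simp
  \<comment> \<open>With V, E, F the numbers of vertices, edges and faces, the even edge sets have
    dimension at most E - (V - 1), the boundaries at least F - 1. By Euler's formula these bounds
    are equal.\<close>
  have "card (vertices M) + card (faces M) = card (edges M) + 2"
    using euler by (simp add: euler_char_def)
  then have "2 ^ (card (vertices M) + card (faces M)) = (2 ^ (card (edges M) + 2) :: nat)" by simp
  then have "2 ^ card (vertices M) * 2 ^ card (faces M) = 4 * (2 :: nat) ^ card (edges M)"
    by (simp add: power_add)
  then have "4 * (card ?Z * card ?I) \<le> (2 * card ?I) * 2 ^ card (faces M)"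
    using A cE mult_le_mono1[OF V2, of "2 ^ card (faces M)"] by simp
  moreover have "card ?I > 0" using fin by (auto simp: card_gt_0_iff inv_sets_def)
  ultimately have "2 * card ?Z \<le> 2 ^ card (faces M)" by simp
  then have "card ?Z \<le> card (boundary M ` ?F)" using F2 by simp
  moreover have sub: "boundary M ` ?F \<subseteq> ?Z"
  proof
    fix Y assume "Y \<in> boundary M ` ?F"
    then obtain K where K: "K \<in> ?F" "Y = boundary M K" by (rule imageE)
    have "Y \<in> ?A" unfolding K(2) by (auto simp: inv_sets_def boundary_def c(5,7))
    then show "Y \<in> ?Z" using odd_vertices_boundary[OF M K(1)] K(2) by simp
  qed
  moreover have "finite ?Z" using fin by simp
  ultimately have "boundary M ` ?F = ?Z" by (intro card_seteq)
  moreover have "X \<in> ?Z" using X even by simp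
  ultimately have "X \<in> boundary M ` ?F" by simp
  then show thesis using that by auto
qed

section \<open>Schnyder woods and monochromatic cycles\<close>

text \<open>The outgoing darts are a parameter \<open>e\<close> instead of the definite description
  \<open>out_dart\<close>, so that they can be reindexed under a shift of colors and carried from
  one map to another.\<close>

definition schnyder_at :: "'a cmap \<Rightarrow> ('a \<Rightarrow> color option) \<Rightarrow> 'a set \<Rightarrow> (color \<Rightarrow> 'a) \<Rightarrow> bool" where
  "schnyder_at M f v e \<longleftrightarrow>
     (\<forall>i. e i \<in> v \<and> f (e i) = Some i) \<and> (\<forall>d\<in>v. \<forall>i. f d = Some i \<longrightarrow> d = e i) \<and>
     cyclic_order (rot M) (e 0) (e 1) (e 2) \<and>
     (\<forall>d\<in>v. \<forall>i. opp M d \<noteq> d \<and> f (opp M d) = Some i \<longrightarrow>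
        d = e (i + 1) \<or> d = e (i - 1) \<or> cyclic_order (rot M) (e (i + 1)) d (e (i - 1)))"

lemma schnyder_property_iff: "schnyder_property M f v \<longleftrightarrow> (\<exists>e. schnyder_at M f v e)"
proof
  assume S: "schnyder_property M f v"
  have "out_dart f v i \<in> v \<and> f (out_dart f v i) = Some i" for i
    unfolding out_dart_def by (rule theI') (use S in \<open>simp add: schnyder_property_def\<close>)
  moreover from this have "d = out_dart f v i" if "d \<in> v" "f d = Some i" for d i
    using S that unfolding schnyder_property_def by blast
  ultimately have "schnyder_at M f v (out_dart f v)"
    using S unfolding schnyder_at_def schnyder_property_def by blast
  then show "\<exists>e. schnyder_at M f v e" by blast
next
  assume "\<exists>e. schnyder_at M f v e"
  then obtain e where e: "schnyder_at M f v e" ..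
  have "out_dart f v i = e i" for i
    unfolding out_dart_def by (rule the_equality) (use e in \<open>auto simp: schnyder_at_def\<close>)
  then have "out_dart f v = e" by auto
  moreover have "\<exists>!d. d \<in> v \<and> f d = Some i" for i
    using e unfolding schnyder_at_def by blast
  ultimately show "schnyder_property M f v"
    using e unfolding schnyder_property_def schnyder_at_def by simp
qed

lemma schnyder_at_cyclic:
  assumes "schnyder_at M f v e" and self: "\<And>x. x \<in> orbit (rot M) x"
  shows "cyclic_order (rot M) (e i) (e (i + 1)) (e (i - 1))"
proof -
  have 0: "cyclic_order (rot M) (e 0) (e 1) (e 2)" using assms by (simp add: schnyder_at_def)
  note 1 = cyclic_order_rotate[OF self 0]
  note 2 = cyclic_order_rotate[OF self 1]
  show ?thesis using color_cases[of i] 0 1 2 by (auto simp: color_consts)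
qed

text \<open>The recoloring spelled out in \<open>wood_equiv\<close> and
  \<open>toroidal_extensions\<close>. The Schnyder property is cyclic in the colors, hence invariant
  under it.\<close>

definition shift_colors :: "color \<Rightarrow> ('a \<Rightarrow> color option) \<Rightarrow> 'a \<Rightarrow> color option" where
  "shift_colors k f = (\<lambda>d. map_option (\<lambda>i. i + k) (f d))"

lemma shift_colors_simps [simp]:
  "shift_colors k f d = None \<longleftrightarrow> f d = None" "shift_colors k f d = Some i \<longleftrightarrow> f d = Some (i - k)"
  "shift_colors 0 f = f" "shift_colors k (shift_colors l f) = shift_colors (l + k) f"
  "shift_colors k f d = shift_colors k f d' \<longleftrightarrow> f d = f d'"
  by (cases "f d"; cases "f d'"; auto simp: shift_colors_def option.map_comp option.map_ident comp_def algebra_simps)+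

lemma orientation_coloring_shift:
  "orientation_coloring M (shift_colors k f) \<longleftrightarrow> orientation_coloring M f"
  by (simp add: orientation_coloring_def del: not_None_eq)

lemma mono_cycle_shift: "mono_cycle M (shift_colors k f) i ds \<longleftrightarrow> mono_cycle M f (i - k) ds"
  by (simp add: mono_cycle_def)

lemma schnyder_at_shift:
  assumes "schnyder_at M f v e" and self: "\<And>x. x \<in> orbit (rot M) x"
  shows "schnyder_at M (shift_colors k f) v (\<lambda>i. e (i - k))"
proof -
  have "cyclic_order (rot M) (e (0 - k)) (e (1 - k)) (e (2 - k))"
    using schnyder_at_cyclic[OF assms, of "0 - k"] color_cases[of k] by (auto simp: color_consts)
  moreover have eq: "i + 1 - k = (i - k) + 1" "i - 1 - k = (i - k) - 1" for i :: 3 by auto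
  ultimately show ?thesis using assms(1) unfolding schnyder_at_def shift_colors_simps eq by blast
qed

lemma schnyder_property_shift:
  assumes self: "\<And>x. x \<in> orbit (rot M) x"
  shows "schnyder_property M (shift_colors k f) v \<longleftrightarrow> schnyder_property M f v"
proof
  assume "schnyder_property M (shift_colors k f) v"
  then obtain e where "schnyder_at M (shift_colors k f) v e" by (auto simp: schnyder_property_iff)
  from schnyder_at_shift[OF this self, of "- k"] show "schnyder_property M f v"
    by (auto simp: schnyder_property_iff)
next
  assume "schnyder_property M f v"
  then show "schnyder_property M (shift_colors k f) v"
    using schnyder_at_shift[OF _ self] unfolding schnyder_property_iff by blast
qed

section \<open>Monochromatic cycles as cyclic sequences of darts\<close>

lemma mono_cycle_nth:
  assumes C: "mono_cycle M f i ds" and k: "k < length ds"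
  shows "ds ! k \<in> darts M" "opp M (ds ! k) \<noteq> ds ! k" "f (ds ! k) = Some i"
    "vertex_of M (opp M (ds ! k)) = vertex_of M (ds ! (Suc k mod length ds))"
proof -
  show "ds ! k \<in> darts M" "opp M (ds ! k) \<noteq> ds ! k" "f (ds ! k) = Some i"
    using C k by (auto simp: mono_cycle_def is_walk_def)
  show "vertex_of M (opp M (ds ! k)) = vertex_of M (ds ! (Suc k mod length ds))"
  proof (cases "Suc k = length ds")
    case True
    then have "k = length ds - 1" "ds \<noteq> []" by auto
    then have "ds ! k = last ds" "hd ds = ds ! 0"
      using last_conv_nth[of ds] hd_conv_nth[of ds] by auto
    then show ?thesis using C True by (simp add: mono_cycle_def)
  next
    case False
    then have "Suc k < length ds" using k by simp
    then show ?thesis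
      using C by (simp add: mono_cycle_def is_walk_def successively_conv_nth)
  qed
qed

lemma mono_cycle_next:
  assumes "mono_cycle M f i ds" "d \<in> set ds"
  obtains e where "e \<in> set ds" "vertex_of M (opp M d) = vertex_of M e"
proof -
  obtain k where k: "k < length ds" "d = ds ! k" using assms(2) by (auto simp: in_set_conv_nth)
  have "Suc k mod length ds < length ds" using k by (intro mod_less_divisor) auto
  then show thesis using mono_cycle_nth(4)[OF assms(1) k(1)] k that nth_mem by metis
qed

lemma mono_cycle_prev:
  assumes "mono_cycle M f i ds" "d \<in> set ds"
  obtains e where "e \<in> set ds" "vertex_of M (opp M e) = vertex_of M d"
proof -
  let ?n = "length ds"
  obtain k where k: "k < ?n" "d = ds ! k" using assms(2) by (auto simp: in_set_conv_nth)
  let ?l = "(k + ?n - 1) mod ?n"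
  have l: "?l < ?n" using k by (intro mod_less_divisor) auto
  have "Suc ?l mod ?n = Suc (k + ?n - 1) mod ?n" by (rule mod_Suc_eq)
  also have "Suc (k + ?n - 1) = k + ?n" using k by simp
  finally have "Suc ?l mod ?n = (k + ?n) mod ?n" .
  then have "Suc ?l mod ?n = k" using k by simp
  then show thesis using mono_cycle_nth(4)[OF assms(1) l] k that l nth_mem by metis
qed

text \<open>Every dart of the cycle is reached from every other by going around;
  \<open>l + ?n - k\<close> steps lead from index \<open>k\<close> to index \<open>l\<close> and
  avoid truncated subtraction.\<close>

lemma mono_cycle_induct:
  assumes C: "mono_cycle M f i ds" and d: "d \<in> set ds" "Q d" and e: "e \<in> set ds"
    and step: "\<And>x y. \<lbrakk>x \<in> set ds; y \<in> set ds; vertex_of M (opp M x) = vertex_of M y; Q x\<rbrakk> \<Longrightarrow> Q y"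
  shows "Q e"
proof -
  let ?n = "length ds"
  obtain k where k: "k < ?n" "d = ds ! k" using d by (auto simp: in_set_conv_nth)
  obtain l where l: "l < ?n" "e = ds ! l" using e by (auto simp: in_set_conv_nth)
  have n: "0 < ?n" using k by auto
  have "Q (ds ! ((k + m) mod ?n))" for m
  proof (induction m)
    case (Suc m)
    have "Suc ((k + m) mod ?n) mod ?n = (k + Suc m) mod ?n" by (simp add: mod_Suc_eq)
    then show ?case
      using step[OF _ _ _ Suc.IH, of "ds ! ((k + Suc m) mod ?n)"] mono_cycle_nth(4)[OF C, of "(k + m) mod ?n"] n
      by simp
  qed (use k d in simp)
  from this[of "l + ?n - k"] show ?thesis using k l by simp
qed

lemma mono_cycle_inj:
  assumes "mono_cycle M f i ds" "d \<in> set ds" "e \<in> set ds" "vertex_of M d = vertex_of M e"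
  shows "d = e"
  using assms by (auto simp: mono_cycle_def distinct_map dest: inj_onD)

text \<open>Both darts are followed by the same dart of the cycle, and the successor modulo the
  length is injective on indices.\<close>

lemma mono_cycle_prev_inj:
  assumes C: "mono_cycle M f i ds" and de: "d \<in> set ds" "e \<in> set ds"
    and eq: "vertex_of M (opp M d) = vertex_of M (opp M e)"
  shows "d = e"
proof -
  let ?n = "length ds"
  obtain k where k: "k < ?n" "d = ds ! k" using de by (auto simp: in_set_conv_nth)
  obtain l where l: "l < ?n" "e = ds ! l" using de by (auto simp: in_set_conv_nth)
  have n: "0 < ?n" using k by auto
  have "ds ! (Suc k mod ?n) = ds ! (Suc l mod ?n)"
    using mono_cycle_nth(4)[OF C k(1)] mono_cycle_nth(4)[OF C l(1)] k l eq n
    by (intro mono_cycle_inj[OF C]) auto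
  moreover have "distinct ds" using C by (auto simp: mono_cycle_def distinct_map)
  ultimately have "Suc k mod ?n = Suc l mod ?n" using n by (simp add: nth_eq_iff_index_eq)
  then have "k = l" using k l by (auto simp: mod_Suc split: if_splits)
  then show ?thesis using k l by simp
qed

text \<open>Iterating a choice of successor in the finite set \<open>Z\<close> becomes periodic, and
  the periodic part is the cycle. As \<open>Z\<close> has at most one dart per vertex, distinct
  darts give distinct vertices.\<close>

lemma ex_mono_cycle:
  assumes "finite Z" "d0 \<in> Z"
    and Z: "\<And>d. d \<in> Z \<Longrightarrow> d \<in> darts M \<and> opp M d \<noteq> d \<and> f d = Some i"
    and inj: "inj_on (vertex_of M) Z"
    and step: "\<And>d. d \<in> Z \<Longrightarrow> \<exists>e\<in>Z. vertex_of M (opp M d) = vertex_of M e"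
  obtains ds where "mono_cycle M f i ds" "set ds \<subseteq> Z"
proof -
  from step obtain N where N: "\<And>d. d \<in> Z \<Longrightarrow> N d \<in> Z \<and> vertex_of M (opp M d) = vertex_of M (N d)"
    by metis
  have Nk: "(N ^^ k) d \<in> Z" if "d \<in> Z" for k d by (induction k) (use N that in auto)
  have "\<not> inj_on (\<lambda>k. (N ^^ k) d0) UNIV"
  proof
    assume "inj_on (\<lambda>k. (N ^^ k) d0) UNIV"
    then have "infinite (range (\<lambda>k. (N ^^ k) d0))" using finite_imageD by blast
    moreover have "range (\<lambda>k. (N ^^ k) d0) \<subseteq> Z" using Nk[OF assms(2)] by auto
    ultimately show False using assms(1) finite_subset by blast
  qed
  then obtain a b where "(N ^^ a) d0 = (N ^^ b) d0" "a < b"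
    unfolding inj_on_def by (metis linorder_neqE_nat)
  then have "(N ^^ (b - a)) ((N ^^ a) d0) = (N ^^ a) d0" "0 < b - a"
    using funpow_shift[of a b N d0] by auto
  then have self: "(N ^^ a) d0 \<in> orbit N ((N ^^ a) d0)" by (metis (mono_tags, lifting) CollectI orbit_altdef)
  define d where "d = (N ^^ a) d0"
  define n where "n = card (orbit N d)"
  define ds where "ds = map (\<lambda>k. (N ^^ k) d) [0..<n]"
  have d: "d \<in> Z" "d \<in> orbit N d" using Nk assms(2) self by (auto simp: d_def)
  have n: "0 < n" "(N ^^ n) d = d" using card_orbit_pos[OF d(2)] funpow_card_orbit(1)[OF d(2)] by (auto simp: n_def)
  have sub: "set ds \<subseteq> Z" using Nk[OF d(1)] by (auto simp: ds_def)
  have nxt: "vertex_of M (opp M ((N ^^ k) d)) = vertex_of M ((N ^^ Suc k) d)" for k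
    using N[OF Nk[OF d(1)]] by simp
  have dist: "distinct ds"
    using funpow_card_orbit(2)[OF d(2)] by (simp add: ds_def distinct_map n_def lessThan_atLeast0)
  have "mono_cycle M f i ds"
    unfolding mono_cycle_def is_walk_def
  proof (intro conjI)
    show "ds \<noteq> []" using n by (simp add: ds_def)
    show "set ds \<subseteq> darts M" using sub Z by blast
    show "successively (\<lambda>d e. vertex_of M (opp M d) = vertex_of M e) ds"
      using nxt by (auto simp: successively_conv_nth ds_def)
    show "vertex_of M (opp M (last ds)) = vertex_of M (hd ds)"
      using nxt[of "n - 1"] n by (simp add: ds_def last_map hd_map del: funpow.simps)
    show "distinct (map (vertex_of M) ds)"
      using dist inj sub by (auto simp: distinct_map intro: inj_on_subset)
    show "\<forall>d\<in>set ds. opp M d \<noteq> d \<and> f d = Some i" using sub Z by blast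
  qed
  then show thesis using sub that by blast
qed

section \<open>Suspensions\<close>

text \<open>A comparison of numbers of classes: \<open>f\<close> and \<open>g\<close> induce the
  same partition along \<open>h\<close>. The map \<open>h\<close> may identify elements, as happens
  when a half-edge is sent to the dart following it.\<close>

lemma card_image_eq:
  assumes "h ` A = B" "\<And>x y. \<lbrakk>x \<in> A; y \<in> A\<rbrakk> \<Longrightarrow> f x = f y \<longleftrightarrow> g (h x) = g (h y)"
  shows "card (f ` A) = card (g ` B)"
proof -
  let ?r = "\<lambda>u. g (h (SOME x. x \<in> A \<and> f x = u))"
  have r: "?r (f x) = g (h x)" if "x \<in> A" for x
  proof -
    have "(SOME y. y \<in> A \<and> f y = f x) \<in> A \<and> f (SOME y. y \<in> A \<and> f y = f x) = f x"
      by (rule someI[of _ x]) (use that in simp)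
    then show ?thesis using assms(2) that by blast
  qed
  have "bij_betw ?r (f ` A) (g ` B)"
    unfolding bij_betw_def
  proof
    show "inj_on ?r (f ` A)" using r assms(2) by (auto intro!: inj_onI)
    show "?r ` f ` A = g ` B" using r assms(1)[symmetric] by (auto simp: image_image)
  qed
  then show ?thesis by (rule bij_betw_same_card)
qed

lemma suspension_simps [simp]:
  "darts (suspension M c) = Inl ` darts M \<union> range Inr"
  "opp (suspension M c) (Inl d) = Inl (opp M d)"
  "opp (suspension M c) (Inr i) = Inr i"
  "rot (suspension M c) (Inr i) = Inl (c i)"
  by (auto simp: suspension_def)

lemma rot_suspension_Inl:
  assumes "inj c"
  shows "rot M d = c i \<Longrightarrow> rot (suspension M c) (Inl d) = Inr i"
    "(\<And>i. rot M d \<noteq> c i) \<Longrightarrow> rot (suspension M c) (Inl d) = Inl (rot M d)"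
  using assms by (auto simp: suspension_def)

lemma rot_suspension_cases:
  assumes "inj c"
  obtains i where "rot M d = c i" "rot (suspension M c) (Inl d) = Inr i"
  | "\<And>i. rot M d \<noteq> c i" "rot (suspension M c) (Inl d) = Inl (rot M d)"
  using rot_suspension_Inl[OF assms, of M d] by blast

text \<open>Serves both for \<open>G\<close> with its outer corners and for the one-vertex map
  \<open>B\<close> with the corners that receive the new edges.\<close>

locale suspended =
  fixes M :: "'a cmap" and c :: "3 \<Rightarrow> 'a"
  assumes comb: "comb_map M" and c_darts: "range c \<subseteq> darts M" and inj_c: "inj c"
begin

abbreviation "H \<equiv> suspension M c"

lemmas M = comb_mapD[OF comb]

lemma c_dart [simp]: "c i \<in> darts M" using c_darts by auto

lemma finite_H: "finite (darts H)" using M(1) by simp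

lemma opp_opp_H [simp]: "opp H (opp H x) = x"
  by (cases x) (auto simp: M(5))

lemma opp_H_darts: "x \<in> darts H \<Longrightarrow> opp H x \<in> darts H"
  by (auto simp: M(7))

lemma rot_H_permutes: "rot H permutes darts H"
proof (rule bij_imp_permutes)
  have sub: "rot H ` darts H \<subseteq> darts H"
  proof
    fix y assume "y \<in> rot H ` darts H"
    then obtain x where x: "x \<in> darts H" "y = rot H x" by blast
    show "y \<in> darts H"
    proof (cases x)
      case (Inl d)
      then show ?thesis using x M(8)[of d] by (cases rule: rot_suspension_cases[OF inj_c, of M d]) auto
    qed (use x in auto)
  qed
  have "x = y" if "rot H x = rot H y" for x y
  proof -
    have inj: "rot M d = rot M e \<Longrightarrow> d = e" for d e using permutes_inj[OF M(2)] by (auto dest: injD)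
    show ?thesis
    proof (cases x; cases y)
      fix d e assume "x = Inl d" "y = Inl e"
      then show ?thesis using that inj[of d e]
        by (cases rule: rot_suspension_cases[OF inj_c, of M d]; cases rule: rot_suspension_cases[OF inj_c, of M e]) auto
    next
      fix d i assume "x = Inl d" "y = Inr i"
      then show ?thesis using that by (cases rule: rot_suspension_cases[OF inj_c, of M d]) auto
    next
      fix d i assume "x = Inr i" "y = Inl d"
      then show ?thesis using that[symmetric] by (cases rule: rot_suspension_cases[OF inj_c, of M d]) auto
    next
      fix i j assume "x = Inr i" "y = Inr j"
      then show ?thesis using that inj_c by (auto dest: injD)
    qed
  qed
  then have inj: "inj_on (rot H) (darts H)" by (auto intro: inj_onI)
  show "bij_betw (rot H) (darts H) (darts H)"
    unfolding bij_betw_def using inj endo_inj_surj[OF finite_H sub inj] by simp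
  fix x assume "x \<notin> darts H"
  then obtain d where d: "x = Inl d" "d \<notin> darts M" by (cases x) auto
  then have "rot M d = d" using M(2) permutes_not_in by metis
  then show "rot H x = x" using d c_dart by (cases rule: rot_suspension_cases[OF inj_c, of M d]) auto
qed

lemmas vertex_H = vertex_of_props[OF finite_H rot_H_permutes]
lemmas vertex_M = vertex_of_props[OF M(1,2)]

lemma self_in_orbit_H: "x \<in> orbit (rot H) x"
  by (rule permutes_self_in_orbit[OF finite_H rot_H_permutes])

text \<open>The half-edge \<open>Inr i\<close> sits at the vertex of \<open>c i\<close>, directly
  before that dart. Replacing it by \<open>c i\<close> lets vertices of the suspension be compared
  with vertices of \<open>M\<close>.\<close>

abbreviation "base \<equiv> case_sum id c"

lemma vertex_base: "vertex_of M (base (rot H x)) = vertex_of M (base x)"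
proof (cases x)
  case (Inl d)
  then show ?thesis using vertex_M(4)[of d] by (cases rule: rot_suspension_cases[OF inj_c, of M d]) auto
qed simp

lemma vertex_H_Inl_rot: "vertex_of H (Inl (rot M d)) = vertex_of H (Inl d)"
proof (cases rule: rot_suspension_cases[OF inj_c, of M d])
  case (1 i)
  then show ?thesis using vertex_H(4)[of "Inl d"] vertex_H(4)[of "Inr i"] by simp
next
  case 2
  then show ?thesis using vertex_H(4)[of "Inl d"] by simp
qed

lemma vertex_H_Inr: "vertex_of H (Inr i) = vertex_of H (Inl (c i))"
  using vertex_H(4)[of "Inr i"] by simp

lemma vertex_H_base: "vertex_of H (Inl (base x)) = vertex_of H x"
  by (cases x) (simp_all add: vertex_H_Inr)

lemma vertex_H_eq_iff: "vertex_of H x = vertex_of H y \<longleftrightarrow> vertex_of M (base x) = vertex_of M (base y)"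
proof
  assume "vertex_of H x = vertex_of H y"
  then have "x \<in> orbit (rot H) y" using vertex_H(1)[of x] by (simp add: vertex_of_def)
  then show "vertex_of M (base x) = vertex_of M (base y)"
    by induction (simp_all add: vertex_base)
next
  assume "vertex_of M (base x) = vertex_of M (base y)"
  then have "base x \<in> orbit (rot M) (base y)" using vertex_M(1)[of "base x"] by (simp add: vertex_of_def)
  then have "vertex_of H (Inl (base x)) = vertex_of H (Inl (base y))"
    by induction (simp_all add: vertex_H_Inl_rot)
  then show "vertex_of H x = vertex_of H y" by (simp add: vertex_H_base)
qed

lemma card_vertices_H: "card (vertices H) = card (vertices M)"
  unfolding vertices_def
proof (rule card_image_eq)
  show "base ` darts H = darts M" by (force simp: image_iff)
qed (rule vertex_H_eq_iff)

lemma rot_opp_mem_iff: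
  assumes "K \<in> inv_sets (face_next M) (darts M)"
  shows "opp M d \<in> K \<longleftrightarrow> rot M d \<in> K"
  using inv_sets_iff[OF M(1,6) assms, of "opp M d"] by (simp add: face_next_def M(5))

lemma connected_H:
  assumes conn: "connected_map M" and sub: "T \<subseteq> darts H" and x: "x \<in> T"
    and opp: "\<And>x. x \<in> darts H \<Longrightarrow> opp H x \<in> T \<longleftrightarrow> x \<in> T"
    and rot: "\<And>x. x \<in> darts H \<Longrightarrow> rot H x \<in> T \<longleftrightarrow> x \<in> T"
  shows "T = darts H"
proof -
  have base: "Inl (base y) \<in> T \<longleftrightarrow> y \<in> T" for y using rot[of y] by (cases y) auto
  let ?T = "{d \<in> darts M. Inl d \<in> T}"
  have "e \<in> ?T" if "e \<in> darts M" for e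
  proof (rule connected_invariant[OF conn _ _ that])
    show "base x \<in> ?T" using base[of x] x sub by (cases x) auto
    fix d assume d: "d \<in> ?T"
    then show "opp M d \<in> ?T" using opp[of "Inl d"] M(7) by auto
    show "rot M d \<in> ?T"
    proof (cases rule: rot_suspension_cases[OF inj_c, of M d])
      case (1 i)
      then show ?thesis using d rot[of "Inl d"] rot[of "Inr i"] by auto
    next
      case 2
      then show ?thesis using d rot[of "Inl d"] M(8)[of d] by auto
    qed
  qed auto
  then have "y \<in> T" if "y \<in> darts H" for y using base[of y] that by (cases y) auto
  then show ?thesis using sub by blast
qed

end

lemma card_edges:
  assumes "comb_map M" shows "card (darts M) = 2 * card (edges M)"
proof -
  note M = comb_mapD[OF assms]
  have orb: "orbit (opp M) d = {d, opp M d}" for d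
  proof
    show "orbit (opp M) d \<subseteq> {d, opp M d}"
    proof
      fix x assume "x \<in> orbit (opp M) d" then show "x \<in> {d, opp M d}"
        by induction (use M(5) in auto)
    qed
    show "{d, opp M d} \<subseteq> orbit (opp M) d"
      using permutes_self_in_orbit[OF M(1,3)] orbit.base[of "opp M" d] by auto
  qed
  have "darts M = \<Union> (edges M)"
    using M(7) by (auto simp: edges_def orb)
  moreover have "card (\<Union> (edges M)) = (\<Sum>e\<in>edges M. card e)"
  proof (rule card_Union_disjoint)
    show "pairwise disjnt (edges M)"
      unfolding pairwise_def disjnt_def edges_def
      using orbit_partition[OF M(1,3)] by blast
    show "finite A" if "A \<in> edges M" for A using that by (auto simp: edges_def orb)
  qed
  moreover have "card e = 2" if "e \<in> edges M" for e
    using that M(4)[symmetric] by (auto simp: edges_def orb card_insert_if)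
  ultimately show ?thesis by simp
qed

section \<open>Planar Schnyder woods and regions\<close>

text \<open>What a toroidal wood leaves on \<open>G\<close>. The colors of the half-edges stay open,
  as a toroidal wood fixes them only up to a shift, and acyclicity is what has to be shown. By
  \<open>c_face\<close> the three corners lie on one face, which is taken as the outer one.\<close>

locale suspended_wood = suspended +
  fixes f :: "'a + 3 \<Rightarrow> color option"
  assumes planar: "planar_map M"
    and c_face: "\<And>i. c i \<in> orbit (face_next M) (c 0)"
    and coloring: "orientation_coloring H f"
    and schnyder: "\<And>v. v \<in> vertices H \<Longrightarrow> schnyder_property H f v"
begin

lemma schnyder_at_ex:
  assumes "x \<in> darts H" obtains e where "schnyder_at H f (vertex_of H x) e"
  using schnyder[of "vertex_of H x"] assms by (auto simp: vertices_def schnyder_property_iff)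

lemma out_unique:
  assumes "x \<in> darts H" "f x = Some i" "f y = Some i" "vertex_of H x = vertex_of H y"
  shows "x = y"
proof -
  obtain e where e: "schnyder_at H f (vertex_of H x) e" using schnyder_at_ex[OF assms(1)] .
  have "x \<in> vertex_of H x" "y \<in> vertex_of H x" using vertex_H(1)[of x] vertex_H(1)[of y] assms(4) by auto
  then have "x = e i" "y = e i" using e assms(2,3) unfolding schnyder_at_def by blast+
  then show ?thesis by simp
qed

lemma coloring_ne: "x \<in> darts H \<Longrightarrow> opp H x \<noteq> x \<Longrightarrow> f x \<noteq> f (opp H x)"
  using coloring unfolding orientation_coloring_def by blast

text \<open>The two directions of an edge never share a color, so the cycle does not turn back on
  the edge it arrived by; and it passes each of its vertices only once.\<close>

lemma cycle_edges_at_vertex: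
  assumes C: "mono_cycle H f i ds" and x: "x \<in> set ds" and p: "p \<in> set ds"
    and px: "vertex_of H (opp H p) = vertex_of H x"
  shows "x \<noteq> opp H p"
    and "z \<in> vertex_of H x \<Longrightarrow> z \<in> set ds \<or> opp H z \<in> set ds \<longleftrightarrow> z = x \<or> z = opp H p"
proof -
  have props: "d \<in> darts H" "opp H d \<noteq> d" "f d = Some i" if "d \<in> set ds" for d
    using that C by (auto simp: mono_cycle_def is_walk_def simp del: suspension_simps)
  show "x \<noteq> opp H p"
    using coloring_ne[of p] props[OF p] props[OF x] by auto
  assume z: "z \<in> vertex_of H x"
  have "z = x" if "z \<in> set ds" using mono_cycle_inj[OF C that x] z vertex_H(3) by simp
  moreover have "opp H z = p" if "opp H z \<in> set ds"
    using mono_cycle_prev_inj[OF C that p] z vertex_H(3) px by simp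
  moreover have "opp H z = p \<longleftrightarrow> z = opp H p" by auto
  ultimately show "z \<in> set ds \<or> opp H z \<in> set ds \<longleftrightarrow> z = x \<or> z = opp H p"
    using x p by auto
qed

text \<open>A region is a union of faces other than the outer one.  It is represented by the darts having
  such a face on their right, so that \<open>opp H x\<close> decides about the face on the left of \<open>x\<close>.\<close>

definition face_union :: "('a + 3) set \<Rightarrow> bool" where
  "face_union S \<longleftrightarrow> S \<subseteq> darts H \<and> (\<forall>x\<in>darts H. rot H x \<in> S \<longleftrightarrow> opp H x \<in> S) \<and> (\<forall>i. Inr i \<notin> S)"

definition region :: "('a + 3) set \<Rightarrow> ('a + 3) set \<Rightarrow> bool" where
  "region S C \<longleftrightarrow> face_union S \<and>
     (\<forall>x\<in>darts H. (x \<in> S) \<noteq> (opp H x \<in> S) \<longleftrightarrow> x \<in> C \<or> opp H x \<in> C)"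

text \<open>A cycle has degree 0 or 2 at every vertex, so it is the boundary of a set of faces by
  \<open>planar_even_is_boundary\<close>.\<close>

lemma ex_region:
  assumes C: "mono_cycle H f i ds"
  obtains S where "region S (set ds)"
proof -
  have ds: "d \<in> darts H" "opp H d \<noteq> d" if "d \<in> set ds" for d
    using that C by (auto simp: mono_cycle_def is_walk_def simp del: suspension_simps)
  have Inl: "\<exists>d'. d = Inl d' \<and> d' \<in> darts M" if "d \<in> set ds" for d
    using ds[OF that] by (cases d) auto
  let ?X = "{d \<in> darts M. Inl d \<in> set ds \<or> Inl (opp M d) \<in> set ds}"
  have X: "?X \<in> inv_sets (opp M) (darts M)"
    using M(5,7) by (auto simp: inv_sets_def)
  have even: "even (card (?X \<inter> vertex_of M d))" if d: "d \<in> darts M" for d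
  proof (cases "?X \<inter> vertex_of M d = {}")
    case True
    then show ?thesis by simp
  next
    case False
    then obtain z where z: "z \<in> ?X" "z \<in> vertex_of M d" by blast
    have "\<exists>x\<in>set ds. vertex_of H x = vertex_of H (Inl z)"
    proof (cases "Inl z \<in> set ds")
      case False
      then have "Inl (opp M z) \<in> set ds" using z by auto
      from mono_cycle_next[OF C this] obtain e where
        "e \<in> set ds" "vertex_of H (opp H (Inl (opp M z))) = vertex_of H e" .
      then show ?thesis using M(5) by auto
    qed auto
    then obtain x where x: "x \<in> set ds" "vertex_of H x = vertex_of H (Inl z)" by blast
    obtain p where p: "p \<in> set ds" "vertex_of H (opp H p) = vertex_of H x"
      using mono_cycle_prev[OF C x(1)] .
    obtain x' p' where xp: "x = Inl x'" "x' \<in> darts M" "p = Inl p'" "p' \<in> darts M"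
      using Inl[OF x(1)] Inl[OF p(1)] by blast
    have vd: "u \<in> vertex_of M d \<longleftrightarrow> Inl u \<in> vertex_of H x" for u
      using x(2) z(2) vertex_M(3) vertex_H(3) vertex_H_eq_iff[of "Inl u" "Inl z"] by simp
    have mem: "u \<in> vertex_of M d \<and> (Inl u \<in> set ds \<or> Inl (opp M u) \<in> set ds) \<longleftrightarrow> u = x' \<or> u = opp M p'" for u
    proof -
      have "Inl x' \<in> vertex_of H x" "Inl (opp M p') \<in> vertex_of H x"
        using vertex_H(3) p xp by auto
      then show ?thesis
        using cycle_edges_at_vertex(2)[OF C x(1) p, of "Inl u"] vd xp by auto
    qed
    have "?X \<inter> vertex_of M d = {x', opp M p'}"
      using mem xp M(7) by auto
    moreover have "x' \<noteq> opp M p'" using cycle_edges_at_vertex(1)[OF C x(1) p] xp by auto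
    ultimately show ?thesis by simp
  qed
  then have "odd_vertices M ?X = {}" by (auto simp: odd_vertices_def)
  from planar_even_is_boundary[OF planar X this] obtain K
    where K: "K \<in> inv_sets (face_next M) (darts M)" "boundary M K = ?X" .
  \<comment> \<open>\<open>K\<close> and its complement have the same boundary. The one without the
    outer face is taken; \<open>c 0\<close> has the outer face on its right.\<close>
  define K' where "K' = (if c 0 \<in> K then darts M - K else K)"
  have K': "opp M d \<in> K' \<longleftrightarrow> rot M d \<in> K'" if "d \<in> darts M" for d
    using rot_opp_mem_iff[OF K(1), of d] M(7,8) that by (auto simp: K'_def)
  have bd: "(d \<in> K') \<noteq> (opp M d \<in> K') \<longleftrightarrow> Inl d \<in> set ds \<or> Inl (opp M d) \<in> set ds" if "d \<in> darts M" for d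
    using K(2) that M(7) unfolding boundary_def K'_def by auto
  have "(c i \<in> K) = (c 0 \<in> K)" for i
  proof -
    have "c i \<in> K" if "c 0 \<in> K" using inv_sets_orbit[OF K(1) that] c_face by blast
    moreover have "c 0 \<in> K" if "c i \<in> K"
      using inv_sets_orbit[OF K(1) that] c_face[of i] orbit_swap[OF permutes_self_in_orbit[OF M(1,6)]] by blast
    ultimately show ?thesis by blast
  qed
  then have cK: "c i \<notin> K'" for i by (auto simp: K'_def)
  have sub: "K' \<subseteq> darts M" using K(1) by (auto simp: K'_def inv_sets_def)
  have "rot H x \<in> Inl ` K' \<longleftrightarrow> opp H x \<in> Inl ` K'" if "x \<in> darts H" for x
  proof (cases x)
    case (Inl d)
    then show ?thesis using K'[of d] that cK
      by (cases rule: rot_suspension_cases[OF inj_c, of M d]) auto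
  qed (use cK in auto)
  moreover have "(x \<in> Inl ` K') \<noteq> (opp H x \<in> Inl ` K') \<longleftrightarrow> x \<in> set ds \<or> opp H x \<in> set ds"
    if "x \<in> darts H" for x
  proof (cases x)
    case (Inl d)
    then show ?thesis using bd[of d] that by auto
  next
    case (Inr i)
    then show ?thesis using Inl by auto
  qed
  ultimately have "region (Inl ` K') (set ds)"
    unfolding region_def face_union_def using sub by auto
  then show thesis using that by blast
qed

text \<open>By connectedness a set of faces without boundary is empty or everything, and the
  half-edges keep a \<open>face_union\<close> from being everything.\<close>

lemma face_union_all:
  assumes S: "face_union S" and opp: "\<And>x. x \<in> darts H \<Longrightarrow> opp H x \<in> S \<longleftrightarrow> x \<in> S"
  shows "S = {}"
proof (rule ccontr)
  assume "S \<noteq> {}"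
  then obtain x where "x \<in> S" by blast
  have "S = darts H"
  proof (rule connected_H[OF _ _ \<open>x \<in> S\<close> opp])
    show "connected_map M" using planar by (simp add: planar_map_def)
    show "S \<subseteq> darts H" using S by (simp add: face_union_def)
    show "rot H y \<in> S \<longleftrightarrow> y \<in> S" if "y \<in> darts H" for y
      using S opp[OF that] that unfolding face_union_def by blast
  qed
  then show False using S unfolding face_union_def by auto
qed

lemma face_union_rot: "face_union S \<Longrightarrow> z \<in> darts H \<Longrightarrow> rot H z \<in> S \<longleftrightarrow> opp H z \<in> S"
  unfolding face_union_def by blast

text \<open>Since only edges of the cycle may separate \<open>K\<close> from its complement,
  membership in \<open>K\<close> is constant on the arc left of the cycle at a vertex and on the arc
  right of it, and the two values are carried around the cycle. This is applied to the interior of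
  the cycle and to the part of another interior outside it.\<close>

lemma sides_constant:
  assumes C: "mono_cycle H f i ds" and K: "face_union K"
    and bd: "\<And>x. \<lbrakk>x \<in> darts H; x \<in> K; opp H x \<notin> K\<rbrakk> \<Longrightarrow> x \<in> set ds \<or> opp H x \<in> set ds"
    and de: "d \<in> set ds" "e \<in> set ds"
  shows "(opp H d \<in> K \<longleftrightarrow> opp H e \<in> K) \<and> (d \<in> K \<longleftrightarrow> e \<in> K)"
proof (rule mono_cycle_induct[OF C de(1) _ de(2)])
  fix p x assume px: "p \<in> set ds" "x \<in> set ds" "vertex_of H (opp H p) = vertex_of H x"
    and IH: "(opp H d \<in> K \<longleftrightarrow> opp H p \<in> K) \<and> (d \<in> K \<longleftrightarrow> p \<in> K)"
  have x: "x \<in> darts H" using C px by (auto simp: mono_cycle_def is_walk_def simp del: suspension_simps)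
  let ?y = "opp H p"
  have orb: "orbit (rot H) ?y = orbit (rot H) x" using px(3) by (simp add: vertex_of_def)
  have y: "?y \<in> orbit (rot H) x" "?y \<noteq> x"
    using self_in_orbit_H[of ?y] orb cycle_edges_at_vertex(1)[OF C px(2,1,3)] by auto
  have z_dart: "z \<in> darts H" if "z \<in> orbit (rot H) x" for z
    using vertex_H(2)[OF x] that unfolding vertex_of_def by blast
  have rot: "rot H z \<in> K \<longleftrightarrow> opp H z \<in> K" if "z \<in> orbit (rot H) x" for z
    using face_union_rot[OF K z_dart[OF that]] .
  have cross: "opp H z \<in> K \<longleftrightarrow> z \<in> K" if z: "z \<in> orbit (rot H) x" "z \<noteq> x" "z \<noteq> ?y" for z
  proof -
    have "\<not> (z \<in> set ds \<or> opp H z \<in> set ds)"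
      using cycle_edges_at_vertex(2)[OF C px(2,1,3), of z] z by (simp add: vertex_of_def)
    then show ?thesis using bd[of z] bd[of "opp H z"] z_dart[OF z(1)] opp_H_darts[of z] by auto
  qed
  \<comment> \<open>The arc from \<open>x\<close> counterclockwise to \<open>?y\<close> is on the
    left of the cycle, the one from \<open>?y\<close> on to \<open>x\<close> on its right.\<close>
  have 1: "?y \<in> K \<longleftrightarrow> opp H x \<in> K"
    using arc_constant(1)[OF self_in_orbit_H y, of "\<lambda>z. z \<in> K" "opp H"] rot cross by blast
  have "x \<in> K \<longleftrightarrow> opp H ?y \<in> K"
    using arc_constant(1)[OF self_in_orbit_H, of x ?y "\<lambda>z. z \<in> K" "opp H"] rot cross
      self_in_orbit_H[of x] y(2) orb by metis
  then show "(opp H d \<in> K \<longleftrightarrow> opp H x \<in> K) \<and> (d \<in> K \<longleftrightarrow> x \<in> K)"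
    using 1 IH by simp
qed simp

end

section \<open>Exclusion of monochromatic cycles in the planar map\<close>

context suspended_wood begin

text \<open>The side of a cycle towards which the outgoing darts of color \<open>i + s\<close> point: left for \<open>s = 1\<close>,
  right for \<open>s = 2 = -1\<close>.\<close>

definition side :: "color \<Rightarrow> ('a + 3) set \<Rightarrow> 'a + 3 \<Rightarrow> bool" where
  "side s S x \<longleftrightarrow> (if s = 1 then opp H x \<in> S else x \<in> S)"

text \<open>An edge entering in color \<open>i\<close> lies between the outgoing darts of colors
  \<open>i + 1\<close> and \<open>i - 1\<close>. So the counterclockwise order is
  \<open>x = e i\<close>, \<open>e (i + 1)\<close>, \<open>opp H p\<close>,
  \<open>e (i - 1)\<close>, where \<open>opp H p\<close> may coincide with a neighbor: color
  \<open>i + 1\<close> leaves to the left, color \<open>i - 1\<close> to the right, unless it runs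
  back along the cycle. If color \<open>i + s\<close> runs back, then color \<open>i - s\<close>
  strictly leaves on the other side, and its sector of entering edges is exactly the closed arc on
  side \<open>s\<close>.\<close>

lemma color_at_cycle:
  assumes C: "mono_cycle H f i ds" and x: "x \<in> set ds" and p: "p \<in> set ds"
    and px: "vertex_of H (opp H p) = vertex_of H x"
    and S: "region S (set ds)" and s: "s = 1 \<or> s = 2"
    and e: "schnyder_at H f (vertex_of H x) e"
  shows "e (i + s) = opp H p \<or> (e (i + s) \<in> S \<longleftrightarrow> side s S x) \<and> (opp H (e (i + s)) \<in> S \<longleftrightarrow> side s S x)"
    and "e (i + s) = opp H p \<Longrightarrow> (e (i - s) \<in> S \<longleftrightarrow> \<not> side s S x) \<and> (opp H (e (i - s)) \<in> S \<longleftrightarrow> \<not> side s S x)"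
    and "\<lbrakk>e (i + s) = opp H p; z \<in> vertex_of H x; opp H z \<noteq> z; f (opp H z) = Some (i - s)\<rbrakk>
      \<Longrightarrow> z = x \<or> z = opp H p \<or> (z \<in> S \<longleftrightarrow> side s S x) \<and> (opp H z \<in> S \<longleftrightarrow> side s S x)"
proof -
  let ?y = "opp H p" and ?r = "rot H"
  note self = self_in_orbit_H
  have dart: "d \<in> darts H" "opp H d \<noteq> d" "f d = Some i" if "d \<in> set ds" for d
    using that C by (auto simp: mono_cycle_def is_walk_def simp del: suspension_simps)
  have orb: "orbit ?r ?y = orbit ?r x" using px by (simp add: vertex_of_def)
  have xv: "x \<in> vertex_of H x" "?y \<in> vertex_of H x" using vertex_H(3) px by auto
  have ex: "e i = x" using e xv(1) dart(3)[OF x] unfolding schnyder_at_def by simp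
  have y_ne: "x \<noteq> ?y" by (rule cycle_edges_at_vertex(1)[OF C x p px])
  have cyc: "cyclic_order ?r (e j) (e (j + 1)) (e (j - 1))" for j
    using schnyder_at_cyclic[OF e self] .
  have cyc_i: "cyclic_order ?r x (e (i + 1)) (e (i - 1))" using cyc[of i] ex by simp
  have inc: "z = e (j + 1) \<or> z = e (j - 1) \<or> cyclic_order ?r (e (j + 1)) z (e (j - 1))"
    if "z \<in> vertex_of H x" "opp H z \<noteq> z" "f (opp H z) = Some j" for z j
    using e that unfolding schnyder_at_def by blast
  have y_inc: "?y = e (i + 1) \<or> ?y = e (i - 1) \<or> cyclic_order ?r (e (i + 1)) ?y (e (i - 1))"
    using inc[OF xv(2), of i] dart[OF p] by (metis opp_opp_H)
  have z_dart: "z \<in> darts H" if "z \<in> orbit ?r x" for z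
    using vertex_H(2)[OF dart(1)[OF x]] that unfolding vertex_of_def by blast
  have fu: "face_union S" using S by (simp add: region_def)
  have rot: "?r z \<in> S \<longleftrightarrow> opp H z \<in> S" if "z \<in> orbit ?r x" for z
    using face_union_rot[OF fu z_dart[OF that]] .
  have cross: "opp H z \<in> S \<longleftrightarrow> z \<in> S" if z: "z \<in> orbit ?r x" "z \<noteq> x" "z \<noteq> ?y" for z
    using cycle_edges_at_vertex(2)[OF C x p px, of z] z z_dart[OF z(1)] S
    unfolding region_def vertex_of_def by blast
  have y: "?y \<in> orbit ?r x" using xv(2) by (simp add: vertex_of_def)
  have left: "(z \<in> S \<longleftrightarrow> opp H x \<in> S) \<and> (opp H z \<in> S \<longleftrightarrow> opp H x \<in> S)" if "cyclic_order ?r x z ?y" for z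
    using arc_constant(2)[OF self y y_ne[symmetric], of "\<lambda>z. z \<in> S" "opp H"] rot cross that by blast
  have "x \<in> orbit ?r ?y" using self[of x] orb by simp
  note right0 = arc_constant[OF self this y_ne, of "\<lambda>z. z \<in> S" "opp H", unfolded orb]
  have "x \<in> S \<longleftrightarrow> opp H ?y \<in> S" using right0(1) rot cross by blast
  then have right: "(z \<in> S \<longleftrightarrow> x \<in> S) \<and> (opp H z \<in> S \<longleftrightarrow> x \<in> S)" if "cyclic_order ?r ?y z x" for z
    using right0(2)[of z] rot cross that by blast
  have sides: "x \<in> S \<longleftrightarrow> opp H x \<notin> S"
    using S dart(1)[OF x] x unfolding region_def by blast
  have left1: "e (i + 1) = ?y \<or> cyclic_order ?r x (e (i + 1)) ?y"
    using y_inc cyc_i cyclic_order_trans(1)[OF self cyc_i, of ?y] by metis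
  have right1: "e (i - 1) = ?y \<or> cyclic_order ?r ?y (e (i - 1)) x"
  proof -
    have "cyclic_order ?r (e (i + 1)) (e (i - 1)) x" by (rule cyclic_order_rotate[OF self cyc_i])
    then show ?thesis using y_inc cyclic_order_trans'[OF self, of "e (i + 1)" ?y "e (i - 1)" x] by metis
  qed
  have side1: "side 1 S x \<longleftrightarrow> opp H x \<in> S" and side2: "side 2 S x \<longleftrightarrow> x \<in> S" by (auto simp: side_def)
  show "e (i + s) = ?y \<or> (e (i + s) \<in> S \<longleftrightarrow> side s S x) \<and> (opp H (e (i + s)) \<in> S \<longleftrightarrow> side s S x)"
    using s
  proof
    assume [simp]: "s = 1"
    show ?thesis using left1 left[of "e (i + 1)"] side1 by auto
  next
    assume [simp]: "s = 2"
    show ?thesis using right1 right[of "e (i - 1)"] side2 by auto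
  qed
  have neq: "e (i + 1) \<noteq> e (i - 1)" using cyclic_order_mem(5)[OF self cyc_i] .
  show "(e (i - s) \<in> S \<longleftrightarrow> \<not> side s S x) \<and> (opp H (e (i - s)) \<in> S \<longleftrightarrow> \<not> side s S x)" if "e (i + s) = ?y"
    using s
  proof
    assume [simp]: "s = 1"
    have "cyclic_order ?r ?y (e (i - 1)) x" using right1 that neq by auto
    then show ?thesis using right sides by (simp add: side1)
  next
    assume [simp]: "s = 2"
    have "cyclic_order ?r x (e (i + 1)) ?y" using left1 that neq by auto
    then show ?thesis using left sides by (simp add: side2)
  qed
  show "z = x \<or> z = ?y \<or> (z \<in> S \<longleftrightarrow> side s S x) \<and> (opp H z \<in> S \<longleftrightarrow> side s S x)"
    if "e (i + s) = ?y" "z \<in> vertex_of H x" "opp H z \<noteq> z" "f (opp H z) = Some (i - s)"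
    using s
  proof
    assume [simp]: "s = 1"
    have "z = x \<or> z = ?y \<or> cyclic_order ?r x z ?y"
      using inc[of z "i - 1"] that ex by auto
    then show ?thesis using left by (auto simp: side1)
  next
    assume [simp]: "s = 2"
    have "z = x \<or> z = ?y \<or> cyclic_order ?r ?y z x"
      using inc[of z "i + 1"] that ex by auto
    then show ?thesis using right by (auto simp: side2)
  qed
qed

lemma no_mono_cycle:
  assumes T2: "\<And>i ds. mono_cycle H f i ds \<Longrightarrow>
      (\<exists>es. mono_cycle H f (i - 1) es \<and> cycles_intersect H ds es) \<and>
      (\<exists>es. mono_cycle H f (i + 1) es \<and> cycles_intersect H ds es)"
  shows "\<not> mono_cycle H f i0 ds0"
proof
  assume C0: "mono_cycle H f i0 ds0"
  obtain S0 where "region S0 (set ds0)" using ex_region[OF C0] .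
  \<comment> \<open>The minimum is taken over cycles of all three colors, because the cycle to be
    compared with it has another color. Size is counted in darts.\<close>
  define R where "R n \<longleftrightarrow> (\<exists>i ds S. mono_cycle H f i ds \<and> region S (set ds) \<and> card S = n)" for n
  have "R (card S0)" unfolding R_def using C0 \<open>region S0 (set ds0)\<close> by blast
  then have least: "R (LEAST n. R n)" by (rule LeastI)
  then obtain i ds S where C: "mono_cycle H f i ds" and S: "region S (set ds)"
    and "card S = (LEAST n. R n)" unfolding R_def by blast
  then have minimal: "card S \<le> card T" if "mono_cycle H f j es" "region T (set es)" for j es T
    using Least_le[of R "card T"] that unfolding R_def by auto
  have dart: "d \<in> darts H" "opp H d \<noteq> d" "f d = Some j" if "mono_cycle H f j es" "d \<in> set es" for d j es
    using that by (auto simp: mono_cycle_def is_walk_def simp del: suspension_simps)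
  have fu: "face_union S" using S by (simp add: region_def)
  have bd: "(x \<in> S) \<noteq> (opp H x \<in> S) \<longleftrightarrow> x \<in> set ds \<or> opp H x \<in> set ds" if "x \<in> darts H" for x
    using S that unfolding region_def by blast
  obtain x0 where x0: "x0 \<in> set ds" using C by (cases ds) (auto simp: mono_cycle_def)
  \<comment> \<open>\<open>opp H x0 \<in> S\<close> means that the interior is on the left. With
    this \<open>s\<close>, color \<open>i + s\<close> leaves the cycle into the interior or runs
    back along the cycle.\<close>
  define s :: color where "s = (if opp H x0 \<in> S then 1 else 2)"
  have s: "s = 1 \<or> s = 2" by (simp add: s_def)
  have sides: "(opp H x \<in> S \<longleftrightarrow> opp H y \<in> S) \<and> (x \<in> S \<longleftrightarrow> y \<in> S)" if "x \<in> set ds" "y \<in> set ds" for x y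
    by (rule sides_constant[OF C fu _ that]) (use bd in auto)
  have sideS: "side s S x" if "x \<in> set ds" for x
    using sides[OF that x0] bd[of x0] dart(1)[OF C x0] x0 by (auto simp: side_def s_def)
  have off: "z \<in> S \<longleftrightarrow> opp H z \<in> S"
    if z: "z \<in> darts H" and "\<forall>y\<in>set ds. vertex_of H y \<noteq> vertex_of H z" for z
  proof -
    have "z \<notin> set ds" using that(2) by blast
    moreover have "opp H z \<notin> set ds"
    proof
      assume "opp H z \<in> set ds"
      from mono_cycle_next[OF C this] that(2) show False by (metis opp_opp_H)
    qed
    ultimately show ?thesis using bd[OF z] by blast
  qed
  \<comment> \<open>Around a vertex off the cycle no separating edge is met, so the vertex is
    entirely inside or entirely outside.\<close>
  have off_const: "u \<in> S \<longleftrightarrow> w \<in> S"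
    if w: "w \<in> darts H" and away: "\<forall>y\<in>set ds. vertex_of H y \<noteq> vertex_of H w" and u: "u \<in> vertex_of H w" for u w
    using u unfolding vertex_of_def
  proof induction
    case base
    then show ?case using face_union_rot[OF fu w] off[OF w away] by simp
  next
    case (step u)
    have u: "u \<in> vertex_of H w" using step(1) by (simp add: vertex_of_def)
    have "u \<in> darts H" using vertex_H(2)[OF w] u by blast
    moreover have "\<forall>y\<in>set ds. vertex_of H y \<noteq> vertex_of H u" using away u vertex_H(3) by simp
    ultimately show ?case using face_union_rot[OF fu] off step(2) by blast
  qed
  \<comment> \<open>The darts of color \<open>i + s\<close> in the closed disk. The disjunction
    admits edges of the cycle itself, which have \<open>S\<close> on one side only.\<close>
  define Z where "Z = {z \<in> darts H. f z = Some (i + s) \<and> opp H z \<noteq> z \<and> (z \<in> S \<or> opp H z \<in> S)}"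
  have ex_Z: "\<exists>z\<in>Z. vertex_of H z = vertex_of H x" if x: "x \<in> darts H" and w: "w \<in> vertex_of H x" "w \<in> S" for x w
  proof (cases "\<exists>y\<in>set ds. vertex_of H y = vertex_of H x")
    case True
    then obtain y where y: "y \<in> set ds" "vertex_of H y = vertex_of H x" by blast
    obtain p where p: "p \<in> set ds" "vertex_of H (opp H p) = vertex_of H y" using mono_cycle_prev[OF C y(1)] .
    obtain e where e: "schnyder_at H f (vertex_of H y) e" using schnyder_at_ex[OF dart(1)[OF C y(1)]] .
    let ?z = "e (i + s)"
    have z: "?z \<in> vertex_of H y" "f ?z = Some (i + s)" using e by (auto simp: schnyder_at_def)
    have "?z \<in> darts H" using z(1) vertex_H(2)[OF x] y(2) by auto
    moreover have "opp H ?z \<noteq> ?z \<and> (?z \<in> S \<or> opp H ?z \<in> S)"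
    proof (cases "?z = opp H p")
      case True
      then show ?thesis using dart[OF C p(1)] bd[OF dart(1)[OF C p(1)]] p(1) by auto
    next
      case False
      then have "?z \<in> S" "opp H ?z \<in> S"
        using color_at_cycle(1)[OF C y(1) p S s e] sideS[OF y(1)] by auto
      then show ?thesis using fu unfolding face_union_def by (cases ?z) (auto simp: M(4))
    qed
    ultimately have "?z \<in> Z" using z(2) by (simp add: Z_def del: suspension_simps)
    moreover have "vertex_of H ?z = vertex_of H x" using z(1) vertex_H(3) y(2) by simp
    ultimately show ?thesis by blast
  next
    case False
    obtain e where e: "schnyder_at H f (vertex_of H x) e" using schnyder_at_ex[OF x] .
    let ?z = "e (i + s)"
    have z: "?z \<in> vertex_of H x" "f ?z = Some (i + s)" using e by (auto simp: schnyder_at_def)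
    have w_dart: "w \<in> darts H" using vertex_H(2)[OF x] w(1) by blast
    have wx: "vertex_of H w = vertex_of H x" using w(1) vertex_H(3) by simp
    have off: "\<forall>y\<in>set ds. vertex_of H y \<noteq> vertex_of H w" using False wx by simp
    have z_in: "?z \<in> S" using off_const[OF w_dart off, of ?z] z(1) w(2) wx by simp
    have z_dart: "?z \<in> darts H" using z(1) vertex_H(2)[OF x] by blast
    have "opp H ?z \<noteq> ?z" using z_in fu unfolding face_union_def by (cases ?z) (auto simp: M(4))
    then have "?z \<in> Z" using z(2) z_in z_dart by (simp add: Z_def del: suspension_simps)
    moreover have "vertex_of H ?z = vertex_of H x" using z(1) vertex_H(3) by simp
    ultimately show ?thesis by blast
  qed
  have "\<exists>e\<in>Z. vertex_of H (opp H z) = vertex_of H e" if "z \<in> Z" for z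
  proof -
    have z: "z \<in> darts H" "z \<in> S \<or> opp H z \<in> S" using that by (auto simp: Z_def simp del: suspension_simps)
    have oz: "opp H z \<in> darts H" by (rule opp_H_darts[OF z(1)])
    \<comment> \<open>Both faces beside \<open>z\<close> have a corner at its end, so this end again
      belongs to the closed disk.\<close>
    have "rot H (opp H z) \<in> S \<or> opp H z \<in> S" using face_union_rot[OF fu oz] z(2) by simp
    moreover have "opp H z \<in> vertex_of H (opp H z)" "rot H (opp H z) \<in> vertex_of H (opp H z)"
      using vertex_H(1)[of "opp H z"] vertex_H(3,4) by auto
    ultimately show ?thesis using ex_Z[OF oz] by metis
  qed
  note step = this
  have "rot H x0 \<in> S \<or> x0 \<in> S"
    using face_union_rot[OF fu dart(1)[OF C x0]] bd[OF dart(1)[OF C x0]] x0 by blast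
  moreover have "x0 \<in> vertex_of H x0" "rot H x0 \<in> vertex_of H x0"
      using vertex_H(1)[of x0] vertex_H(3,4) by auto
  ultimately obtain z0 where z0: "z0 \<in> Z" using ex_Z[OF dart(1)[OF C x0]] by blast
  have "finite Z" unfolding Z_def using finite_H by simp
  moreover have "inj_on (vertex_of H) Z"
    using out_unique unfolding Z_def inj_on_def by blast
  moreover have "d \<in> darts H \<and> opp H d \<noteq> d \<and> f d = Some (i + s)" if "d \<in> Z" for d
    using that unfolding Z_def by blast
  ultimately obtain es where D: "mono_cycle H f (i + s) es" and es: "set es \<subseteq> Z"
    using ex_mono_cycle[OF _ z0, of H f "i + s"] step by blast
  obtain T where T: "region T (set es)" using ex_region[OF D] .
  have fuT: "face_union T" using T by (simp add: region_def)
  have bdT: "(x \<in> T) \<noteq> (opp H x \<in> T) \<longleftrightarrow> x \<in> set es \<or> opp H x \<in> set es" if "x \<in> darts H" for x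
    using T that unfolding region_def by blast
  \<comment> \<open>The edges around the faces of \<open>T\<close> outside \<open>S\<close> belong
    to \<open>ds\<close>: an edge of \<open>es\<close> has \<open>S\<close> on some side, so if it
    also has \<open>T - S\<close> on a side, it separates \<open>S\<close> from its
    complement.\<close>
  have fuK: "face_union (T - S)" using fu fuT unfolding face_union_def by blast
  have bdK: "x \<in> set ds \<or> opp H x \<in> set ds" if x: "x \<in> darts H" "x \<in> T - S" "opp H x \<notin> T - S" for x
  proof (cases "opp H x \<in> T")
    case True
    then show ?thesis using x bd[OF x(1)] by blast
  next
    case False
    then have "x \<in> set es \<or> opp H x \<in> set es" using bdT[OF x(1)] x by blast
    moreover have "y \<in> S \<or> opp H y \<in> S" if "y \<in> set es" for y
      using subsetD[OF es that] unfolding Z_def by blast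
    ultimately have "x \<in> S \<or> opp H x \<in> S" using opp_opp_H[of x] by metis
    then show ?thesis using x bd[OF x(1)] by blast
  qed
  have "T \<subseteq> S"
  proof (rule ccontr)
    assume nsub: "\<not> T \<subseteq> S"
    have K_sides: "(opp H x \<in> T - S \<longleftrightarrow> opp H y \<in> T - S) \<and> (x \<in> T - S \<longleftrightarrow> y \<in> T - S)"
      if "x \<in> set ds" "y \<in> set ds" for x y
      by (rule sides_constant[OF C fuK _ that]) (rule bdK)
    have "\<exists>x\<in>darts H. x \<in> T - S \<and> opp H x \<notin> T - S"
    proof (rule ccontr)
      assume no: "\<not> ?thesis"
      have "opp H x \<in> T - S \<longleftrightarrow> x \<in> T - S" if "x \<in> darts H" for x
        using no that opp_H_darts[OF that] opp_opp_H[of x] by metis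
      from face_union_all[OF fuK this] show False using nsub by blast
    qed
    then obtain x1 where x1: "x1 \<in> darts H" "x1 \<in> T - S" "opp H x1 \<notin> T - S" by blast
    obtain y1 where y1: "y1 \<in> set ds" "(y1 \<in> T - S) \<noteq> (opp H y1 \<in> T - S)"
      using bdK[OF x1] x1(2,3) opp_opp_H[of x1] by metis
    have cross: "(x \<in> T - S) \<noteq> (opp H x \<in> T - S)" if "x \<in> set ds" for x
      using K_sides[OF that y1(1)] y1(2) by simp
    \<comment> \<open>By now every edge of \<open>ds\<close> has \<open>S\<close> on one side and
      \<open>T - S\<close> on the other, so \<open>T \<union> S\<close> has no boundary at
      all.\<close>
    have "face_union (T \<union> S)" using fu fuT unfolding face_union_def by blast
    moreover have "opp H x \<in> T \<union> S \<longleftrightarrow> x \<in> T \<union> S" if x: "x \<in> darts H" for x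
    proof (cases "x \<in> set ds \<or> opp H x \<in> set ds")
      case True
      then have "(x \<in> T - S) \<noteq> (opp H x \<in> T - S)" using cross[of x] cross[of "opp H x"] by auto
      moreover have "(x \<in> S) \<noteq> (opp H x \<in> S)" using bd[OF x] True by blast
      ultimately show ?thesis by blast
    next
      case False
      then have "x \<in> S \<longleftrightarrow> opp H x \<in> S" using bd[OF x] by blast
      moreover have "x \<in> T - S \<longleftrightarrow> opp H x \<in> T - S"
        using False bdK[OF x] bdK[OF opp_H_darts[OF x]] opp_opp_H[of x] by metis
      ultimately show ?thesis by blast
    qed
    ultimately have "T \<union> S = {}" by (rule face_union_all)
    then show False using nsub by blast
  qed
  moreover have "finite S" using fu finite_H unfolding face_union_def by (metis finite_subset)
  ultimately have "T = S" using minimal[OF D T] by (simp add: card_seteq)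
  then have same: "x \<in> set ds \<or> opp H x \<in> set ds \<longleftrightarrow> x \<in> set es \<or> opp H x \<in> set es" if "x \<in> darts H" for x
    using bd[OF that] bdT[OF that] by blast
  have ne: "i + s \<noteq> i" "i - s \<noteq> i" "i + s \<noteq> i - s" using s by auto
  \<comment> \<open>The two cycles have the same edges, since they bound the same region, which does
    not record a direction. As no dart has both colors, \<open>es\<close> runs through them
    backwards.\<close>
  have rev: "opp H x \<in> set es" if "x \<in> set ds" for x
    using same[OF dart(1)[OF C that]] that dart(3)[OF C that] dart(3)[OF D, of x] ne by auto
  have "\<exists>cs. mono_cycle H f (i - s) cs \<and> cycles_intersect H ds cs"
    using T2[OF C] s by auto
  then obtain cs where E: "mono_cycle H f (i - s) cs" and "cycles_intersect H ds cs" by blast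
  then obtain u x where u: "u \<in> set cs" and x: "x \<in> set ds" and ux: "vertex_of H u = vertex_of H x"
    unfolding cycles_intersect_def by fastforce
  \<comment> \<open>At every vertex of \<open>ds\<close> color \<open>i + s\<close> leaves by the
    reversed entering edge, the case in which \<open>color_at_cycle\<close> also decides color
    \<open>i - s\<close>.\<close>
  have e_rev: "e (i + s) = opp H p"
    if "y \<in> set ds" "p \<in> set ds" "vertex_of H (opp H p) = vertex_of H y"
      "schnyder_at H f (vertex_of H y) e" for y p e
  proof -
    have "f (opp H p) = Some (i + s)" using dart(3)[OF D rev[OF that(2)]] .
    moreover have "opp H p \<in> vertex_of H y" using that(3) vertex_H(3) by simp
    ultimately show ?thesis using that(4) unfolding schnyder_at_def by simp
  qed
  have enter: "z \<in> S \<and> opp H z \<in> S"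
    if z: "z \<in> set cs" and y: "y \<in> set ds" and zy: "vertex_of H (opp H z) = vertex_of H y" for z y
  proof -
    obtain p where p: "p \<in> set ds" "vertex_of H (opp H p) = vertex_of H y" using mono_cycle_prev[OF C y] .
    obtain e where e: "schnyder_at H f (vertex_of H y) e" using schnyder_at_ex[OF dart(1)[OF C y]] .
    have "opp H z \<in> vertex_of H y" using zy vertex_H(3) by simp
    then have "opp H z = y \<or> opp H z = opp H p \<or> (opp H z \<in> S \<longleftrightarrow> side s S y) \<and> (opp H (opp H z) \<in> S \<longleftrightarrow> side s S y)"
      using color_at_cycle(3)[OF C y p S s e e_rev[OF y p e], of "opp H z"] dart(2,3)[OF E z]
      unfolding opp_opp_H by metis
    moreover have "opp H z \<noteq> y"
    proof
      assume "opp H z = y"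
      then have "opp H y = z" using opp_opp_H[of z] by simp
      then show False using dart(3)[OF D rev[OF y]] dart(3)[OF E z] ne by simp
    qed
    moreover have "opp H z \<noteq> opp H p"
    proof
      assume "opp H z = opp H p"
      then have "z = p" by (metis opp_opp_H)
      then show False using dart(3)[OF E z] dart(3)[OF C p(1)] ne by simp
    qed
    ultimately show ?thesis using sideS[OF y] by simp
  qed
  have leave: "u \<notin> S \<and> opp H u \<notin> S"
  proof -
    obtain p where p: "p \<in> set ds" "vertex_of H (opp H p) = vertex_of H x" using mono_cycle_prev[OF C x] .
    obtain e where e: "schnyder_at H f (vertex_of H x) e" using schnyder_at_ex[OF dart(1)[OF C x]] .
    have "u \<in> vertex_of H x" using ux vertex_H(3) by simp
    then have "u = e (i - s)" using e dart(3)[OF E u] unfolding schnyder_at_def by blast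
    then show ?thesis
      using color_at_cycle(2)[OF C x p S s e e_rev[OF x p e]] sideS[OF x] by simp
  qed
  \<comment> \<open>Starting outside at \<open>u\<close>, the cycle \<open>cs\<close> stays outside:
    it could change sides only at a vertex of \<open>ds\<close>, but it enters those from the
    inside. Yet \<open>p\<close>, its last dart before \<open>u\<close>, enters such a
    vertex.\<close>
  define Q where "Q z \<longleftrightarrow> z \<notin> S \<and> opp H z \<notin> S" for z
  obtain p where p: "p \<in> set cs" "vertex_of H (opp H p) = vertex_of H u" using mono_cycle_prev[OF E u] .
  have "Q p"
  proof (rule mono_cycle_induct[OF E u _ p(1)])
    show "Q u" using leave by (simp add: Q_def)
    fix z z' assume z: "z \<in> set cs" "z' \<in> set cs" "vertex_of H (opp H z) = vertex_of H z'" "Q z"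
    have away: "\<forall>y\<in>set ds. vertex_of H y \<noteq> vertex_of H z'"
      using enter[OF z(1)] z(3,4) unfolding Q_def by metis
    have z': "z' \<in> darts H" by (rule dart(1)[OF E z(2)])
    have "opp H z \<in> vertex_of H z'" using z(3) vertex_H(3) by simp
    then show "Q z'" using off_const[OF z' away] off[OF z' away] z(4) unfolding Q_def by blast
  qed
  then show False using enter[OF p(1) x] p(2) ux by (simp add: Q_def)
qed

end

section \<open>Three loops on the torus\<close>

lemma orbit_fixpoint: "p x = x \<Longrightarrow> orbit p x = {x}"
  by (simp add: orbit_eq_singleton_iff)

lemma face_walk_contractible:
  assumes "is_walk M (face_walk M d)"
  shows "contractible_walk M (face_walk M d)"
  unfolding contractible_walk_def
  using homotopy_step.face[of M "[]" d "[]"] assms by (auto intro: r_into_equivclp)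

locale three_loops =
  fixes B :: "'b cmap"
  assumes toroidal: "toroidal_map B" and one_vertex: "card (vertices B) = 1" and three_edges: "card (edges B) = 3"
begin

lemma comb: "comb_map B" using toroidal by (simp add: toroidal_map_def)

lemmas B = comb_mapD[OF comb]

lemma card_darts: "card (darts B) = 6"
  using card_edges[OF comb] three_edges by simp

lemma vertex_of_eq: assumes "d \<in> darts B" shows "vertex_of B d = darts B"
proof
  show "vertex_of B d \<subseteq> darts B" by (rule vertex_of_props(2)[OF B(1,2) assms])
  obtain v where v: "vertices B = {v}" using one_vertex by (auto simp: card_1_singleton_iff)
  show "darts B \<subseteq> vertex_of B d"
  proof
    fix x assume "x \<in> darts B"
    then have "vertex_of B x \<in> {v}" "vertex_of B d \<in> {v}"
      using assms unfolding v[symmetric] vertices_def by blast+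
    then have "vertex_of B x = vertex_of B d" by simp
    then show "x \<in> vertex_of B d" using vertex_of_props(1)[OF B(1,2)] by metis
  qed
qed

lemma orbit_eq: "d \<in> darts B \<Longrightarrow> orbit (rot B) d = darts B"
  using vertex_of_eq by (simp add: vertex_of_def)

lemma self: "d \<in> orbit (rot B) d" by (rule permutes_self_in_orbit[OF B(1,2)])

lemma rot_6: assumes "d \<in> darts B" shows "(rot B ^^ (k + 6)) d = (rot B ^^ k) d"
proof -
  have "(rot B ^^ 6) d = d" using funpow_card_orbit(1)[OF self, of d] orbit_eq[OF assms] card_darts by simp
  then show ?thesis by (simp only: funpow_add o_apply)
qed

lemma rot_eq_iff:
  assumes "d \<in> darts B" "k < 6" "l < 6"
  shows "(rot B ^^ k) d = (rot B ^^ l) d \<longleftrightarrow> k = l"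
  using funpow_orbit_inj[OF self, of k d l] orbit_eq[OF assms(1)] card_darts assms(2,3) by auto

lemma rot_index:
  assumes "d \<in> darts B" "e \<in> darts B"
  obtains k where "k < 6" "e = (rot B ^^ k) d"
proof -
  obtain k where "k < card (orbit (rot B) d)" "e = (rot B ^^ k) d"
    using orbit_index[OF self, of e d] assms orbit_eq by auto
  then show thesis using that orbit_eq[OF assms(1)] card_darts by simp
qed

lemma rot_pow_dart: "d \<in> darts B \<Longrightarrow> (rot B ^^ k) d \<in> darts B"
  by (induction k) (auto simp: B(8))

text \<open>A face of degree 1 would be a disk bounded by a loop.\<close>

lemma no_face_1: assumes d: "d \<in> darts B" shows "face_next B d \<noteq> d"
proof
  assume "face_next B d = d"
  then have "face_walk B d = [d]" by (simp add: face_walk_def orbit_fixpoint)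
  moreover have "is_walk B [d]" using d by (simp add: is_walk_def)
  ultimately have "contractible_walk B [d]" using face_walk_contractible[of B d] by simp
  moreover have "vertex_of B d = vertex_of B (opp B d)" using vertex_of_eq d B(7) by simp
  ultimately show False using toroidal d unfolding toroidal_map_def by blast
qed

text \<open>A face of degree 2 would be a disk between two loops, which makes them parallel.\<close>

lemma no_face_2: assumes d: "d \<in> darts B" shows "face_next B (face_next B d) \<noteq> d"
proof
  let ?e = "face_next B d"
  assume 2: "face_next B ?e = d"
  have e: "?e \<in> darts B" using d B(7,8) by (simp add: face_next_def)
  have ne: "?e \<noteq> d" by (rule no_face_1[OF d])
  have "(face_next B ^^ 2) d = d" using 2 by (simp add: numeral_2_eq_2)
  then have "orbit (face_next B) d = {(face_next B ^^ m) d |m. m < 2}" by (rule orbit_altdef_bounded) simp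
  also have "\<dots> = {d, ?e}"
  proof (intro equalityI subsetI)
    fix x assume "x \<in> {(face_next B ^^ m) d |m. m < 2}"
    then obtain m where "m < 2" "x = (face_next B ^^ m) d" by blast
    then show "x \<in> {d, ?e}" by (cases m) auto
  next
    fix x assume "x \<in> {d, ?e}"
    then have "x = (face_next B ^^ 0) d \<or> x = (face_next B ^^ 1) d" by auto
    then show "x \<in> {(face_next B ^^ m) d |m. m < 2}" by (metis (mono_tags, lifting) mem_Collect_eq one_less_numeral_iff semiring_norm(76) zero_less_numeral)
  qed
  finally have "card (orbit (face_next B) d) = 2" using ne by simp
  then have fw: "face_walk B d = [d, ?e]" by (simp add: face_walk_def numeral_2_eq_2)
  have "is_walk B [d, ?e]" using d e B(7) vertex_of_eq by (simp add: is_walk_def)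
  then have "contractible_walk B [d, opp B (opp B ?e)]" using face_walk_contractible[of B d] fw B(5) by simp
  \<comment> \<open>Parallelism concerns two different edges. If both sides of the face came from
    one edge, \<open>rot B\<close> would fix a dart.\<close>
  moreover have "opp B ?e \<noteq> d"
  proof
    assume "opp B ?e = d"
    then have "opp B d = ?e" using B(5) by metis
    then have "(rot B ^^ 1) (opp B d) = (rot B ^^ 0) (opp B d)" by (simp add: face_next_def)
    then show False using rot_eq_iff[OF B(7)[OF d], of 1 0] by simp
  qed
  moreover have "opp B ?e \<noteq> opp B d" using ne B(5) by metis
  moreover have "vertex_of B x = darts B" if "x \<in> {d, ?e, opp B d, opp B ?e, opp B (opp B ?e)}" for x
    using that d e B(7) vertex_of_eq by auto
  ultimately show False using toroidal d e B(7) unfolding toroidal_map_def by (metis insertCI)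
qed

text \<open>Number the six darts counterclockwise. A loop joining neighbors cuts off a face of
  degree 1. A loop joining 0 and 2 forces, by exclusion, loops joining 1 with 4 and 3 with 5, and
  then 0 and 3 form a face of degree 2. Only opposite darts remain.\<close>

lemma opp_eq: assumes d: "d \<in> darts B" shows "opp B d = (rot B ^^ 3) d"
proof -
  have cases: "opp B x = (rot B ^^ 2) x \<or> opp B x = (rot B ^^ 3) x \<or> opp B x = (rot B ^^ 4) x"
    if x: "x \<in> darts B" for x
  proof -
    obtain k where k: "k < 6" "opp B x = (rot B ^^ k) x" using rot_index[OF x B(7)[OF x]] .
    have "k \<noteq> 0" using k B(4)[OF x] by (cases k) auto
    moreover have "k \<noteq> 1"
    proof
      assume "k = 1"
      then have "opp B x = rot B x" using k by simp
      then have "face_next B (opp B x) = opp B x" unfolding face_next_def B(5) by simp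
      then show False using no_face_1[OF B(7)[OF x]] by simp
    qed
    moreover have "k \<noteq> 5"
    proof
      assume "k = 5"
      then have "face_next B x = (rot B ^^ (0 + 6)) x" using k by (simp add: face_next_def numeral_eq_Suc)
      then show False using rot_6[OF x, of 0] no_face_1[OF x] by simp
    qed
    ultimately have "k = 2 \<or> k = 3 \<or> k = 4" using k by linarith
    then show ?thesis using k by auto
  qed
  have no2: "opp B x \<noteq> (rot B ^^ 2) x" if x: "x \<in> darts B" for x
  proof
    assume 2: "opp B x = (rot B ^^ 2) x"
    let ?x = "\<lambda>k. (rot B ^^ k) x"
    have xd: "?x k \<in> darts B" for k by (rule rot_pow_dart[OF x])
    have add: "(rot B ^^ k) (?x l) = ?x (l + k)" for k l by (simp add: funpow_add add.commute[of l])
    have x6: "?x 6 = ?x 0" "?x 7 = ?x 1" "?x 8 = ?x 2"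
      using rot_6[OF x, of 0] rot_6[OF x, of 1] rot_6[OF x, of 2] by (simp_all del: funpow.simps)
    note c = cases[OF xd, unfolded add]
    have o0: "opp B (?x 0) = ?x 2" "opp B (?x 2) = ?x 0" using 2 B(5)[of x] by auto
    have inj: "?x k = ?x l \<longleftrightarrow> k = l" if "k < 6" "l < 6" for k l using rot_eq_iff[OF x that] .
    have oinj: "opp B y = opp B z \<longleftrightarrow> y = z" for y z using B(5) by metis
    have c4: "opp B (?x 4) = ?x 0 \<or> opp B (?x 4) = ?x 1 \<or> opp B (?x 4) = ?x 2"
      using c[of 4] x6 by simp
    then have "opp B (?x 4) = ?x 1"
    proof (elim disjE)
      assume "opp B (?x 4) = ?x 0"
      then have "opp B (?x 4) = opp B (?x 2)" using o0 by simp
      then show ?thesis using oinj inj[of 4 2] by simp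
    next
      assume "opp B (?x 4) = ?x 2"
      then have "opp B (?x 4) = opp B (?x 0)" using o0 by simp
      then show ?thesis using oinj inj[of 4 0] by (simp del: funpow.simps)
    qed
    moreover have "opp B (?x 3) = ?x 5"
    proof -
      have "opp B (?x 3) = ?x 5 \<or> opp B (?x 3) = ?x 0 \<or> opp B (?x 3) = ?x 1"
        using c[of 3] x6 by simp
      moreover have "opp B (?x 3) \<noteq> ?x 0"
        using o0(2) oinj[of "?x 3" "?x 2"] inj[of 3 2] by auto
      moreover have "opp B (?x 3) \<noteq> ?x 1"
        using \<open>opp B (?x 4) = ?x 1\<close> oinj[of "?x 3" "?x 4"] inj[of 3 4] by auto
      ultimately show ?thesis by blast
    qed
    moreover have "rot B (?x k) = ?x (Suc k)" for k by simp
    ultimately have "face_next B (face_next B (?x 0)) = ?x 6"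
      unfolding face_next_def o0 by (metis Suc_numeral semiring_norm(2,5,8))
    then show False using no_face_2[OF x] x6(1) by simp
  qed
  have "opp B d \<noteq> (rot B ^^ 4) d"
  proof
    assume 4: "opp B d = (rot B ^^ 4) d"
    have "(rot B ^^ 2) (opp B d) = (rot B ^^ (0 + 6)) d" unfolding 4 by (simp add: numeral_eq_Suc)
    then have "(rot B ^^ 2) (opp B d) = opp B (opp B d)" using rot_6[OF d, of 0] B(5) by simp
    then show False using no2[OF B(7)[OF d]] by simp
  qed
  then show ?thesis using cases[OF d] no2[OF d] by blast
qed

lemma face_next_eq: "d \<in> darts B \<Longrightarrow> face_next B d = (rot B ^^ 4) d"
  by (simp add: face_next_def opp_eq numeral_eq_Suc)

lemma card_faces: "card (faces B) = 2"
  using toroidal one_vertex three_edges by (simp add: toroidal_map_def euler_char_def)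

text \<open>A step along a face is four sixths of a turn, so the faces are triangles formed by every
  second dart around the vertex.\<close>

lemma card_orbit_face_next:
  assumes d: "d \<in> darts B" shows "orbit (face_next B) d \<subseteq> {d, (rot B ^^ 4) d, (rot B ^^ 2) d}"
proof
  have add: "(rot B ^^ k) ((rot B ^^ l) d) = (rot B ^^ (l + k)) d" for k l by (simp add: funpow_add add.commute[of l])
  have "face_next B ((rot B ^^ l) d) = (rot B ^^ (l + 4)) d" for l
    using face_next_eq[OF rot_pow_dart[OF d]] add by simp
  note fn = this[of 0] this[of 4] this[of 2]
  have x6: "(rot B ^^ 6) d = d" "(rot B ^^ 8) d = (rot B ^^ 2) d"
    using rot_6[OF d, of 0] rot_6[OF d, of 2] by (simp_all del: funpow.simps add: funpow_0)
  fix x assume "x \<in> orbit (face_next B) d"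
  then show "x \<in> {d, (rot B ^^ 4) d, (rot B ^^ 2) d}"
    by induction (use fn x6 in auto)
qed

end

section \<open>Faces of \<open>G\<^sup>+\<close>\<close>

lemma G_plus_simps [simp]:
  "darts (G_plus G c B b) = darts (suspension G c) <+> darts (suspension B b)"
  "rot (G_plus G c B b) (Inl x) = Inl (rot (suspension G c) x)"
  "rot (G_plus G c B b) (Inr y) = Inr (rot (suspension B b) y)"
  "opp (G_plus G c B b) (Inl (Inl d)) = Inl (Inl (opp G d))"
  "opp (G_plus G c B b) (Inl (Inr i)) = Inr (Inr i)"
  "opp (G_plus G c B b) (Inr (Inl e)) = Inr (Inl (opp B e))"
  "opp (G_plus G c B b) (Inr (Inr i)) = Inl (Inr i)"
  by (simp_all add: G_plus_def)

locale glued = G: suspended G c + B: suspended B b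
  for G :: "'a cmap" and c :: "3 \<Rightarrow> 'a" and B :: "'b cmap" and b :: "3 \<Rightarrow> 'b" +
  assumes comb_P: "comb_map (G_plus G c B b)"
begin

abbreviation "P \<equiv> G_plus G c B b"

lemmas P = comb_mapD[OF comb_P]
lemmas vertex_P = vertex_of_props[OF P(1,2)]

lemma self_in_orbit_P: "x \<in> orbit (rot P) x" by (rule permutes_self_in_orbit[OF P(1,2)])

lemma vertex_P_Inl: "vertex_of P (Inl x) = Inl ` vertex_of G.H x"
  unfolding vertex_of_def by (rule orbit_map[OF G.self_in_orbit_H]) simp

lemma vertex_P_Inr: "vertex_of P (Inr x) = Inr ` vertex_of B.H x"
  unfolding vertex_of_def by (rule orbit_map[OF B.self_in_orbit_H]) simp

lemma vertices_P: "vertices P = (`) Inl ` vertices G.H \<union> (`) Inr ` vertices B.H"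
  unfolding vertices_def G_plus_simps Plus_def image_Un image_image vertex_P_Inl vertex_P_Inr by simp

lemma card_vertices_P: "card (vertices P) = card (vertices G) + card (vertices B)"
proof -
  have fin: "finite (vertices G.H)" "finite (vertices B.H)"
    unfolding vertices_def using G.finite_H B.finite_H by simp_all
  let ?l = "Inl :: 'a + 3 \<Rightarrow> ('a + 3) + ('b + 3)" and ?r = "Inr :: 'b + 3 \<Rightarrow> ('a + 3) + ('b + 3)"
  have "card (vertices P) = card ((`) ?l ` vertices G.H) + card ((`) ?r ` vertices B.H)"
    unfolding vertices_P
  proof (rule card_Un_disjoint)
    have "v \<noteq> {}" if "v \<in> vertices G.H" for v
      using that G.vertex_H(1) by (auto simp: vertices_def simp del: suspension_simps)
    then show "(`) ?l ` vertices G.H \<inter> (`) ?r ` vertices B.H = {}" by fastforce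
  qed (use fin in auto)
  also have "card ((`) ?l ` vertices G.H) = card (vertices G)"
    using G.card_vertices_H by (subst card_image) (auto intro!: inj_onI simp: inj_image_eq_iff)
  also have "card ((`) ?r ` vertices B.H) = card (vertices B)"
    using B.card_vertices_H by (subst card_image) (auto intro!: inj_onI simp: inj_image_eq_iff)
  finally show ?thesis .
qed

lemma card_darts_suspension:
  "finite (darts M) \<Longrightarrow> card (darts (suspension M k)) = card (darts M) + 3"
  unfolding suspension_simps by (subst card_Un_disjoint) (auto simp: card_image)

lemma card_edges_P: "card (edges P) = card (edges G) + card (edges B) + 3"
proof -
  have "card (darts P) = card (darts G) + 3 + (card (darts B) + 3)"
    unfolding G_plus_simps(1)
    by (subst card_Plus) (simp_all only: G.finite_H B.finite_H card_darts_suspension[OF G.M(1)] card_darts_suspension[OF B.M(1)])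
  then show ?thesis using card_edges[OF comb_P] card_edges[OF G.comb] card_edges[OF B.comb] by simp
qed

abbreviation "face \<equiv> orbit (face_next P)"

lemma face_step: "face (face_next P x) = face x"
  by (rule orbit_partition[OF P(1,6) orbit.base])

lemma face_next_P_out: "face_next P (Inl (Inr i)) = Inr (Inl (b i))"
  "face_next P (Inr (Inr i)) = Inl (Inl (c i))"
  by (simp_all add: face_next_def)

lemma face_next_P_G:
  "face_next G d = c i \<Longrightarrow> face_next P (Inl (Inl d)) = Inl (Inr i)"
  "face_next G d \<notin> range c \<Longrightarrow> face_next P (Inl (Inl d)) = Inl (Inl (face_next G d))"
  using rot_suspension_Inl[OF G.inj_c, of G "opp G d"] by (auto simp: face_next_def)

lemma face_next_P_B:
  "face_next B d = b i \<Longrightarrow> face_next P (Inr (Inl d)) = Inr (Inr i)"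
  "face_next B d \<notin> range b \<Longrightarrow> face_next P (Inr (Inl d)) = Inr (Inl (face_next B d))"
  using rot_suspension_Inl[OF B.inj_c, of B "opp B d"] by (auto simp: face_next_def)

lemma face_G_step:
  "face_next G d = c i \<Longrightarrow> face (Inl (Inl d)) = face (Inl (Inr i))"
  "face_next G d \<notin> range c \<Longrightarrow> face (Inl (Inl d)) = face (Inl (Inl (face_next G d)))"
  using face_next_P_G face_step by metis+

lemma face_B_step:
  "face_next B d = b i \<Longrightarrow> face (Inr (Inl d)) = face (Inr (Inr i))"
  "face_next B d \<notin> range b \<Longrightarrow> face (Inr (Inl d)) = face (Inr (Inl (face_next B d)))"
  using face_next_P_B face_step by metis+

text \<open>A face of \<open>P\<close> follows the face of \<open>G\<close> until the first corner
  carrying a new edge deflects it. For \<open>y\<close> such a corner the second alternative fails,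
  so a half-edge is met.\<close>

lemma face_G_reach:
  assumes "y \<in> orbit (face_next G) d"
  shows "(\<exists>j. face (Inl (Inl d)) = face (Inl (Inr j))) \<or>
    face (Inl (Inl d)) = face (Inl (Inl y)) \<and> y \<notin> range c"
  using assms
proof induction
  case base
  then show ?case using face_G_step[of d] by blast
next
  case (step y)
  then show ?case using face_G_step[of y] by (metis rangeE)
qed

text \<open>As for \<open>G\<close>, but it also records that the corner met belongs to the same
  face of \<open>B\<close>, which later places all corners on one face.\<close>

lemma face_B_reach:
  assumes "y \<in> orbit (face_next B) d"
  shows "(\<exists>j. face (Inr (Inl d)) = face (Inr (Inr j)) \<and> b j \<in> orbit (face_next B) d) \<or>
    face (Inr (Inl d)) = face (Inr (Inl y)) \<and> y \<notin> range b"
  using assms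
proof induction
  case base
  show ?case using face_B_step[of d] orbit.base[of "face_next B" d] by (metis rangeE)
next
  case (step y)
  then show ?case using face_B_step[of y] orbit.step[OF step(1)] by (metis rangeE)
qed

lemma self_in_face_G: "d \<in> orbit (face_next G) d" by (rule permutes_self_in_orbit[OF G.M(1,6)])
lemma self_in_face_B: "d \<in> orbit (face_next B) d" by (rule permutes_self_in_orbit[OF B.M(1,6)])

lemma face_of_c: obtains j where "face (Inl (Inl (c i))) = face (Inl (Inr j))"
  using face_G_reach[OF self_in_face_G[of "c i"]] by blast

lemma face_of_b: obtains j where "face (Inr (Inr i)) = face (Inl (Inr j))"
  using face_of_c[of i] face_step[of "Inr (Inr i)"] face_next_P_out(2)[of i] by metis

text \<open>A face of \<open>P\<close> without new edges is a whole face of \<open>G\<close> or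
  \<open>B\<close> containing none of the chosen corners. Any other face runs along some new edge
  towards the new vertex: having come back to \<open>G\<close> by a new edge, it leaves again by
  one.\<close>

lemma faces_P_subset:
  "faces P \<subseteq> (\<lambda>F. (Inl \<circ> Inl) ` F) ` (faces G - {orbit (face_next G) (c 0)})
     \<union> (\<lambda>F. (Inr \<circ> Inl) ` F) ` (faces B - {orbit (face_next B) (b 0)})
     \<union> range (\<lambda>i. face (Inl (Inr i)))" (is "_ \<subseteq> ?X \<union> ?Y \<union> ?Z")
proof
  fix F assume "F \<in> faces P"
  then obtain x where x: "x \<in> darts P" "F = face x" unfolding faces_def by blast
  consider d where "x = Inl (Inl d)" "d \<in> darts G" | i where "x = Inl (Inr i)"
    | d where "x = Inr (Inl d)" "d \<in> darts B" | i where "x = Inr (Inr i)"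
    using x(1) by auto
  then show "F \<in> ?X \<union> ?Y \<union> ?Z"
  proof cases
    case (1 d)
    show ?thesis
    proof (cases "\<exists>j. face (Inl (Inl d)) = face (Inl (Inr j))")
      case True
      then show ?thesis using x 1 by blast
    next
      case False
      have no: "y \<notin> range c" if "y \<in> orbit (face_next G) d" for y
        using face_G_reach[OF that] False by blast
      have "face ((Inl \<circ> Inl) d) = (Inl \<circ> Inl) ` orbit (face_next G) d"
        by (rule orbit_map[OF self_in_face_G]) (use no face_next_P_G(2) in \<open>auto intro: orbit.step\<close>)
      moreover have "orbit (face_next G) d \<noteq> orbit (face_next G) (c 0)"
        using no[of "c 0"] self_in_face_G[of "c 0"] by auto
      moreover have "orbit (face_next G) d \<in> faces G" using 1 by (simp add: faces_def)
      ultimately have "F \<in> ?X" using x(2) 1 by auto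
      then show ?thesis by blast
    qed
  next
    case (3 d)
    show ?thesis
    proof (cases "\<exists>j. face (Inr (Inl d)) = face (Inr (Inr j))")
      case True
      then obtain j where "face x = face (Inr (Inr j))" using 3 by blast
      moreover obtain k where "face (Inr (Inr j)) = face (Inl (Inr k))" using face_of_b .
      ultimately show ?thesis using x(2) by simp
    next
      case False
      have no: "y \<notin> range b" if "y \<in> orbit (face_next B) d" for y
        using face_B_reach[OF that] False by blast
      have "face ((Inr \<circ> Inl) d) = (Inr \<circ> Inl) ` orbit (face_next B) d"
        by (rule orbit_map[OF self_in_face_B]) (use no face_next_P_B(2) in \<open>auto intro: orbit.step\<close>)
      moreover have "orbit (face_next B) d \<noteq> orbit (face_next B) (b 0)"
        using no[of "b 0"] self_in_face_B[of "b 0"] by auto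
      moreover have "orbit (face_next B) d \<in> faces B" using 3 by (simp add: faces_def)
      ultimately have "F \<in> ?Y" using x(2) 3 by auto
      then show ?thesis by blast
    qed
  next
    case (4 i)
    moreover obtain k where "face (Inr (Inr i)) = face (Inl (Inr k))" using face_of_b .
    ultimately show ?thesis using x(2) by simp
  qed (use x in blast)
qed

end

section \<open>Position of the new edges among the loops\<close>

locale torus_extension = glued + B: three_loops B +
  assumes planar: "planar_map G" and outer: "cyclic_order (face_next G) (c 0) (c 1) (c 2)"
    and toroidal_P: "toroidal_map P"
begin

lemma card_faces_P: "card (faces P) = card (faces G) + 3"
  using card_edges_P card_vertices_P planar toroidal_P B.three_edges B.one_vertex
  by (simp add: planar_map_def toroidal_map_def euler_char_def)

text \<open>Euler's formula asks for \<open>card (faces G) + 3\<close> faces. Old faces account for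
  at most \<open>card (faces G) - 1\<close> from \<open>G\<close> and one from \<open>B\<close>, so
  the three darts towards the new vertex must lie on three distinct faces.\<close>

lemma inj_new_faces: "inj (\<lambda>i. face (Inl (Inr i)))"
proof -
  have fin: "finite (faces G)" "finite (faces B)" unfolding faces_def using G.M(1) B.M(1) by simp_all
  let ?X = "faces G - {orbit (face_next G) (c 0)}" and ?Y = "faces B - {orbit (face_next B) (b 0)}"
  let ?Z = "range (\<lambda>i. face (Inl (Inr i)))"
  have "card (faces P) \<le> card ((\<lambda>F. (Inl \<circ> Inl) ` F) ` ?X \<union> (\<lambda>F. (Inr \<circ> Inl) ` F) ` ?Y \<union> ?Z)"
    by (rule card_mono[OF _ faces_P_subset]) (use fin in auto)
  also have "\<dots> \<le> card ?X + card ?Y + card ?Z"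
  proof -
    have "card (U \<union> V \<union> W) \<le> card U + card V + card W" for U V W :: "'c set"
      using card_Un_le[of "U \<union> V" W] card_Un_le[of U V] by linarith
    then show ?thesis
      by (rule order_trans) (intro add_mono card_image_le order_refl finite_Diff fin)
  qed
  also have "card ?X = card (faces G) - 1"
    using fin by (subst card_Diff_subset) (auto simp: faces_def)
  also have "card ?Y = 1"
    using fin B.card_faces by (subst card_Diff_subset) (auto simp: faces_def)
  finally have "card (faces G) + 3 \<le> card (faces G) - 1 + 1 + card ?Z" using card_faces_P by simp
  moreover have "0 < card (faces G)" using fin G.comb by (auto simp: card_gt_0_iff faces_def comb_map_def)
  ultimately have "3 \<le> card ?Z" by linarith
  moreover have "card ?Z \<le> card (UNIV :: 3 set)" by (rule card_image_le) simp
  ultimately have "card ?Z = card (UNIV :: 3 set)" by simp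
  then show ?thesis by (intro eq_card_imp_inj_on) simp_all
qed

lemma outer_cyclic: "cyclic_order (face_next G) (c j) (c (j + 1)) (c (j - 1))"
proof -
  note 1 = cyclic_order_rotate[OF self_in_face_G outer]
  note 2 = cyclic_order_rotate[OF self_in_face_G 1]
  show ?thesis using color_cases[of j] outer 1 2 by (auto simp: color_consts)
qed

text \<open>Here the counterclockwise order of the roots enters: after \<open>c j\<close> the outer
  face meets \<open>c (j + 1)\<close> before the third corner, so a face coming in by edge
  \<open>j\<close> goes out by edge \<open>j + 1\<close>.\<close>

lemma outer_face_next: "face (Inl (Inl (c j))) = face (Inl (Inr (j + 1)))"
proof -
  let ?f = "face_next G" and ?n = "card (orbit (face_next G) (c j))"
  obtain k l where kl: "0 < k" "k < l" "l < ?n" "c (j + 1) = (?f ^^ k) (c j)" "c (j - 1) = (?f ^^ l) (c j)"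
    using outer_cyclic[of j] unfolding cyclic_order_def by blast
  have all: "i = j \<or> i = j + 1 \<or> i = j - 1" for i
    using color_cases[of i] color_cases[of j] by (auto simp: color_consts)
  have no: "(?f ^^ m) (c j) \<notin> range c" if m: "0 < m" "m < k" for m
  proof
    assume "(?f ^^ m) (c j) \<in> range c"
    then obtain i where i: "(?f ^^ m) (c j) = c i" by blast
    have "(?f ^^ m) (c j) = (?f ^^ 0) (c j) \<or> (?f ^^ m) (c j) = (?f ^^ k) (c j) \<or> (?f ^^ m) (c j) = (?f ^^ l) (c j)"
      using all[of i] i kl(4,5) by auto
    then show False
    proof (elim disjE)
      assume "(?f ^^ m) (c j) = (?f ^^ 0) (c j)"
      from funpow_orbit_inj[OF self_in_face_G this] show False using m kl(1-3) by simp
    next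
      assume "(?f ^^ m) (c j) = (?f ^^ k) (c j)"
      from funpow_orbit_inj[OF self_in_face_G this] show False using m kl(1-3) by simp
    next
      assume "(?f ^^ m) (c j) = (?f ^^ l) (c j)"
      from funpow_orbit_inj[OF self_in_face_G this] show False using m kl(1-3) by simp
    qed
  qed
  have "m < k \<Longrightarrow> face (Inl (Inl (c j))) = face (Inl (Inl ((?f ^^ m) (c j))))" for m
  proof (induction m)
    case (Suc m)
    then show ?case using face_G_step(2)[of "(?f ^^ m) (c j)"] no[of "Suc m"] by simp
  qed simp
  from this[of "k - 1"] have "face (Inl (Inl (c j))) = face (Inl (Inl ((?f ^^ (k - 1)) (c j))))" using kl(1) by simp
  moreover have "?f ((?f ^^ (k - 1)) (c j)) = c (j + 1)" using kl(1,4) by (cases k) auto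
  ultimately show ?thesis using face_G_step(1)[of "(?f ^^ (k - 1)) (c j)" "j + 1"] by simp
qed

text \<open>The face goes to the new vertex by edge \<open>i\<close>, back to \<open>G\<close> by
  edge \<open>j\<close>, and then out by edge \<open>j + 1\<close>. It contains only one dart
  towards the new vertex, so \<open>j + 1\<close> is \<open>i\<close>.\<close>

lemma b_step:
  assumes "face (Inl (Inr i)) = face (Inr (Inr j))"
  shows "j = i - 1"
proof -
  have "face (Inr (Inr j)) = face (Inl (Inr (j + 1)))"
    using face_step[of "Inr (Inr j)"] outer_face_next[of j] by (simp add: face_next_P_out)
  then have "i = j + 1" using injD[OF inj_new_faces, of i "j + 1"] assms by simp
  then show ?thesis by simp
qed

lemma face_Inl_Inr: "face (Inl (Inr i)) = face (Inr (Inl (b i)))"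
  using face_step[of "Inl (Inr i)"] by (simp add: face_next_P_out)

text \<open>By \<open>b_step\<close> the face of \<open>B\<close> at \<open>b i\<close> contains
  \<open>b (i - 1)\<close>, hence all three corners. It is a triangle, so each face step goes
  straight from \<open>b i\<close> to \<open>b (i - 1)\<close>; as this step is \<open>rot B\<close>
  iterated four times, two rotations lead from \<open>b i\<close> to
  \<open>b (i + 1)\<close>.\<close>

lemma rot_b: "(rot B ^^ 2) (b i) = b (i + 1)"
proof -
  have mem: "b (i - 1) \<in> orbit (face_next B) (b i)" for i
    using face_B_reach[OF self_in_face_B[of "b i"]] face_Inl_Inr[of i] b_step[of i] by auto
  have mem2: "b (i + 1) \<in> orbit (face_next B) (b i)" for i
    using orbit_trans[OF mem[of "i - 1"] mem[of i]] by simp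
  have fn: "face_next B (b i) = b (i - 1)" for i
  proof -
    have ne: "b (i - 1) \<noteq> b i" "b (i + 1) \<noteq> b i" "b (i + 1) \<noteq> b (i - 1)"
      using B.inj_c by (auto simp: inj_eq)
    have "b (i - 1) \<in> {b i, (rot B ^^ 4) (b i), (rot B ^^ 2) (b i)}"
      "b (i + 1) \<in> {b i, (rot B ^^ 4) (b i), (rot B ^^ 2) (b i)}"
      using B.card_orbit_face_next[OF B.c_dart[of i]] mem[of i] mem2[of i] by blast+
    then have "(rot B ^^ 4) (b i) = b (i - 1) \<or> (rot B ^^ 4) (b i) = b (i + 1)" using ne by auto
    then have "face_next B (b i) = b (i - 1) \<or> face_next B (b i) = b (i + 1)"
      using B.face_next_eq[OF B.c_dart] by simp
    then obtain j where j: "face_next B (b i) = b j" by blast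
    have "face (Inl (Inr i)) = face (Inr (Inr j))" using face_Inl_Inr face_B_step(1)[OF j] by simp
    then show ?thesis using b_step j by simp
  qed
  have "b i = (rot B ^^ 4) (b (i + 1))" using fn[of "i + 1"] B.face_next_eq[OF B.c_dart] by simp
  then have "(rot B ^^ 2) (b i) = (rot B ^^ (0 + 6)) (b (i + 1))" by (simp add: numeral_eq_Suc)
  then show ?thesis using B.rot_6[OF B.c_dart, of 0 "i + 1"] by simp
qed

end

section \<open>The new vertex\<close>

definition ccw :: "nat \<Rightarrow> nat \<Rightarrow> nat \<Rightarrow> bool" where
  "ccw i j k \<longleftrightarrow> i < j \<and> j < k \<or> j < k \<and> k < i \<or> k < i \<and> i < j"

text \<open>Turns cyclic order around a vertex into inequalities between positions, so that the case
  analyses at the new vertex become arithmetic.\<close>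

lemma cyclic_order_enum:
  assumes q: "\<And>n. q (p n) = p (Suc n)" and period: "\<And>n. p (n + N) = p n"
    and inj: "inj_on p {..<N}" and ijk: "i < N" "j < N" "k < N"
  shows "cyclic_order q (p i) (p j) (p k) \<longleftrightarrow> ccw i j k"
proof -
  have N: "0 < N" using ijk by simp
  have pow: "(q ^^ m) (p n) = p (n + m)" for m n by (induction m) (simp_all add: q)
  have mod: "p (n mod N) = p n" for n
  proof -
    have "p (m + N * t) = p m" for m t
    proof (induction t)
      case (Suc t)
      then show ?case using period[of "m + N * t"] by (simp add: ac_simps)
    qed simp
    from this[of "n mod N" "n div N"] show ?thesis by simp
  qed
  have eq: "p m = p n \<longleftrightarrow> m mod N = n mod N" for m n
    using inj_onD[OF inj, of "m mod N" "n mod N"] mod N by (metis lessThan_iff mod_less_divisor)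
  have "orbit q (p i) = {(q ^^ m) (p i) |m. m < N}"
    by (rule orbit_altdef_bounded) (use N pow period in simp_all)
  also have "\<dots> = (\<lambda>m. p (i + m)) ` {..<N}" by (auto simp: pow)
  finally have orb: "orbit q (p i) = (\<lambda>m. p (i + m)) ` {..<N}" .
  have wrap: "(i + l) mod N = (if i + l < N then i + l else i + l - N)" if "l < N" for l
    using that ijk(1) by (simp add: mod_if)
  have "inj_on (\<lambda>m. p (i + m)) {..<N}"
    by (rule inj_onI) (use wrap ijk(1) in \<open>auto simp: eq split: if_splits\<close>)
  then have "card (orbit q (p i)) = N" unfolding orb by (simp add: card_image)
  then have "cyclic_order q (p i) (p j) (p k) \<longleftrightarrow>
      (\<exists>m n. 0 < m \<and> m < n \<and> n < N \<and> j = (i + m) mod N \<and> k = (i + n) mod N)"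
    unfolding cyclic_order_def pow eq using ijk by simp
  also have "\<dots> \<longleftrightarrow> ccw i j k"
  proof
    assume "\<exists>m n. 0 < m \<and> m < n \<and> n < N \<and> j = (i + m) mod N \<and> k = (i + n) mod N"
    then obtain m n where mn: "0 < m" "m < n" "n < N" "j = (i + m) mod N" "k = (i + n) mod N" by blast
    then show "ccw i j k"
      using wrap[of m] wrap[of n] ijk(1) unfolding ccw_def by (auto split: if_splits)
  next
    assume c: "ccw i j k"
    define d where "d l = (if i \<le> l then l - i else l + N - i)" for l
    have "(i + d l) mod N = l" if "l < N" for l using that ijk(1) by (simp add: d_def)
    moreover have "0 < d j" "d j < d k" "d k < N" using c ijk by (auto simp: ccw_def d_def)
    ultimately show "\<exists>m n. 0 < m \<and> m < n \<and> n < N \<and> j = (i + m) mod N \<and> k = (i + n) mod N"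
      using ijk by metis
  qed
  finally show ?thesis .
qed

definition sector :: "nat \<Rightarrow> nat \<Rightarrow> nat \<Rightarrow> bool" where
  "sector i j k \<longleftrightarrow> j = i \<or> j = k \<or> ccw i j k"

text \<open>The darts at the new vertex are numbered from 0 to 8 counterclockwise, the edges from \<open>G\<close> being
  0, 3, 6 and the loops joining 1 with 5, 2 with 7, and 4 with 8; \<open>n0, n1, n2\<close> are the
  outgoing darts of colors 0, 1, 2.\<close>

definition loop_opp :: "nat \<Rightarrow> nat" where
  "loop_opp m = (if m = 1 then 5 else if m = 5 then 1 else if m = 2 then 7 else if m = 7 then 2
     else if m = 4 then 8 else 4)"

text \<open>A finite check: every loop needs one of the three outgoing darts, and a loop must come
  back in the sector of its color. Up to rotation of the colors, the outgoing darts are those just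
  after the new edges or those just before them; reversing all loops exchanges the two
  patterns.\<close>

lemma loop_orientations:
  assumes "n0 = 1 \<or> n1 = 1 \<or> n2 = 1 \<or> n0 = 5 \<or> n1 = 5 \<or> n2 = 5"
    and "n0 = 2 \<or> n1 = 2 \<or> n2 = 2 \<or> n0 = 7 \<or> n1 = 7 \<or> n2 = 7"
    and "n0 = 4 \<or> n1 = 4 \<or> n2 = 4 \<or> n0 = 8 \<or> n1 = 8 \<or> n2 = 8"
    and "ccw n0 n1 n2"
    and "sector n1 (loop_opp n0) n2" "sector n2 (loop_opp n1) n0" "sector n0 (loop_opp n2) n1"
  shows "(n0, n1, n2) \<in> {(1, 4, 7), (4, 7, 1), (7, 1, 4), (2, 5, 8), (5, 8, 2), (8, 2, 5)}"
  using assms(1-3)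
  by (elim disjE) (use assms(4-7) in \<open>simp_all add: ccw_def sector_def loop_opp_def\<close>)


section \<open>Numbering of the darts around the new vertex\<close>

context torus_extension begin

definition lp :: "nat \<Rightarrow> 'b" where "lp k = (rot B ^^ k) (b 0)"

lemma lp_dart [simp]: "lp k \<in> darts B"
  unfolding lp_def by (rule B.rot_pow_dart[OF B.c_dart])

lemma rot_lp: "rot B (lp k) = lp (Suc k)" by (simp add: lp_def)

lemma lp_6: "lp (k + 6) = lp k"
  unfolding lp_def by (rule B.rot_6[OF B.c_dart])

lemma lp_eq_iff: "k < 6 \<Longrightarrow> l < 6 \<Longrightarrow> lp k = lp l \<longleftrightarrow> k = l"
  unfolding lp_def by (rule B.rot_eq_iff[OF B.c_dart])

lemma opp_lp: "opp B (lp k) = lp (k + 3)"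
  using B.opp_eq[OF lp_dart, of k] by (simp add: lp_def funpow_add add.commute[of k])

lemma b_lp: "b 0 = lp 0" "b 1 = lp 2" "b 2 = lp 4"
proof -
  show "b 0 = lp 0" by (simp add: lp_def)
  show 1: "b 1 = lp 2" using rot_b[of 0] by (simp add: lp_def)
  have "b 2 = (rot B ^^ 2) (b 1)" using rot_b[of 1] by simp
  then show "b 2 = lp 4" unfolding 1 lp_def by (simp add: numeral_eq_Suc)
qed

lemma range_b: "range b = {lp 0, lp 2, lp 4}"
  by (simp add: UNIV_color b_lp)

lemma less_6: "k < 6 \<Longrightarrow> k = 0 \<or> k = 1 \<or> k = 2 \<or> k = 3 \<or> k = 4 \<or> k = (5::nat)"
  by linarith

lemma dart_lp: assumes "d \<in> darts B" obtains "d = lp 0" | "d = lp 1" | "d = lp 2" | "d = lp 3" | "d = lp 4" | "d = lp 5"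
proof -
  obtain k where "k < 6" "d = lp k"
    using B.rot_index[OF B.c_dart assms] unfolding lp_def by metis
  then show thesis using less_6[of k] that by blast
qed

text \<open>The corners are the darts \<open>lp k\<close> with even \<open>k\<close>, and
  \<open>opp B\<close> shifts \<open>k\<close> by 3, which changes parity. So the darts
  \<open>b i\<close> select one direction of each loop.\<close>

lemma loop_in_range:
  assumes "d \<in> darts B" shows "d \<in> range b \<longleftrightarrow> opp B d \<notin> range b"
  using assms
  by (cases rule: dart_lp)
    (use lp_6[of 0] lp_6[of 1] lp_6[of 2] in \<open>simp_all add: range_b opp_lp lp_eq_iff\<close>)

text \<open>The half-edge \<open>Inr i\<close> stands directly before \<open>b i\<close>, and
  \<open>b 0\<close>, \<open>b 1\<close>, \<open>b 2\<close> are \<open>lp 0\<close>,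
  \<open>lp 2\<close>, \<open>lp 4\<close>. Since \<open>lp k\<close> is joined to
  \<open>lp (k + 3)\<close>, these positions give the pairing in \<open>loop_opp\<close>.\<close>

definition pos :: "nat \<Rightarrow> 'b + 3" where
  "pos n = [Inr 0, Inl (lp 0), Inl (lp 1), Inr 1, Inl (lp 2), Inl (lp 3), Inr 2, Inl (lp 4), Inl (lp 5)] ! (n mod 9)"

lemma pos_simps:
  "pos 0 = Inr 0" "pos 1 = Inl (lp 0)" "pos 2 = Inl (lp 1)" "pos 3 = Inr 1" "pos 4 = Inl (lp 2)"
  "pos 5 = Inl (lp 3)" "pos 6 = Inr 2" "pos 7 = Inl (lp 4)" "pos 8 = Inl (lp 5)" "pos 9 = Inr 0"
  by (simp_all add: pos_def)

lemma less_9: "n < 9 \<Longrightarrow> n = 0 \<or> n = 1 \<or> n = 2 \<or> n = 3 \<or> n = 4 \<or> n = 5 \<or> n = 6 \<or> n = 7 \<or> n = (8::nat)"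
  by linarith

lemma pos_mod: "pos (n mod 9) = pos n" by (simp add: pos_def)

lemma rot_pos: "rot B.H (pos n) = pos (Suc n)"
proof -
  have e: "rot B.H (Inl (lp k)) = Inl (lp (Suc k))" if "lp (Suc k) \<notin> range b" for k
    using rot_suspension_Inl(2)[OF B.inj_c, of B "lp k"] that by (auto simp: rot_lp)
  have o: "rot B.H (Inl (lp k)) = Inr i" if "lp (Suc k) = b i" for k i
    using rot_suspension_Inl(1)[OF B.inj_c, of B "lp k" i] that by (simp add: rot_lp)
  have 6: "lp 6 = lp 0" using lp_6[of 0] by simp
  have "rot B.H (Inl (lp 0)) = Inl (lp 1)" "rot B.H (Inl (lp 2)) = Inl (lp 3)" "rot B.H (Inl (lp 4)) = Inl (lp 5)"
    using e[of 0] e[of 2] e[of 4] by (simp_all add: range_b lp_eq_iff)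
  moreover have "rot B.H (Inl (lp 1)) = Inr 1" "rot B.H (Inl (lp 3)) = Inr 2" "rot B.H (Inl (lp 5)) = Inr 0"
    using o[of 1 1] o[of 3 2] o[of 5 0] 6 by (simp_all add: b_lp numeral_2_eq_2)
  ultimately have *: "m = 0 \<or> m = 1 \<or> m = 2 \<or> m = 3 \<or> m = 4 \<or> m = 5 \<or> m = 6 \<or> m = 7 \<or> m = 8
      \<Longrightarrow> rot B.H (pos m) = pos (Suc m)" for m
    by (elim disjE) (simp_all add: pos_simps b_lp flip: One_nat_def)
  have "rot B.H (pos (n mod 9)) = pos (Suc (n mod 9))"
    by (rule *, rule less_9) simp
  then show ?thesis using pos_mod by (metis mod_Suc_eq)
qed

lemma pos_inj: "inj_on pos {..<9}"
proof (rule inj_onI)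
  fix m n assume "m \<in> {..<9}" "n \<in> {..<9}" and eq: "pos m = pos n"
  then have m: "m < 9" and n: "n < 9" by auto
  show "m = n"
    using less_9[OF m] less_9[OF n] eq
    by (elim disjE; simp only: pos_simps sum.simps lp_eq_iff; simp add: lp_eq_iff)
qed

lemma pos_range: "x \<in> darts B.H \<longleftrightarrow> (\<exists>n<9. x = pos n)"
proof
  assume x: "x \<in> darts B.H"
  have *: "\<exists>n<9. x = pos n" if "x \<in> pos ` {0, 1, 2, 3, 4, 5, 6, 7, 8}"
  proof -
    from that obtain n where n: "x = pos n" "n \<in> {0, 1, 2, 3, 4, 5, 6, 7, 8}" by (rule imageE)
    from n(2) have "n < 9" by auto
    then show ?thesis using n(1) by blast
  qed
  show "\<exists>n<9. x = pos n"
  proof (cases x)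
    case (Inl d)
    then have "d \<in> darts B" using x by auto
    then show ?thesis
      by (cases rule: dart_lp) (rule *, simp only: image_insert pos_simps Inl insert_iff simp_thms)+
  next
    case (Inr i)
    then show ?thesis using color_cases[of i]
      by (elim disjE) (rule *, simp only: image_insert pos_simps Inr insert_iff simp_thms)+
  qed
next
  assume "\<exists>n<9. x = pos n"
  then obtain n where "n < 9" "x = pos n" by blast
  then show "x \<in> darts B.H"
    using less_9[OF \<open>n < 9\<close>] unfolding \<open>x = pos n\<close> by (elim disjE) (simp_all add: pos_simps flip: One_nat_def)
qed

lemma cyclic_pos:
  assumes "i < 9" "j < 9" "k < 9"
  shows "cyclic_order (rot P) (Inr (pos i)) (Inr (pos j)) (Inr (pos k)) \<longleftrightarrow> ccw i j k"
proof -
  have "cyclic_order (rot P) (Inr (pos i)) (Inr (pos j)) (Inr (pos k))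
      \<longleftrightarrow> cyclic_order (rot B.H) (pos i) (pos j) (pos k)"
    by (rule cyclic_order_map[OF _ _ B.self_in_orbit_H]) simp_all
  also have "\<dots> \<longleftrightarrow> ccw i j k"
    by (rule cyclic_order_enum[OF rot_pos _ pos_inj assms]) (use pos_mod in \<open>metis mod_add_self2\<close>)
  finally show ?thesis .
qed

lemma opp_pos: "m \<in> {1, 2, 4, 5, 7, 8} \<Longrightarrow> opp P (Inr (pos m)) = Inr (pos (loop_opp m))"
  using lp_6[of 0] lp_6[of 1] lp_6[of 2]
  by (elim insertE) (simp_all add: loop_opp_def pos_simps opp_lp flip: One_nat_def)

lemma vertex_B_H: "x \<in> darts B.H \<Longrightarrow> vertex_of B.H x = darts B.H"
proof -
  assume x: "x \<in> darts B.H"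
  have "B.base y \<in> darts B" if "y \<in> darts B.H" for y using that by (cases y) auto
  then have "y \<in> vertex_of B.H x" if "y \<in> darts B.H" for y
    using that x B.vertex_H(3) B.vertex_H_eq_iff B.vertex_of_eq by simp
  then show ?thesis using B.vertex_H(2)[OF x] by blast
qed

abbreviation "hub \<equiv> Inr ` darts B.H"

lemma vertex_P_hub: "x \<in> darts B.H \<Longrightarrow> vertex_of P (Inr x) = hub"
  by (simp only: vertex_P_Inr vertex_B_H)

lemma hub_vertex: "hub \<in> vertices P"
  unfolding vertices_def by (rule image_eqI[of _ _ "Inr (Inr 0)"]) (subst vertex_P_hub, simp_all add: Plus_def)

end

text \<open>In both patterns every gap between consecutive outgoing darts contains exactly one of
  the positions 0, 3, 6, and the entering color of the gaps increases by one
  counterclockwise.\<close>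

lemma sector_colors:
  fixes n :: "3 \<Rightarrow> nat"
  assumes "(n 0, n 1, n 2) \<in> {(1, 4, 7), (4, 7, 1), (7, 1, 4), (2, 5, 8), (5, 8, 2), (8, 2, 5)}"
  obtains k where
    "\<And>i. sector (n (i + 1)) 0 (n (i - 1)) \<Longrightarrow> i = k"
    "\<And>i. sector (n (i + 1)) 3 (n (i - 1)) \<Longrightarrow> i = 1 + k"
    "\<And>i. sector (n (i + 1)) 6 (n (i - 1)) \<Longrightarrow> i = 2 + k"
proof -
  have "\<exists>k. \<forall>i. (sector (n (i + 1)) 0 (n (i - 1)) \<longrightarrow> i = k) \<and>
     (sector (n (i + 1)) 3 (n (i - 1)) \<longrightarrow> i = 1 + k) \<and> (sector (n (i + 1)) 6 (n (i - 1)) \<longrightarrow> i = 2 + k)"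
    (is "\<exists>k. ?Q k")
  proof -
    have "?Q 0 \<or> ?Q 1 \<or> ?Q 2"
      using assms unfolding all_color
      by (elim insertE emptyE) (simp_all add: color_consts sector_def ccw_def)
    then show ?thesis by blast
  qed
  then show thesis using that by blast
qed

section \<open>Restriction of a toroidal wood to the planar map\<close>

context torus_extension begin

lemma schnyder_at_hub:
  assumes oc: "orientation_coloring P g" and S: "schnyder_property P g hub"
  obtains k where "\<And>i. g (Inr (Inr i)) = None" "\<And>i. g (Inl (Inr i)) = Some (i + k)"
proof -
  obtain E where E: "schnyder_at P g hub E" using S by (auto simp: schnyder_property_iff)
  have E1: "E i \<in> hub" "g (E i) = Some i" for i using E unfolding schnyder_at_def by blast+
  have E2: "d = E i" if "d \<in> hub" "g d = Some i" for d i using E that unfolding schnyder_at_def by blast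
  have E3: "d = E (i + 1) \<or> d = E (i - 1) \<or> cyclic_order (rot P) (E (i + 1)) d (E (i - 1))"
    if "d \<in> hub" "opp P d \<noteq> d" "g (opp P d) = Some i" for d i
    using E that unfolding schnyder_at_def by blast
  have "\<exists>m<9. E i = Inr (pos m)" for i
  proof -
    have "E i \<in> hub" by (rule E1)
    then obtain x where "x \<in> darts B.H" "E i = Inr x" by (rule imageE)
    then show ?thesis unfolding pos_range by blast
  qed
  then obtain n where n: "\<And>i. n i < 9" "\<And>i. E i = Inr (pos (n i))" by metis
  have hub: "Inr (pos m) \<in> hub" if "m < 9" for m using that pos_range by blast
  have out: "\<exists>i. n i = m" if m: "m < 9" and g: "g (Inr (pos m)) \<noteq> None" for m
  proof -
    obtain i where "g (Inr (pos m)) = Some i" using g by auto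
    then have "Inr (pos m) = E i" by (rule E2[OF hub[OF m]])
    then have "pos m = pos (n i)" using n(2) by simp
    then have "m = n i" using inj_onD[OF pos_inj, of m "n i"] m n(1) by simp
    then show ?thesis by blast
  qed
  have En: "g (Inr (pos (n i))) = Some i" for i using E1(2)[of i] n(2)[of i] by simp
  have color: "(\<exists>i. P' i) \<longleftrightarrow> P' 0 \<or> P' 1 \<or> P' (2 :: 3)" for P' using color_cases by metis
  have loop: "(\<exists>i. n i = m) \<or> (\<exists>i. n i = loop_opp m)" if m: "m \<in> {1, 2, 4}" for m
  proof -
    have "m < 9" "loop_opp m < 9" "m \<in> {1, 2, 4, 5, 7, 8}" using m by (auto simp: loop_opp_def)
    moreover from this have "g (Inr (pos m)) \<noteq> None \<or> g (Inr (pos (loop_opp m))) \<noteq> None"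
    proof -
      have "pos m \<in> darts B.H" using \<open>m < 9\<close> pos_range by blast
      then have "Inr (pos m) \<in> darts P" by (simp only: G_plus_simps InrI)
      then show ?thesis
        using oc opp_pos[OF \<open>m \<in> {1, 2, 4, 5, 7, 8}\<close>] unfolding orientation_coloring_def by metis
    qed
    ultimately show ?thesis using out by blast
  qed
  have inc: "sector (n (i + 1)) m (n (i - 1))"
    if m: "m < 9" and ne: "opp P (Inr (pos m)) \<noteq> Inr (pos m)" and g: "g (opp P (Inr (pos m))) = Some i" for m i
  proof -
    have "Inr (pos m) = E (i + 1) \<or> Inr (pos m) = E (i - 1) \<or>
        cyclic_order (rot P) (E (i + 1)) (Inr (pos m)) (E (i - 1))"
      by (rule E3[OF hub[OF m] ne g])
    then show ?thesis
      unfolding n(2) cyclic_pos[OF n(1) m n(1)] sum.inject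
      using inj_onD[OF pos_inj, of m] m n(1) unfolding sector_def by auto
  qed
  have ones: "n 0 = 1 \<or> n 1 = 1 \<or> n 2 = 1 \<or> n 0 = 5 \<or> n 1 = 5 \<or> n 2 = 5"
    "n 0 = 2 \<or> n 1 = 2 \<or> n 2 = 2 \<or> n 0 = 7 \<or> n 1 = 7 \<or> n 2 = 7"
    "n 0 = 4 \<or> n 1 = 4 \<or> n 2 = 4 \<or> n 0 = 8 \<or> n 1 = 8 \<or> n 2 = 8"
    using loop[of 1] loop[of 2] loop[of 4] unfolding color by (auto simp: loop_opp_def)
  have n_loop: "n i \<in> {1, 2, 4, 5, 7, 8}" for i
  proof -
    have "n 0 \<in> {1, 2, 4, 5, 7, 8} \<and> n 1 \<in> {1, 2, 4, 5, 7, 8} \<and> n 2 \<in> {1, 2, 4, 5, 7, 8}"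
      using ones by (elim disjE) simp_all
    then show ?thesis using color_cases[of i] by auto
  qed
  have n_inc: "sector (n (i + 1)) (loop_opp (n i)) (n (i - 1))" for i
  proof (rule inc)
    have l: "loop_opp (n i) \<in> {1, 2, 4, 5, 7, 8}" "loop_opp (loop_opp (n i)) = n i" "loop_opp (n i) \<noteq> n i"
      using n_loop[of i] by (auto simp: loop_opp_def)
    show lt: "loop_opp (n i) < 9" using l(1) by auto
    have o: "opp P (Inr (pos (loop_opp (n i)))) = Inr (pos (n i))" using opp_pos[OF l(1)] l(2) by simp
    then show "g (opp P (Inr (pos (loop_opp (n i))))) = Some i" using En by simp
    show "opp P (Inr (pos (loop_opp (n i)))) \<noteq> Inr (pos (loop_opp (n i)))"
      using o inj_onD[OF pos_inj, of "n i" "loop_opp (n i)"] lt n(1) l(3) by auto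
  qed
  have "ccw (n 0) (n 1) (n 2)"
    using E cyclic_pos[OF n(1) n(1) n(1)] n(2) unfolding schnyder_at_def by simp
  then have cases: "(n 0, n 1, n 2) \<in> {(1, 4, 7), (4, 7, 1), (7, 1, 4), (2, 5, 8), (5, 8, 2), (8, 2, 5)}"
    using n_inc[of 0] n_inc[of 1] n_inc[of 2]
    by (intro loop_orientations[OF ones]) (simp_all add: color_consts)
  have None: "g (Inr (Inr i)) = None" for i
  proof (rule ccontr)
    assume g: "g (Inr (Inr i)) \<noteq> None"
    obtain m where m: "m \<in> {0, 3, 6}" "pos m = Inr i"
    proof -
      note that[of 0] that[of 3] that[of 6]
      then show thesis using color_cases[of i] by (elim disjE) (simp_all add: pos_simps(1,4,7))
    qed
    then have "\<exists>j. n j = m" using out[of m] g by auto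
    then obtain j where "n j = m" by blast
    then show False using n_loop[of j] m(1) by auto
  qed
  obtain k where k:
    "\<And>i. sector (n (i + 1)) 0 (n (i - 1)) \<Longrightarrow> i = k"
    "\<And>i. sector (n (i + 1)) 3 (n (i - 1)) \<Longrightarrow> i = 1 + k"
    "\<And>i. sector (n (i + 1)) 6 (n (i - 1)) \<Longrightarrow> i = 2 + k"
    using sector_colors[of n] cases by blast
  have "g (Inl (Inr j)) = Some (j + k)" for j
  proof -
    have "Inl (Inr j) \<in> darts P" "opp P (Inl (Inr j)) = Inr (Inr j)" by auto
    then have "g (Inl (Inr j)) \<noteq> None" using oc None[of j] unfolding orientation_coloring_def by metis
    then obtain i where i: "g (Inl (Inr j)) = Some i" by auto
    have s: "sector (n (i + 1)) m (n (i - 1))" if "m < 9" "pos m = Inr j" for m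
      using inc[OF that(1), of i] that(2) i by simp
    have "i = j + k"
      using color_cases[of j] s[of 0] s[of 3] s[of 6] k by (elim disjE) (simp_all add: pos_simps)
    then show ?thesis using i by simp
  qed
  then show thesis using None that by blast
qed

text \<open>A half-edge is its own reverse and must be colored itself. It is, because its edge in
  \<open>P\<close> is not oriented towards \<open>G\<close>.\<close>

lemma orientation_coloring_restrict:
  assumes oc: "orientation_coloring P g" and None: "\<And>i. g (Inr (Inr i)) = None"
  shows "orientation_coloring G.H (g \<circ> Inl)"
  unfolding orientation_coloring_def
proof (intro conjI allI ballI impI)
  fix d assume d: "d \<notin> darts G.H"
  have "Inl d \<notin> darts P" using d by (simp only: G_plus_simps Plus_def) blast
  then show "(g \<circ> Inl) d = None" using oc unfolding orientation_coloring_def by simp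
next
  fix d assume d: "d \<in> darts G.H"
  have dP: "Inl d \<in> darts P" using d by (simp only: G_plus_simps InlI)
  show "(g \<circ> Inl) d \<noteq> None \<or> (g \<circ> Inl) (opp G.H d) \<noteq> None"
  proof (cases d)
    case (Inl e)
    then show ?thesis using oc dP unfolding orientation_coloring_def by (metis G_plus_simps(4) comp_apply suspension_simps(2))
  next
    case (Inr i)
    then show ?thesis using oc dP None unfolding orientation_coloring_def by (metis G_plus_simps(5) comp_apply)
  qed
  assume "opp G.H d \<noteq> d"
  then obtain e where e: "d = Inl e" by (cases d) auto
  have "g (Inl d) \<noteq> g (opp P (Inl d))"
    using oc dP P(4)[OF dP] unfolding orientation_coloring_def by metis
  then show "(g \<circ> Inl) d \<noteq> (g \<circ> Inl) (opp G.H d)" using e by simp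
qed

text \<open>Nothing enters \<open>G\<close> along the new edges, and a half-edge does not count as
  entering, so the conditions on entering edges agree.\<close>

lemma schnyder_restrict:
  assumes v: "v \<subseteq> darts G.H" and None: "\<And>i. g (Inr (Inr i)) = None"
  shows "schnyder_property P g (Inl ` v) \<longleftrightarrow> schnyder_property G.H (g \<circ> Inl) v"
proof -
  have cyc: "cyclic_order (rot P) (Inl x) (Inl y) (Inl z) \<longleftrightarrow> cyclic_order (rot G.H) x y z" for x y z
    by (rule cyclic_order_map[OF _ _ G.self_in_orbit_H]) simp_all
  have opp: "opp P (Inl d) \<noteq> Inl d \<and> g (opp P (Inl d)) = Some i \<longleftrightarrow> opp G.H d \<noteq> d \<and> (g \<circ> Inl) (opp G.H d) = Some i" for d i
    using None by (cases d) auto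
  have at: "schnyder_at P g (Inl ` v) (Inl \<circ> e) \<longleftrightarrow> schnyder_at G.H (g \<circ> Inl) v e" for e
    unfolding schnyder_at_def ball_simps opp comp_def cyc sum.inject inj_image_mem_iff[OF inj_Inl] ..
  show ?thesis
  proof
    assume "schnyder_property P g (Inl ` v)"
    then obtain e where e: "schnyder_at P g (Inl ` v) e" by (auto simp: schnyder_property_iff)
    then have "\<forall>i. \<exists>x. e i = Inl x" unfolding schnyder_at_def by blast
    then obtain e' where "e = Inl \<circ> e'" by (metis comp_apply ext)
    then show "schnyder_property G.H (g \<circ> Inl) v" using e at by (auto simp: schnyder_property_iff)
  next
    assume "schnyder_property G.H (g \<circ> Inl) v"
    then show "schnyder_property P g (Inl ` v)" using at unfolding schnyder_property_iff by blast
  qed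
qed

lemma mono_cycle_Inl:
  assumes None: "\<And>i. g (Inr (Inr i)) = None"
  shows "mono_cycle P g i (map Inl ds) \<and> (\<forall>j. Inr j \<notin> set ds) \<longleftrightarrow> mono_cycle G.H (g \<circ> Inl) i ds"
proof (cases "\<forall>j. Inr j \<notin> set ds")
  case True
  have vert: "vertex_of P (Inl x) = vertex_of P (Inl y) \<longleftrightarrow> vertex_of G.H x = vertex_of G.H y" for x y
    unfolding vertex_P_Inl by (simp add: inj_image_eq_iff)
  have opp: "opp P (Inl d) = Inl (opp G.H d)" if "d \<in> set ds" for d
    using True that by (cases d) auto
  have inj: "inj (\<lambda>x. Inl ` vertex_of G.H x) \<longleftrightarrow> inj (vertex_of G.H)"
    by (auto simp: inj_def inj_image_eq_iff)
  have 1: "set (map Inl ds) \<subseteq> darts P \<longleftrightarrow> set ds \<subseteq> darts G.H"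
    by (simp only: G_plus_simps set_map) blast
  have 2: "successively (\<lambda>d e. vertex_of P (opp P d) = vertex_of P e) (map Inl ds) \<longleftrightarrow>
      successively (\<lambda>d e. vertex_of G.H (opp G.H d) = vertex_of G.H e) ds"
    unfolding successively_map by (rule successively_cong) (simp_all add: opp vert)
  have 3: "distinct (map (vertex_of P) (map Inl ds)) \<longleftrightarrow> distinct (map (vertex_of G.H) ds)"
    unfolding distinct_map inj_on_def by (simp add: distinct_map inj_on_def vert)
  have 4: "(\<forall>d\<in>set (map Inl ds). opp P d \<noteq> d \<and> g d = Some i) \<longleftrightarrow> (\<forall>d\<in>set ds. opp G.H d \<noteq> d \<and> (g \<circ> Inl) d = Some i)"
    using opp by simp
  have 5: "ds \<noteq> [] \<Longrightarrow> vertex_of P (opp P (last (map Inl ds))) = vertex_of P (hd (map Inl ds)) \<longleftrightarrow>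
      vertex_of G.H (opp G.H (last ds)) = vertex_of G.H (hd ds)"
    by (simp add: last_map hd_map opp vert)
  show ?thesis using True 5 unfolding mono_cycle_def is_walk_def 1 2 3 4 by auto
next
  case False
  then show ?thesis unfolding mono_cycle_def by auto
qed

text \<open>Every colored dart leaving the new vertex is a loop, so a cycle through this vertex
  closes at once. All other cycles avoid the new edges, after which they would have to continue at
  the new vertex.\<close>

lemma mono_cycle_cases:
  assumes None: "\<And>i. g (Inr (Inr i)) = None" and C: "mono_cycle P g i es"
  obtains d where "es = [Inr d]" "d \<in> darts B.H"
  | ds where "es = map Inl ds" "mono_cycle G.H (g \<circ> Inl) i ds"
proof -
  have dart: "x \<in> darts P" "g x = Some i" if "x \<in> set es" for x
    using C that by (auto simp: mono_cycle_def is_walk_def simp del: G_plus_simps)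
  show thesis
  proof (cases "\<exists>y. Inr y \<in> set es")
    case True
    then obtain y where y: "Inr y \<in> set es" by blast
    obtain d where d: "y = Inl d" using dart(2)[OF y] None by (cases y) auto
    have yB: "y \<in> darts B.H" using dart(1)[OF y] by (simp only: G_plus_simps) blast
    have "z = Inr y" if z: "z \<in> set es" for z
    proof (rule mono_cycle_induct[where Q = "\<lambda>z. z = Inr y", OF C y refl z])
      fix u w assume u: "u \<in> set es" "w \<in> set es" "vertex_of P (opp P u) = vertex_of P w" "u = Inr y"
      have "opp P u = Inr (opp B.H y)" using u(4) d by simp
      then have "vertex_of P (opp P u) = vertex_of P (Inr y)"
        using vertex_P_hub yB B.opp_H_darts[OF yB] by metis
      then show "w = Inr y" using mono_cycle_inj[OF C u(2) y] u(3) by simp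
    qed
    then have "set es = {Inr y}" using y by blast
    moreover have "distinct es" using C by (auto simp: mono_cycle_def distinct_map)
    ultimately have "length es = 1" using distinct_card[of es] by simp
    then have "es = [Inr y]" using y by (auto simp: length_Suc_conv)
    then show thesis using that(1) yB by blast
  next
    case False
    have "\<forall>x\<in>set es. \<exists>y. x = Inl y"
    proof
      fix x assume "x \<in> set es"
      then have "x \<noteq> Inr y" for y using False by blast
      then show "\<exists>y. x = Inl y" by (cases x) auto
    qed
    then obtain ds where ds: "es = map Inl ds" by (metis ex_map_conv)
    have "Inr j \<notin> set ds" for j
    proof
      assume "Inr j \<in> set ds"
      then have "Inl (Inr j) \<in> set es" using ds by simp
      from mono_cycle_next[OF C this] obtain e where
        e: "e \<in> set es" "vertex_of P (opp P (Inl (Inr j))) = vertex_of P e" .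
      have "vertex_of P (Inr (Inr j)) = hub" by (rule vertex_P_hub) simp
      then have "vertex_of P e = hub" using e(2) by simp
      then have "e \<in> hub" using vertex_P(1)[of e] by simp
      then show False using False e(1) by blast
    qed
    then have "mono_cycle G.H (g \<circ> Inl) i ds" using mono_cycle_Inl[where g = g, OF None] C ds by blast
    then show thesis using that(2) ds by blast
  qed
qed

end

section \<open>The bijection\<close>

context torus_extension begin

text \<open>Edge \<open>i\<close> arrives in color \<open>i\<close> between \<open>b (i - 1)\<close>
  and \<open>b i\<close>, and must lie in the sector from the outgoing dart of color
  \<open>i + 1\<close> to that of color \<open>i - 1\<close>. This gives \<open>b i\<close> the
  color \<open>i - 1\<close>.\<close>

definition extension :: "('a + 3 \<Rightarrow> color option) \<Rightarrow> ('a + 3) + ('b + 3) \<Rightarrow> color option" where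
  "extension f x = (case x of
     Inl y \<Rightarrow> f y
   | Inr (Inl d) \<Rightarrow> if d \<in> range b then Some (inv b d - 1) else None
   | Inr (Inr i) \<Rightarrow> None)"

lemma extension_simps [simp]:
  "extension f (Inl y) = f y" "extension f (Inr (Inr i)) = None"
  "extension f (Inr (Inl (b i))) = Some (i - 1)"
  "d \<notin> range b \<Longrightarrow> extension f (Inr (Inl d)) = None"
  using B.inj_c by (simp_all add: extension_def)

lemma extension_Inl: "extension f \<circ> Inl = f" by (simp add: fun_eq_iff)

lemma orientation_coloring_extension:
  assumes f: "orientation_coloring G.H f" and half: "\<And>i. f (Inr i) = Some i"
  shows "orientation_coloring P (extension f)"
proof -
  have f0: "f d = None" if "d \<notin> darts G.H" for d using f that unfolding orientation_coloring_def by blast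
  have f1: "f d \<noteq> None \<or> f (opp G.H d) \<noteq> None" if "d \<in> darts G.H" for d
    using f that unfolding orientation_coloring_def by blast
  have f2: "f d \<noteq> f (opp G.H d)" if "d \<in> darts G.H" "opp G.H d \<noteq> d" for d
    using f that unfolding orientation_coloring_def by blast
  have bd: "b i \<in> darts B" for i by simp
  have "extension f x = None" if "x \<notin> darts P" for x
  proof -
    consider y where "x = Inl y" | d where "x = Inr (Inl d)" | i where "x = Inr (Inr i)" by (metis sum.exhaust)
    then show ?thesis
    proof cases
      case (1 y)
      then have "y \<notin> darts G.H" using that InlI[of y "darts G.H"] by (auto simp only: G_plus_simps)
      then show ?thesis using f0[of y] 1 by simp
    next
      case (2 d)
      then have "d \<notin> darts B" using that by auto
      then have "d \<notin> range b" using bd by blast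
      then show ?thesis using 2 by simp
    qed simp
  qed
  moreover have "(extension f x \<noteq> None \<or> extension f (opp P x) \<noteq> None) \<and> extension f x \<noteq> extension f (opp P x)"
    if x: "x \<in> darts P" for x
  proof -
    consider d where "x = Inl (Inl d)" "d \<in> darts G" | i where "x = Inl (Inr i)"
      | d where "x = Inr (Inl d)" "d \<in> darts B" | i where "x = Inr (Inr i)"
      using x by auto
    then show ?thesis
    proof cases
      case (1 d)
      then show ?thesis using f1[of "Inl d"] f2[of "Inl d"] G.M(4) by auto
    next
      case (3 d)
      show ?thesis
      proof (cases "d \<in> range b")
        case True
        then show ?thesis using 3 loop_in_range[of d] by auto
      next
        case False
        then have "opp B d \<in> range b" using 3 loop_in_range[of d] by blast
        then show ?thesis using 3 False by auto
      qed
    qed (simp_all add: half)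
  qed
  ultimately show ?thesis unfolding orientation_coloring_def by blast
qed

lemma schnyder_extension_hub:
  assumes half: "\<And>i. f (Inr i) = Some i"
  shows "schnyder_property P (extension f) hub"
proof -
  let ?g = "extension f"
  define E :: "3 \<Rightarrow> ('a + 3) + ('b + 3)" where "E i = Inr (Inl (b (i + 1)))" for i
  have E: "E 0 = Inr (pos 4)" "E 1 = Inr (pos 7)" "E 2 = Inr (pos 1)" "E 3 = Inr (pos 4)" "E (- 1) = Inr (pos 1)"
    by (simp_all add: E_def pos_simps b_lp color_consts flip: One_nat_def)
  have out: "?g (Inr (pos m)) = (if m = 1 then Some 2 else if m = 4 then Some 0 else if m = 7 then Some 1 else None)"
    if "m < 9" for m
  proof -
    have "?g (Inr (Inl (lp 0))) = Some 2" "?g (Inr (Inl (lp 2))) = Some 0" "?g (Inr (Inl (lp 4))) = Some 1"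
      using extension_simps(3)[of f 0] extension_simps(3)[of f 1] extension_simps(3)[of f 2]
      by (simp_all add: b_lp color_consts)
    moreover have "?g (Inr (Inl (lp 1))) = None" "?g (Inr (Inl (lp 3))) = None" "?g (Inr (Inl (lp 5))) = None"
      using extension_simps(4)[of _ f] by (simp_all add: range_b lp_eq_iff)
    ultimately show ?thesis
      using less_9[OF that] by (elim disjE) (simp_all add: pos_simps flip: One_nat_def)
  qed
  have opp_h: "opp P (Inr (pos 0)) = Inl (Inr 0)" "opp P (Inr (pos 3)) = Inl (Inr 1)" "opp P (Inr (pos 6)) = Inl (Inr 2)"
    by (simp_all add: pos_simps)
  have hub_pos: "\<exists>m<9. d = Inr (pos m)" if "d \<in> hub" for d
    using that pos_range by blast
  have "schnyder_at P ?g hub E"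
    unfolding schnyder_at_def
  proof (intro conjI ballI allI impI)
    fix i show "E i \<in> hub" by (auto simp: E_def)
    show "?g (E i) = Some i" by (simp add: E_def)
  next
    fix d i assume d: "d \<in> hub" "?g d = Some i"
    obtain m where m: "m < 9" "d = Inr (pos m)" using hub_pos[OF d(1)] by blast
    show "d = E i" using d(2) out[OF m(1)] m(2) E by (auto split: if_splits)
  next
    show "cyclic_order (rot P) (E 0) (E 1) (E 2)"
      unfolding E by (subst cyclic_pos) (simp_all add: ccw_def)
  next
    fix d i assume d: "d \<in> hub" "opp P d \<noteq> d \<and> ?g (opp P d) = Some i"
    obtain m where m: "m < 9" "d = Inr (pos m)" using hub_pos[OF d(1)] by blast
    \<comment> \<open>The entering edges as pairs of position and color: the new edges at 0, 3, 6
      and the ends of the loops leaving at 1, 4, 7. All lie strictly inside their sectors.\<close>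
    have "(m, i) \<in> {(0, 0), (3, 1), (6, 2), (5, 2), (8, 0), (2, 1)}"
      using less_9[OF m(1)] d(2) unfolding m(2)
      by (elim disjE) (simp_all add: opp_h opp_pos loop_opp_def out half flip: One_nat_def)
    then have "cyclic_order (rot P) (E (i + 1)) d (E (i - 1))"
      unfolding m(2) by (elim insertE emptyE) (simp_all add: E color_consts cyclic_pos ccw_def flip: One_nat_def)
    then show "d = E (i + 1) \<or> d = E (i - 1) \<or> cyclic_order (rot P) (E (i + 1)) d (E (i - 1))" by blast
  qed
  then show ?thesis unfolding schnyder_property_iff by blast
qed

lemma extension_wood:
  assumes f: "planar_schnyder_wood G c f"
  shows "toroidal_schnyder_wood P (extension f)"
proof -
  let ?g = "extension f"
  have oc: "orientation_coloring G.H f" and half: "f (Inr i) = Some i"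
    and S: "v \<in> vertices G.H \<Longrightarrow> schnyder_property G.H f v" and no: "\<not> mono_cycle G.H f i ds" for v i ds
    using f unfolding planar_schnyder_wood_def by blast+
  have None: "\<And>i. ?g (Inr (Inr i)) = None" by simp
  have "schnyder_property P ?g v" if "v \<in> vertices P" for v
  proof -
    have "v \<in> (`) Inl ` vertices G.H \<or> v \<in> (`) Inr ` vertices B.H" using that vertices_P by blast
    then show ?thesis
    proof
      assume "v \<in> (`) Inl ` vertices G.H"
      then obtain w where w: "w \<in> vertices G.H" "v = Inl ` w" by blast
      then have "w \<subseteq> darts G.H" using G.vertex_H(2) unfolding vertices_def by blast
      then have "schnyder_property P ?g (Inl ` w) \<longleftrightarrow> schnyder_property G.H (?g \<circ> Inl) w"
        by (rule schnyder_restrict) simp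
      then show ?thesis using S[OF w(1)] w(2) extension_Inl by simp
    next
      assume "v \<in> (`) Inr ` vertices B.H"
      then obtain w where w: "w \<in> vertices B.H" "v = Inr ` w" by blast
      then obtain x where "x \<in> darts B.H" "w = vertex_of B.H x" unfolding vertices_def by blast
      then have "v = hub" using w(2) vertex_B_H by simp
      then show ?thesis using schnyder_extension_hub[OF half] by simp
    qed
  qed
  \<comment> \<open>Since \<open>f\<close> has no monochromatic cycle, \<open>ds\<close> is a loop
    at the new vertex, and \<open>b (j + 1)\<close> is a loop of any required color \<open>j\<close>
    there.\<close>
  moreover have "\<exists>es. mono_cycle P ?g j es \<and> cycles_intersect P ds es" if C: "mono_cycle P ?g i ds" for i j ds
  proof -
    let ?l = "Inr (Inl (b (j + 1)))"
    obtain d where d: "ds = [Inr d]" "d \<in> darts B.H"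
      using mono_cycle_cases[OF None C] no unfolding extension_Inl by metis
    have l: "Inl (b (j + 1)) \<in> darts B.H" "opp B.H (Inl (b (j + 1))) \<in> darts B.H"
      using B.M(7) by auto
    have lP: "?l \<in> darts P" using l(1) by (simp only: G_plus_simps InrI)
    have "vertex_of P ?l = hub" using vertex_P_hub[OF l(1)] .
    moreover have "vertex_of P (opp P ?l) = hub" using vertex_P_hub[OF l(2)] by simp
    ultimately have "mono_cycle P ?g j [?l]"
      using lP P(4)[OF lP] by (simp add: mono_cycle_def is_walk_def del: G_plus_simps(1))
    moreover have "cycles_intersect P ds [?l]"
      using vertex_P_hub[OF d(2)] vertex_P_hub[OF l(1)] d(1) by (simp add: cycles_intersect_def)
    ultimately show ?thesis by blast
  qed
  ultimately show ?thesis
    using orientation_coloring_extension[OF oc half] unfolding toroidal_schnyder_wood_def by blast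
qed

lemma wood_hub:
  assumes "toroidal_schnyder_wood P g"
  obtains k where "\<And>i. g (Inr (Inr i)) = None" "\<And>i. g (Inl (Inr i)) = Some (i + k)"
  using schnyder_at_hub[of g] assms hub_vertex unfolding toroidal_schnyder_wood_def by blast

lemma restricted_wood:
  assumes g: "toroidal_schnyder_wood P g"
  obtains k where "planar_schnyder_wood G c (shift_colors (- k) (g \<circ> Inl))"
proof -
  obtain k where None: "\<And>i. g (Inr (Inr i)) = None" and half: "\<And>i. g (Inl (Inr i)) = Some (i + k)"
    using wood_hub[OF g] by blast
  have oc: "orientation_coloring G.H (g \<circ> Inl)"
    using g by (intro orientation_coloring_restrict None) (simp add: toroidal_schnyder_wood_def)
  have S: "schnyder_property G.H (g \<circ> Inl) v" if v: "v \<in> vertices G.H" for v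
  proof -
    have "v \<subseteq> darts G.H" using v G.vertex_H(2) unfolding vertices_def by blast
    moreover have "schnyder_property P g (Inl ` v)"
      using g v vertices_P unfolding toroidal_schnyder_wood_def by blast
    ultimately show ?thesis using schnyder_restrict[where g = g, OF _ None] by blast
  qed
  have "c i \<in> orbit (face_next G) (c 0)" for i
    using color_cases[of i] self_in_face_G[of "c 0"] cyclic_order_mem(1,2)[OF self_in_face_G outer] by auto
  then interpret W: suspended_wood G c "g \<circ> Inl"
    by unfold_locales (use planar oc S in blast)+
  \<comment> \<open>A cycle meeting a cycle of \<open>G\<close> is itself in \<open>G\<close>,
    because all others are loops at the new vertex. Hence (T2) passes to the suspension.\<close>
  have transfer: "\<exists>es. mono_cycle G.H (g \<circ> Inl) j es \<and> cycles_intersect G.H ds es"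
    if C: "mono_cycle G.H (g \<circ> Inl) i ds"
      and ex: "\<exists>es. mono_cycle P g j es \<and> cycles_intersect P (map Inl ds) es" for i j ds
  proof -
    obtain es where D: "mono_cycle P g j es" and I: "cycles_intersect P (map Inl ds) es" using ex by blast
    show ?thesis
    proof (cases rule: mono_cycle_cases[OF None D])
      case (1 d)
      have "vertex_of P (Inr d) \<in> vertex_of P ` set (map Inl ds)"
        using I unfolding 1(1) cycles_intersect_def by auto
      then obtain u where "Inr ` vertex_of B.H d = Inl ` vertex_of G.H u"
        unfolding set_map image_image vertex_P_Inl vertex_P_Inr by blast
      then show ?thesis using B.vertex_H(1)[of d] by blast
    next
      case (2 es')
      have "cycles_intersect G.H ds es'"
        using I unfolding 2(1) cycles_intersect_def set_map image_image vertex_P_Inl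
        by (auto simp: inj_image_eq_iff)
      then show ?thesis using 2(2) by blast
    qed
  qed
  have no: "\<not> mono_cycle G.H (g \<circ> Inl) i ds" for i ds
  proof (rule W.no_mono_cycle)
    fix i ds assume C: "mono_cycle G.H (g \<circ> Inl) i ds"
    then have "mono_cycle P g i (map Inl ds)" using mono_cycle_Inl[where g = g, OF None] by blast
    then have "\<exists>es. mono_cycle P g (i - 1) es \<and> cycles_intersect P (map Inl ds) es"
      "\<exists>es. mono_cycle P g (i + 1) es \<and> cycles_intersect P (map Inl ds) es"
      using g unfolding toroidal_schnyder_wood_def by blast+
    then show "(\<exists>es. mono_cycle G.H (g \<circ> Inl) (i - 1) es \<and> cycles_intersect G.H ds es) \<and>
        (\<exists>es. mono_cycle G.H (g \<circ> Inl) (i + 1) es \<and> cycles_intersect G.H ds es)"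
      using transfer[OF C] by blast
  qed
  have "planar_schnyder_wood G c (shift_colors (- k) (g \<circ> Inl))"
    unfolding planar_schnyder_wood_def orientation_coloring_shift mono_cycle_shift
      schnyder_property_shift[OF G.self_in_orbit_H]
    using oc S no half by simp
  then show thesis by (rule that)
qed

section \<open>Extensions of a planar wood as an equivalence class\<close>

lemma toroidal_extensions_iff:
  assumes f: "planar_schnyder_wood G c f"
  shows "g \<in> toroidal_extensions G c B b f \<longleftrightarrow>
    toroidal_schnyder_wood P g \<and> (\<exists>k. g \<circ> Inl = shift_colors k f)"
proof -
  have "(\<forall>d\<in>darts G.H. g (Inl d) = map_option (\<lambda>i. i + k) (f d)) \<longleftrightarrow> g \<circ> Inl = shift_colors k f"
    if g: "toroidal_schnyder_wood P g" for k
  proof -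
    have "g (Inl d) = None \<and> f d = None" if "d \<notin> darts G.H" for d
    proof
      have "Inl d \<notin> darts P" using that by (simp only: G_plus_simps Plus_def) blast
      then show "g (Inl d) = None" using g unfolding toroidal_schnyder_wood_def orientation_coloring_def by blast
      show "f d = None" using f that unfolding planar_schnyder_wood_def orientation_coloring_def by blast
    qed
    then show ?thesis unfolding fun_eq_iff shift_colors_def comp_def by (metis option.map(1))
  qed
  then show ?thesis unfolding toroidal_extensions_def by blast
qed

text \<open>Outside \<open>G\<close> only the new edges directed away from the new vertex are
  compared, and every wood leaves these uncolored. So the class of a wood is determined by its
  restriction to \<open>G\<close> up to a shift.\<close>

lemma wood_equiv_iff:
  assumes g: "toroidal_schnyder_wood P g" and h: "toroidal_schnyder_wood P h"
  shows "(g, h) \<in> wood_equiv G c B b \<longleftrightarrow> (\<exists>k. h \<circ> Inl = shift_colors k (g \<circ> Inl))"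
proof -
  have "(\<forall>d\<in>darts P - range (Inr \<circ> Inl). h d = map_option (\<lambda>i. i + k) (g d)) \<longleftrightarrow>
      h \<circ> Inl = shift_colors k (g \<circ> Inl)" (is "?L \<longleftrightarrow> ?R") for k
  proof
    assume L: ?L
    have "h (Inl d) = map_option (\<lambda>i. i + k) (g (Inl d))" for d
    proof (cases "Inl d \<in> darts P")
      case True
      then show ?thesis using L by auto
    next
      case False
      then have "g (Inl d) = None" "h (Inl d) = None"
        using g h unfolding toroidal_schnyder_wood_def orientation_coloring_def by blast+
      then show ?thesis by simp
    qed
    then show ?R by (simp add: fun_eq_iff shift_colors_def)
  next
    assume R: ?R
    have "h d = map_option (\<lambda>i. i + k) (g d)" if d: "d \<in> darts P - range (Inr \<circ> Inl)" for d
    proof -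
      consider y where "d = Inl y" | i where "d = Inr (Inr i)" using d by auto
      then show ?thesis
      proof cases
        case (1 y)
        then show ?thesis using fun_cong[OF R, of y] by (simp add: shift_colors_def)
      next
        case (2 i)
        obtain k1 k2 where "g (Inr (Inr i)) = None" "h (Inr (Inr i)) = None"
          using wood_hub[OF g] wood_hub[OF h] by metis
        then show ?thesis using 2 by simp
      qed
    qed
    then show ?L by blast
  qed
  then show ?thesis using g h unfolding wood_equiv_def by blast
qed

lemma toroidal_extensions_class:
  assumes f: "planar_schnyder_wood G c f" and g: "g \<in> toroidal_extensions G c B b f"
  shows "toroidal_extensions G c B b f = wood_equiv G c B b `` {g}"
proof (intro set_eqI iffI)
  obtain k where wg: "toroidal_schnyder_wood P g" and k: "g \<circ> Inl = shift_colors k f"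
    using g toroidal_extensions_iff[OF f] by blast
  have f': "f = shift_colors (- k) (g \<circ> Inl)" unfolding k by simp
  fix h
  {
    assume "h \<in> toroidal_extensions G c B b f"
    then obtain l where wh: "toroidal_schnyder_wood P h" and "h \<circ> Inl = shift_colors l f"
      using toroidal_extensions_iff[OF f] by blast
    then have "h \<circ> Inl = shift_colors (- k + l) (g \<circ> Inl)" by (subst (asm) f') simp
    then show "h \<in> wood_equiv G c B b `` {g}" using wood_equiv_iff[OF wg wh] by blast
  next
    assume "h \<in> wood_equiv G c B b `` {g}"
    then have gh: "(g, h) \<in> wood_equiv G c B b" by simp
    then have wh: "toroidal_schnyder_wood P h" by (simp add: wood_equiv_def)
    from gh obtain l where "h \<circ> Inl = shift_colors l (g \<circ> Inl)" using wood_equiv_iff[OF wg wh] by blast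
    then have "h \<circ> Inl = shift_colors (k + l) f" unfolding k by simp
    then show "h \<in> toroidal_extensions G c B b f" using toroidal_extensions_iff[OF f] wh by blast
  }
qed

lemma extension_in_extensions:
  assumes f: "planar_schnyder_wood G c f"
  shows "extension f \<in> toroidal_extensions G c B b f"
  using toroidal_extensions_iff[OF f] extension_wood[OF f] extension_Inl shift_colors_simps(3) by metis

lemma bij_toroidal_extensions:
  "bij_betw (toroidal_extensions G c B b) {f. planar_schnyder_wood G c f}
     ({g. toroidal_schnyder_wood P g} // wood_equiv G c B b)"
  unfolding bij_betw_def
proof
  show "inj_on (toroidal_extensions G c B b) {f. planar_schnyder_wood G c f}"
  proof (rule inj_onI)
    fix f f' assume "f \<in> {f. planar_schnyder_wood G c f}" "f' \<in> {f. planar_schnyder_wood G c f}"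
      and eq: "toroidal_extensions G c B b f = toroidal_extensions G c B b f'"
    then have f: "planar_schnyder_wood G c f" and f': "planar_schnyder_wood G c f'" by auto
    have "extension f \<in> toroidal_extensions G c B b f'" using extension_in_extensions[OF f] eq by simp
    then have "\<exists>k. extension f \<circ> Inl = shift_colors k f'"
      using toroidal_extensions_iff[OF f'] by blast
    then obtain k where k: "f = shift_colors k f'" unfolding extension_Inl by blast
    \<comment> \<open>The prescribed color of a root half-edge in both planar woods rules out a
      nontrivial shift.\<close>
    have "f (Inr 0) = Some 0" "f' (Inr 0) = Some 0"
      using f f' unfolding planar_schnyder_wood_def by blast+
    then have "k = 0" using fun_cong[OF k, of "Inr 0"] by (simp add: shift_colors_def)
    then show "f = f'" using k by simp
  qed
  show "toroidal_extensions G c B b ` {f. planar_schnyder_wood G c f} =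
      {g. toroidal_schnyder_wood P g} // wood_equiv G c B b"
  proof (intro equalityI subsetI)
    fix X assume "X \<in> toroidal_extensions G c B b ` {f. planar_schnyder_wood G c f}"
    then obtain f where f: "planar_schnyder_wood G c f" "X = toroidal_extensions G c B b f" by blast
    have "X = wood_equiv G c B b `` {extension f}"
      using toroidal_extensions_class[OF f(1) extension_in_extensions[OF f(1)]] f(2) by simp
    then show "X \<in> {g. toroidal_schnyder_wood P g} // wood_equiv G c B b"
      using extension_wood[OF f(1)] by (auto intro: quotientI)
  next
    fix X assume "X \<in> {g. toroidal_schnyder_wood P g} // wood_equiv G c B b"
    then obtain g where g: "toroidal_schnyder_wood P g" "X = wood_equiv G c B b `` {g}"
      by (auto elim: quotientE)
    obtain k where f: "planar_schnyder_wood G c (shift_colors (- k) (g \<circ> Inl))" (is "planar_schnyder_wood _ _ ?f")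
      using restricted_wood[OF g(1)] .
    have "g \<circ> Inl = shift_colors k ?f" by simp
    then have "g \<in> toroidal_extensions G c B b ?f" using toroidal_extensions_iff[OF f] g(1) by blast
    from toroidal_extensions_class[OF f this]
    show "X \<in> toroidal_extensions G c B b ` {f. planar_schnyder_wood G c f}" using f g(2) by blast
  qed
qed

end

theorem theorem4:
  fixes G :: "'a cmap" and c :: "3 \<Rightarrow> 'a" and B :: "'b cmap" and b :: "3 \<Rightarrow> 'b"
  assumes "planar_map G"
    and "range c \<subseteq> darts G" and "inj (\<lambda>i. vertex_of G (c i))"
    and "cyclic_order (face_next G) (c 0) (c 1) (c 2)"
    and "toroidal_map B" and "card (vertices B) = 1" and "card (edges B) = 3"
    and "range b \<subseteq> darts B" and "inj b"
    and "toroidal_map (G_plus G c B b)"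
  shows "bij_betw (toroidal_extensions G c B b)
           {f. planar_schnyder_wood G c f}
           ({g. toroidal_schnyder_wood (G_plus G c B b) g} // wood_equiv G c B b)"
proof -
  have "inj c" using assms(3) by (auto simp: inj_def)
  then interpret torus_extension G c B b
    using assms by unfold_locales (simp_all add: planar_map_def toroidal_map_def)
  show ?thesis by (rule bij_toroidal_extensions)
qed

end
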